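(* Let $H=h^5$ and let $F_6(x,H)=\sum_{k\ge0}R_k(x)H^{k+1}$ be the reduced sixth-order generating function defined in the context. Then there is a polynomial $P_{6,1}(H,F)\in\mathbb Q[H,F]$ of degree $10$ in $F$, irreducible over $\mathbb Q(H)$ as a polynomial in $F$, such that the specialization at $x=1$ satisfies $P_{6,1}(H,F_6(1,H))=0$, $$P_{6,1}(0,F)=\frac{F\,(125F+32)^5\,(125F^2+75F+11)^2}{5^{21}},$$ and the Galois group over $\mathbb Q$ of the specialized polynomial $P_{6,1}(1,F)\in\mathbb Q[F]$ is the full symmetric group $S_{10}$.
   Context: The rational functions $R_k(x)$ are defined by $R_0(x)=\frac45\frac{x}{1+x}$ and, for $k\ge1$, $$x\frac{d^6}{dx^6}R_{k-1}(x)=\frac{(5k+5)(5k+1)(5k)(5k-1)(5k-2)(5k-3)}{25}R_k(x).$$ All $R_k$ are regular at $x=1$, and $F_6(1,H)=\sum_{k\ge0}R_k(1)H^{k+1}\in\mathbb Q[[H]]$. *)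

theory Defs
  imports
    "HOL-Algebra.Bij"
    "HOL-Algebra.Sym_Groups"
    "HOL-Algebra.Generated_Fields"
    "HOL-Algebra.Algebraic_Closure_Type"
    "HOL-Computational_Algebra.Computational_Algebra"
    "HOL-Computational_Algebra.Field_as_Ring"
begin

section \<open>Rational functions in one variable over the rationals\<close>

text \<open>
  The field \<open>\<rat>(x)\<close> is the type \<^typ>\<open>rat poly fract\<close>. The function \<^const>\<open>quot_of_fract\<close>
  returns the reduced numerator and the monic reduced denominator.
\<close>

abbreviation ratfun_X :: "rat poly fract" where
  "ratfun_X \<equiv> to_fract [:0, 1:]"

abbreviation ratfun_const :: "rat \<Rightarrow> rat poly fract" where
  "ratfun_const c \<equiv> to_fract [:c:]"

definition ratfun_deriv :: "rat poly fract \<Rightarrow> rat poly fract" where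
  "ratfun_deriv f =
     (case quot_of_fract f of (p, q) \<Rightarrow>
        Fraction_Field.Fract (pderiv p * q - p * pderiv q) (q * q))"

definition ratfun_regular :: "rat poly fract \<Rightarrow> rat \<Rightarrow> bool" where
  "ratfun_regular f a \<longleftrightarrow> poly (snd (quot_of_fract f)) a \<noteq> 0"

text \<open>This is the value of \<open>f\<close> at \<open>a\<close> only if \<open>f\<close> is regular at \<open>a\<close>; at a pole it is \<open>0\<close>.\<close>

definition ratfun_eval :: "rat poly fract \<Rightarrow> rat \<Rightarrow> rat" where
  "ratfun_eval f a =
     (case quot_of_fract f of (p, q) \<Rightarrow> poly p a / poly q a)"

lemma quot_of_fract_Fract_scale:
  fixes a b :: "rat poly"
  assumes "b \<noteq> 0"
  obtains d where "a = fst (quot_of_fract (Fraction_Field.Fract a b)) * d"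
    "b = snd (quot_of_fract (Fraction_Field.Fract a b)) * d" "d \<noteq> 0"
proof -
  have "quot_of_fract (Fraction_Field.Fract a b) = normalize_quot (a, b)"
    using quot_of_fract_quot_to_fract[of "(a, b)"] by (simp add: quot_to_fract_def)
  then show ?thesis
    using that normalize_quotE[OF assms, of a] by metis
qed

lemma ratfun_deriv_Fract:
  assumes "b \<noteq> 0"
  shows "ratfun_deriv (Fraction_Field.Fract a b) =
           Fraction_Field.Fract (pderiv a * b - a * pderiv b) (b * b)"
proof -
  obtain p q where pq: "quot_of_fract (Fraction_Field.Fract a b) = (p, q)"
    by fastforce
  obtain d where d: "a = p * d" "b = q * d" "d \<noteq> 0"
    using quot_of_fract_Fract_scale[OF assms, of a] pq by (metis fst_conv snd_conv)
  have q: "q \<noteq> 0" using d assms by auto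
  have "ratfun_deriv (Fraction_Field.Fract a b) =
          Fraction_Field.Fract (pderiv p * q - p * pderiv q) (q * q)"
    by (simp add: ratfun_deriv_def pq)
  also have "\<dots> = Fraction_Field.Fract (pderiv a * b - a * pderiv b) (b * b)"
    using q d(3) unfolding d(1,2) by (simp add: eq_fract pderiv_mult algebra_simps)
  finally show ?thesis .
qed

lemma ratfun_eval_Fract:
  assumes "poly b x \<noteq> 0"
  shows "ratfun_eval (Fraction_Field.Fract a b) x = poly a x / poly b x"
proof -
  obtain p q where pq: "quot_of_fract (Fraction_Field.Fract a b) = (p, q)"
    by fastforce
  have "b \<noteq> 0" using assms by auto
  then obtain d where d: "a = p * d" "b = q * d"
    using quot_of_fract_Fract_scale[of b a] pq by (metis fst_conv snd_conv)
  have "ratfun_eval (Fraction_Field.Fract a b) x = poly p x / poly q x"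
    by (simp add: ratfun_eval_def pq)
  also have "\<dots> = poly a x / poly b x"
    using assms unfolding d by simp
  finally show ?thesis .
qed

lemma ratfun_regular_Fract:
  assumes "poly b x \<noteq> 0"
  shows "ratfun_regular (Fraction_Field.Fract a b) x"
proof -
  have "b \<noteq> 0" using assms by auto
  then obtain d where "b = snd (quot_of_fract (Fraction_Field.Fract a b)) * d"
    using quot_of_fract_Fract_scale[of b a] by metis
  then show ?thesis
    using assms unfolding ratfun_regular_def by (metis mult_zero_left poly_mult)
qed

lemma ratfun_regularE:
  assumes "ratfun_regular f x"
  obtains a b where "f = Fraction_Field.Fract a b" "poly b x \<noteq> 0"
proof (rule that)
  show "f = Fraction_Field.Fract (fst (quot_of_fract f)) (snd (quot_of_fract f))"
    using quot_to_fract_quot_of_fract[of f] by (simp add: quot_to_fract_def case_prod_unfold)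
  show "poly (snd (quot_of_fract f)) x \<noteq> 0"
    using assms by (simp add: ratfun_regular_def)
qed

lemma ratfun_regular_deriv:
  assumes "ratfun_regular f x"
  shows "ratfun_regular (ratfun_deriv f) x"
proof -
  obtain a b where ab: "f = Fraction_Field.Fract a b" "poly b x \<noteq> 0"
    using assms by (rule ratfun_regularE)
  then have "b \<noteq> 0" by auto
  with ab show ?thesis
    by (simp add: ratfun_deriv_Fract ratfun_regular_Fract)
qed

lemma ratfun_regular_funpow_deriv:
  "ratfun_regular f x \<Longrightarrow> ratfun_regular ((ratfun_deriv ^^ n) f) x"
  by (induction n) (auto intro: ratfun_regular_deriv)

section \<open>The reduced sixth-order generating function\<close>

definition R_factor :: "nat \<Rightarrow> rat" where
  "R_factor k =
     (5 * of_nat k + 5) * (5 * of_nat k + 1) * (5 * of_nat k) *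
     (5 * of_nat k - 1) * (5 * of_nat k - 2) * (5 * of_nat k - 3) / 25"

primrec R :: "nat \<Rightarrow> rat poly fract" where
  "R 0 = ratfun_const (4 / 5) * (ratfun_X / (1 + ratfun_X))"
| "R (Suc k) = ratfun_X * (ratfun_deriv ^^ 6) (R k) / ratfun_const (R_factor (Suc k))"

lemma R_factor_nonzero:
  assumes "k \<ge> 1"
  shows "R_factor k \<noteq> 0"
proof -
  have "(of_nat k :: rat) \<ge> 1" using assms by simp
  then show ?thesis unfolding R_factor_def by simp
qed

lemma R_0_Fract: "R 0 = Fraction_Field.Fract [:0, 4 / 5:] [:1, 1:]"
  by (simp add: to_fract_def One_fract_def one_pCons)

lemma R_recursion:
  assumes "k \<ge> 1"
  shows "ratfun_X * (ratfun_deriv ^^ 6) (R (k - 1)) = ratfun_const (R_factor k) * R k"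
proof -
  obtain j where "k = Suc j" using assms by (cases k) auto
  moreover have "ratfun_const (R_factor k) \<noteq> 0"
    using R_factor_nonzero[OF assms] by simp
  ultimately show ?thesis by (simp del: funpow.simps)
qed

lemma R_regular_at_one: "ratfun_regular (R k) 1"
proof (induction k)
  case 0
  show ?case unfolding R_0_Fract by (rule ratfun_regular_Fract) simp
next
  case (Suc k)
  obtain a b where ab: "(ratfun_deriv ^^ 6) (R k) = Fraction_Field.Fract a b" "poly b 1 \<noteq> 0"
    using ratfun_regular_funpow_deriv[OF Suc.IH] by (rule ratfun_regularE)
  have "R (Suc k) = Fraction_Field.Fract ([:0, 1:] * a) (b * [:R_factor (Suc k):])"
    using ab(1) by (simp add: to_fract_def del: funpow.simps)
  moreover have "poly (b * [:R_factor (Suc k):]) 1 \<noteq> 0"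
    using ab(2) R_factor_nonzero[of "Suc k"] by simp
  ultimately show ?case by (metis ratfun_regular_Fract)
qed

text \<open>\<open>F6\<close> is \<open>F\<^sub>6(x,H)\<close>, a power series in \<open>H\<close> with coefficients in \<open>\<rat>(x)\<close>.\<close>

definition F6 :: "rat poly fract fps" where
  "F6 = Abs_fps (\<lambda>n. case n of 0 \<Rightarrow> 0 | Suc k \<Rightarrow> R k)"

definition F6_at :: "rat \<Rightarrow> rat fps" where
  "F6_at a = Abs_fps (\<lambda>n. ratfun_eval (fps_nth F6 n) a)"

lemma F6_at_one_nth: "fps_nth (F6_at 1) (Suc 0) = 2 / 5"
  by (simp add: F6_at_def F6_def R_0_Fract ratfun_eval_Fract del: R.simps)

section \<open>Bivariate polynomials\<close>

text \<open>
  An element of \<open>\<rat>[H,F]\<close> is a \<^typ>\<open>rat poly poly\<close>: the outer variable is \<open>F\<close> and the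
  coefficients are polynomials in \<open>H\<close>.
\<close>

definition specialize_H :: "rat \<Rightarrow> rat poly poly \<Rightarrow> rat poly" where
  "specialize_H a P = map_poly (\<lambda>c. poly c a) P"

definition eval_at_series :: "rat poly poly \<Rightarrow> rat fps \<Rightarrow> rat fps" where
  "eval_at_series P S = poly (map_poly fps_of_poly P) S"

section \<open>Galois groups of rational polynomials\<close>

definition splitting_field :: "rat poly \<Rightarrow> complex set" where
  "splitting_field f =
     generate_field ring_of_type_algebra {z. poly (map_poly of_rat f) z = 0}"

text \<open>The group operation inherited from \<^const>\<open>BijGroup\<close> is composition of maps.\<close>

definition galois_group :: "rat poly \<Rightarrow> (complex \<Rightarrow> complex) monoid" where
  "galois_group f =
     (let L = ring_of_type_algebra\<lparr>carrier := splitting_field f\<rparr> in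
      BijGroup (carrier L)
        \<lparr>carrier := {\<sigma> \<in> ring_hom L L \<inter> Bij (carrier L).
                       \<forall>q::rat. \<sigma> (of_rat q) = of_rat q}\<rparr>)"

end

theory Submission
  imports Defs "Jordan_Normal_Form.Char_Poly"
begin

text \<open>
  Let \<open>\<sigma> \<in> \<rat>(x)[[H]]\<close> be the solution of \<open>(\<sigma>\<^sup>5 - 1) (\<sigma> + x)\<^sup>5 = 25 H \<sigma>\<^sup>5\<close> with \<open>\<sigma>(0) = 1\<close>. Lagrange
  inversion and the recursion give \<open>(5 k + 1) R\<^sub>k = - 4/125 [H\<^bsup>k+1\<^esup>] (\<sigma> + x)\<^sup>5\<close> for \<open>k \<ge> 1\<close>. At \<open>x = 1\<close> this is a
  first order differential equation for \<open>F = F\<^sub>6(1,H)\<close>, with the rational solution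
  \<open>125 F + 32 = (s + 1)\<^sup>4 (5 s\<^sup>5 + s - 4) / s\<^sup>5\<close> on the curve \<open>25 H s\<^sup>5 = (s\<^sup>5 - 1) (s + 1)\<^sup>5\<close>; the polynomial \<open>P\<close>
  is the characteristic polynomial of \<open>F\<close> over \<open>\<rat>(H)\<close>.

  At \<open>H = 1\<close> the ten values of \<open>s\<close> are the roots of a monic integer polynomial. It has no rational
  root, it is a linear factor times an irreducible factor of degree 9 modulo 7, and it has factors of
  degrees 1, 2, 7 modulo 47. By Dedekind's theorem its Galois group is 2-transitive and contains a
  transposition, so it is the full symmetric group. The values \<open>F(s)\<close> are permuted in the same way and
  are distinct: by 2-transitivity they would otherwise all coincide, but \<open>F(s)\<close> has degree 9 in \<open>s\<close>.
  Transitivity makes \<open>P(1,F)\<close> irreducible, and as \<open>P\<close> is monic in \<open>F\<close>, it is irreducible over \<open>\<rat>(H)\<close>.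
\<close>

section \<open>Lagrange inversion over \<open>\<rat>(x)\<close>\<close>

text \<open>Both sides of the comparison are products of Euler operators \<theta>/5 + j with
  \<theta> = x d/dx. In the recursion they arise because d/dx shifts \<theta> by 1: five derivatives
  shift \<theta>/5 by exactly 1, and the sixth, multiplied by x, contributes \<theta> itself. In
  Lagrange inversion they come from iterating d/dw with w = x^(-5). The function (\<sigma> + x)^5 is
  the one whose coefficients carry the same powers (1 + x)^(-(5k+1)) as \<open>R k\<close>, and 5k+1
  is the eigenvalue of 5 H d/dH - 4 on H^(k+1), hence the differential equation. The group is
  computed for s and not for F because the equation of s is monic with small integer coefficients,
  while P(1,F) has denominators; since F(s) lies in Q(s), no reduction of F is needed. No finite
  field is constructed: the roots are algebraic integers modulo a prime ideal, and factorization
  statements become explicit inverses and Frobenius residues modulo p and a monic integer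
  polynomial.\<close>

lemma ratfun_cases:
  fixes f :: "rat poly fract"
  obtains a b where "f = Fraction_Field.Fract a b" "b \<noteq> 0"
  by (cases f) auto

lemma ratfun_deriv_add: "ratfun_deriv (f + g) = ratfun_deriv f + ratfun_deriv g"
proof -
  obtain a b where f: "f = Fraction_Field.Fract a b" "b \<noteq> 0" by (rule ratfun_cases)
  obtain c d where g: "g = Fraction_Field.Fract c d" "d \<noteq> 0" by (rule ratfun_cases)
  show ?thesis
    using f(2) g(2)
    by (simp add: f(1) g(1) ratfun_deriv_Fract eq_fract pderiv_mult pderiv_add algebra_simps)
qed

lemma ratfun_deriv_mult: "ratfun_deriv (f * g) = f * ratfun_deriv g + ratfun_deriv f * g"
proof -
  obtain a b where f: "f = Fraction_Field.Fract a b" "b \<noteq> 0" by (rule ratfun_cases)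
  obtain c d where g: "g = Fraction_Field.Fract c d" "d \<noteq> 0" by (rule ratfun_cases)
  show ?thesis
    using f(2) g(2)
    by (simp add: f(1) g(1) ratfun_deriv_Fract eq_fract pderiv_mult pderiv_add algebra_simps)
qed

lemma ratfun_deriv_const: "ratfun_deriv (ratfun_const c) = 0"
  by (simp add: to_fract_def ratfun_deriv_Fract Zero_fract_def pderiv_pCons)

lemma ratfun_deriv_X: "ratfun_deriv ratfun_X = 1"
  by (simp add: to_fract_def ratfun_deriv_Fract One_fract_def pderiv_pCons one_pCons)

text \<open>Shared by d/dx on Q(x), its coefficientwise extension to Q(x)[[H]], the operators
  \<open>Dt\<close> and \<open>Dw\<close>, and \<open>fps_deriv\<close> over Q.\<close>

locale derivation =
  fixes D :: "'a :: comm_ring_1 \<Rightarrow> 'a"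
  assumes add: "D (f + g) = D f + D g"
    and mult: "D (f * g) = f * D g + D f * g"
begin

lemma one [simp]: "D 1 = 0"
  using mult[of 1 1] by simp

lemma zero [simp]: "D 0 = 0"
  using add[of 0 0] by simp

lemma minus: "D (- f) = - D f"
  using add[of f "- f"] by (simp add: eq_neg_iff_add_eq_0 add.commute)

lemma diff: "D (f - g) = D f - D g"
  using add[of f "- g"] by (simp add: minus)

lemma of_nat [simp]: "D (of_nat n) = 0"
  by (induction n) (simp_all add: add)

lemma numeral [simp]: "D (numeral n) = 0"
  using of_nat[of "numeral n"] by simp

lemma power: "D (f ^ Suc n) = of_nat (Suc n) * f ^ n * D f"
  by (induction n) (simp_all add: mult algebra_simps)

lemma power_numeral: "D (f ^ numeral n) = numeral n * f ^ (pred_numeral n) * D f"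
  using power[of f "pred_numeral n"] by (metis numeral_eq_Suc of_nat_numeral)

lemma reciprocal:
  assumes "u * v = 1"
  shows "D u = - (u ^ 2) * D v"
proof -
  have "u * (u * D v + D u * v) = 0"
    using mult[of u v] assms by simp
  then have "D u * (u * v) = - (u ^ 2) * D v"
    by (simp add: algebra_simps power2_eq_square eq_neg_iff_add_eq_0)
  then show ?thesis by (simp add: assms)
qed

lemma funpow_add: "(D ^^ n) (f + g) = (D ^^ n) f + (D ^^ n) g"
  by (induction n) (simp_all add: add)

end

text \<open>
  Lagrange inversion: \<open>D\<^sub>t g = \<phi> D\<^sub>w g\<close> is the equation satisfied by every function of the
  solution \<open>z\<close> of \<open>z = w + t \<phi>(z)\<close>.
\<close>

lemma commuting_derivations_funpow:
  fixes Dt Dw :: "'a :: comm_ring_1 \<Rightarrow> 'a"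
  assumes "derivation Dt" "derivation Dw" and comm: "\<And>f. Dt (Dw f) = Dw (Dt f)"
    and phi: "Dt \<phi> = \<phi> * Dw \<phi>" and g: "Dt g = \<phi> * Dw g"
  shows "(Dt ^^ Suc k) g = (Dw ^^ k) (\<phi> ^ Suc k * Dw g)"
proof -
  interpret t: derivation Dt by fact
  interpret w: derivation Dw by fact
  have pow: "Dt (\<phi> ^ j) = \<phi> * Dw (\<phi> ^ j)" for j
    by (cases j) (simp_all add: t.power w.power phi del: power_Suc)
  \<comment> \<open>One \<open>Dt\<close> is traded for one \<open>Dw\<close> and one more factor
    \<phi>: the two terms of the product rule recombine because powers of \<phi> satisfy the same
    equation as g.\<close>
  have step: "Dt (\<phi> ^ j * Dw g) = Dw (\<phi> ^ Suc j * Dw g)" for j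
  proof -
    have "Dt (\<phi> ^ j * Dw g) = \<phi> ^ j * Dw (\<phi> * Dw g) + \<phi> * Dw (\<phi> ^ j) * Dw g"
      by (simp add: t.mult comm g pow)
    also have "\<dots> = Dw (\<phi> ^ j * (\<phi> * Dw g))"
      unfolding w.mult[of "\<phi> ^ j"] by (simp add: algebra_simps)
    finally show ?thesis by (simp add: mult_ac)
  qed
  have swap: "Dt ((Dw ^^ k) f) = (Dw ^^ k) (Dt f)" for k f
    by (induction k) (simp_all add: comm)
  show ?thesis
  proof (induction k)
    case 0
    then show ?case by (simp add: g)
  next
    case (Suc k)
    have "(Dt ^^ Suc (Suc k)) g = Dt ((Dw ^^ k) (\<phi> ^ Suc k * Dw g))"
      using Suc by simp
    also have "\<dots> = (Dw ^^ k) (Dw (\<phi> ^ Suc (Suc k) * Dw g))"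
      by (simp only: swap step)
    finally show ?case by (simp add: funpow_swap1)
  qed
qed

section \<open>Euler operators and a closed form for the rational functions
  \<open>R k\<close>\<close>

interpretation rf: derivation ratfun_deriv
  by unfold_locales (fact ratfun_deriv_add ratfun_deriv_mult)+

text \<open>\<open>theta_prod c k\<close> is \<open>(\<theta>/5 + c)(\<theta>/5 + c + 1) \<dots> (\<theta>/5 + c + k - 1)\<close> with \<open>\<theta> = x d/dx\<close>.\<close>

primrec theta_prod :: "rat poly fract \<Rightarrow> nat \<Rightarrow> rat poly fract \<Rightarrow> rat poly fract" where
  "theta_prod c 0 u = u"
| "theta_prod c (Suc k) u =
     ratfun_X * ratfun_deriv (theta_prod c k u) / 5 + (c + of_nat k) * theta_prod c k u"

lemma rf_deriv_divide_numeral: "ratfun_deriv (f / numeral n) = ratfun_deriv f / numeral n"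
proof -
  have "ratfun_deriv (numeral n * (f / numeral n)) = numeral n * ratfun_deriv (f / numeral n)"
    by (subst rf.mult) simp
  then show ?thesis by (simp add: field_simps)
qed

lemma ratfun_const_eq_of_rat: "ratfun_const c = of_rat c"
proof -
  have nat: "ratfun_const (of_nat n) = of_nat n" for n
    by (induction n) (simp_all add: of_nat_poly [symmetric] flip: of_nat_Suc, simp_all add: to_fract_def of_nat_fract of_nat_poly)
  have int: "ratfun_const (of_int n) = of_int n" for n
  proof (cases n)
    case (nonneg m) then show ?thesis using nat[of m] by simp
  next
    case (neg m)
    have "ratfun_const (of_int n) = - ratfun_const (of_nat (Suc m))"
      by (simp add: neg to_fract_def)
    then show ?thesis by (simp only: nat neg) simp
  qed
  obtain a b where c: "c = of_int a / of_int b" "b \<noteq> 0"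
    by (cases c) (auto simp: Fract_of_int_quotient)
  have "ratfun_const c * ratfun_const (of_int b) = ratfun_const (of_int a)"
    using c by (simp add: to_fract_def)
  then have "ratfun_const c = of_int a / of_int b"
    unfolding int using c(2) by (simp add: field_simps)
  also have "\<dots> = of_rat c" by (simp add: c of_rat_divide)
  finally show ?thesis .
qed


lemma rf_deriv_of_rat [simp]: "ratfun_deriv (of_rat c) = 0"
  using ratfun_deriv_const[of c] by (simp add: ratfun_const_eq_of_rat)

text \<open>From (d/dx) \<theta> = (\<theta> + 1) (d/dx), each factor \<theta>/5 + c + j moves up by
  1/5 when d/dx passes it.\<close>

lemma theta_prod_deriv:
  "ratfun_deriv (theta_prod c k u) = theta_prod (c + 1/5) k (ratfun_deriv u)"
  if "ratfun_deriv c = 0"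
proof (induction k)
  case (Suc k)
  have "ratfun_deriv (theta_prod c (Suc k) u) =
     ratfun_X * ratfun_deriv (ratfun_deriv (theta_prod c k u)) / 5
     + (c + 1/5 + of_nat k) * ratfun_deriv (theta_prod c k u)"
    by (simp add: rf.add rf.mult rf_deriv_divide_numeral ratfun_deriv_X that field_simps)
  then show ?case by (simp add: Suc)
qed simp

lemma theta_prod_funpow_deriv:
  assumes "ratfun_deriv c = 0"
  shows "(ratfun_deriv ^^ n) (theta_prod c k u) = theta_prod (c + of_nat n / 5) k ((ratfun_deriv ^^ n) u)"
proof (induction n)
  case (Suc n)
  have "ratfun_deriv (c + of_nat n / 5) = 0"
    by (simp add: rf.add assms rf_deriv_divide_numeral)
  from theta_prod_deriv[OF this] show ?case
    by (simp add: Suc add_divide_distrib add_ac)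
qed simp

text \<open>All factors are polynomials in \<theta> and commute, so x d/dx = 5 (\<theta>/5) can be
  inserted as the missing front factor.\<close>

lemma theta_prod_front:
  "ratfun_X * ratfun_deriv (theta_prod 1 k u) = 5 * theta_prod 0 (Suc k) u"
proof (induction k)
  case (Suc k)
  define v where "v = theta_prod 1 k u"
  have IH: "ratfun_X * ratfun_deriv v = 5 * theta_prod 0 (Suc k) u"
    using Suc by (simp add: v_def)
  have "ratfun_X * ratfun_deriv (theta_prod 1 (Suc k) u) =
     ratfun_X * ratfun_deriv (ratfun_X * ratfun_deriv v / 5 + (1 + of_nat k) * v)"
    by (simp add: v_def)
  also have "\<dots> = ratfun_X * ratfun_deriv (ratfun_X * ratfun_deriv v / 5)
      + (1 + of_nat k) * (ratfun_X * ratfun_deriv v)"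
    unfolding rf.add rf.mult[of "1 + of_nat k"] by (simp add: rf.add algebra_simps del: of_nat_Suc)
  also have "\<dots> = 5 * (ratfun_X * ratfun_deriv (theta_prod 0 (Suc k) u) / 5
      + (1 + of_nat k) * theta_prod 0 (Suc k) u)"
    unfolding IH by (simp del: theta_prod.simps add: algebra_simps)
  finally show ?case by (simp add: add_ac del: theta_prod.simps(2)) (simp add: add_ac)
qed simp

lemma theta_prod_scale: "ratfun_deriv a = 0 \<Longrightarrow> theta_prod c k (a * u) = a * theta_prod c k u"
  by (induction k) (simp_all add: rf.mult algebra_simps)

lemma ratfun_X_nonzero [simp]: "ratfun_X \<noteq> 0" by simp

lemma one_plus_ratfun_X: "1 + ratfun_X = Fraction_Field.Fract [:1, 1:] 1"
  by (simp add: to_fract_def One_fract_def one_pCons)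

lemma one_plus_ratfun_X_nonzero [simp]: "1 + ratfun_X \<noteq> 0"
  by (simp add: one_plus_ratfun_X Zero_fract_def eq_fract)

abbreviation "geom_ratfun \<equiv> inverse (1 + ratfun_X)"

lemma deriv_geom_power: "ratfun_deriv (geom_ratfun ^ Suc n) = - (of_nat (Suc n) * geom_ratfun ^ Suc (Suc n))"
proof -
  have "ratfun_deriv geom_ratfun = - (geom_ratfun ^ 2)"
    using rf.reciprocal[of geom_ratfun "1 + ratfun_X"] by (simp add: rf.add ratfun_deriv_X)
  then show ?thesis
    by (simp add: rf.power power2_eq_square del: power_Suc) (simp add: mult_ac)
qed

lemma funpow_deriv_geom_power:
  "(ratfun_deriv ^^ m) (geom_ratfun ^ Suc n) = (-1) ^ m * pochhammer (of_nat (Suc n)) m * geom_ratfun ^ (Suc n + m)"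
proof (induction m)
  case (Suc m)
  have c: "ratfun_deriv ((-1) ^ m * pochhammer (of_nat (Suc n)) m) = 0"
  proof -
    have "(-1) ^ m * pochhammer (of_nat (Suc n)) m = (of_rat ((-1) ^ m * pochhammer (of_nat (Suc n)) m) :: rat poly fract)"
      by (simp add: pochhammer_prod of_rat_mult of_rat_power of_rat_prod of_rat_add)
    then show ?thesis by (metis rf_deriv_of_rat)
  qed
  have "(ratfun_deriv ^^ Suc m) (geom_ratfun ^ Suc n) =
      (-1) ^ m * pochhammer (of_nat (Suc n)) m * ratfun_deriv (geom_ratfun ^ Suc (n + m))"
    using Suc c rf.mult[of "(-1) ^ m * pochhammer (of_nat (Suc n)) m" "geom_ratfun ^ Suc (n + m)"] by simp
  also have "\<dots> = (-1) ^ Suc m * pochhammer (of_nat (Suc n)) (Suc m) * geom_ratfun ^ (Suc n + Suc m)"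
    unfolding deriv_geom_power by (simp add: pochhammer_Suc algebra_simps)
  finally show ?case .
qed simp

text \<open>The scalar that remains of \<open>R k\<close> after the Euler product applied to (1 +
  x)^(-(5k+1)) is split off.\<close>

definition R_coeff :: "nat \<Rightarrow> rat" where
  "R_coeff k = - (4/5) * (-25) ^ k / (of_nat (5 * k + 1) * fact (Suc k))"

text \<open>The scalar part of the recursion: five derivatives of (1 + x)^(-(5k+1)) give (-1)^5
  times the Pochhammer symbol, and the last 5 comes from \<open>theta_prod_front\<close>.\<close>

lemma R_coeff_Suc:
  "R_coeff k * (-1) ^ 5 * pochhammer (of_nat (5 * k + 1)) 5 * 5 = R_coeff (Suc k) * R_factor (Suc k)"
proof -
  define n :: rat where "n = of_nat k"
  have n: "n \<ge> 0" by (simp add: n_def)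
  have p: "pochhammer (5 * n + 1) 5 = (5*n+1)*(5*n+2)*(5*n+3)*(5*n+4)*(5*n+5)"
    by (simp add: pochhammer_prod eval_nat_numeral atLeast0LessThan lessThan_Suc algebra_simps)
  have R: "R_factor (Suc k) = (5*n+10)*(5*n+6)*(5*n+5)*(5*n+4)*(5*n+3)*(5*n+2)/25"
    by (simp add: R_factor_def n_def algebra_simps)
  have ck: "R_coeff k * (5 * n + 1) = (- (4/5) * (-25) ^ k / fact (Suc k))"
    using n by (simp add: R_coeff_def n_def add_pos_nonneg divide_simps del: fact_Suc)
  have "R_coeff (Suc k) * (5*n+6) * (n+2) = (- (4/5) * (-25) ^ Suc k / ((5*n+6) * ((n+2) * fact (Suc k)))) * (5*n+6) * (n+2)"
    by (simp add: R_coeff_def n_def algebra_simps)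
  also have "\<dots> = - (4/5) * (-25) ^ Suc k / fact (Suc k)"
    using n by (simp add: divide_simps del: fact_Suc power_Suc)
  also have "\<dots> = (-25) * (- (4/5) * (-25) ^ k / fact (Suc k))" by simp
  finally have c1: "R_coeff (Suc k) * (5*n+6) * (n+2) = (-25) * (R_coeff k * (5 * n + 1))"
    unfolding ck .
  have "R_coeff k * (-1) ^ 5 * ((5*n+1)*(5*n+2)*(5*n+3)*(5*n+4)*(5*n+5)) * 5
     = (-25) * (R_coeff k * (5 * n + 1)) * ((5*n+2)*(5*n+3)*(5*n+4)*(5*n+5)) / 5"
    by simp
  also have "\<dots> = R_coeff (Suc k) * (5*n+6) * (n+2) * ((5*n+2)*(5*n+3)*(5*n+4)*(5*n+5)) / 5"
    unfolding c1 by simp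
  also have "\<dots> = R_coeff (Suc k) * R_factor (Suc k)"
    unfolding R by (simp add: field_simps)
  finally show ?thesis using p by (simp add: n_def add_ac)
qed

text \<open>Five of the six derivatives turn \<open>theta_prod 0\<close> into
  \<open>theta_prod 1\<close> and raise the exponent of 1/(1 + x) by 5; the sixth, together with x,
  restores the front factor. The extra 4/5 is the constant in x/(1 + x) = 1 - 1/(1 + x) and
  disappears under differentiation.\<close>

lemma R_closed_form:
  "R k = of_rat (R_coeff k) * theta_prod 0 k (geom_ratfun ^ (5 * k + 1)) + (if k = 0 then 4/5 else 0)"
proof (induction k)
  case 0
  have "ratfun_X / (1 + ratfun_X) = 1 - geom_ratfun"
    by (simp add: field_simps)
  then have "R 0 = 4/5 * (1 - geom_ratfun)"
    by (simp add: ratfun_const_eq_of_rat of_rat_divide)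
  then show ?case
    by (simp add: R_coeff_def of_rat_divide of_rat_minus algebra_simps)
next
  case (Suc k)
  let ?c = "of_rat (R_coeff k) :: rat poly fract"
  have kill: "(ratfun_deriv ^^ 5) (if k = 0 then 4/5 else 0) = 0"
    by (simp add: eval_nat_numeral rf_deriv_divide_numeral)
  have scale: "(ratfun_deriv ^^ m) (of_rat c * u) = of_rat c * (ratfun_deriv ^^ m) u" for m c u
    by (induction m) (simp_all add: rf.mult)
  define p :: rat where "p = (-1) ^ 5 * pochhammer (of_nat (5 * k + 1)) 5"
  have p: "(-1) ^ 5 * pochhammer (of_nat (Suc (5 * k))) 5 = (of_rat p :: rat poly fract)"
    by (simp add: p_def pochhammer_prod of_rat_mult of_rat_power of_rat_prod of_rat_add of_rat_minus)
  have "(ratfun_deriv ^^ 5) (R k) = ?c * theta_prod 1 k ((ratfun_deriv ^^ 5) (geom_ratfun ^ (5 * k + 1)))"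
    unfolding Suc by (simp add: rf.funpow_add kill scale theta_prod_funpow_deriv del: funpow.simps)
  also have "(ratfun_deriv ^^ 5) (geom_ratfun ^ (5 * k + 1)) = of_rat p * geom_ratfun ^ (5 * Suc k + 1)"
    using funpow_deriv_geom_power[of 5 "5 * k"] unfolding p by (simp add: add_ac del: funpow.simps)
  finally have d5: "(ratfun_deriv ^^ 5) (R k) = of_rat (R_coeff k * p) * theta_prod 1 k (geom_ratfun ^ (5 * Suc k + 1))"
    by (simp add: theta_prod_scale of_rat_mult)
  have "ratfun_X * (ratfun_deriv ^^ 6) (R k) = ratfun_X * ratfun_deriv ((ratfun_deriv ^^ 5) (R k))"
    by (simp add: eval_nat_numeral)
  also have "\<dots> = of_rat (R_coeff k * p) * (ratfun_X * ratfun_deriv (theta_prod 1 k (geom_ratfun ^ (5 * Suc k + 1))))"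
    unfolding d5 by (simp add: rf.mult)
  also have "\<dots> = of_rat (R_coeff k * p * 5) * theta_prod 0 (Suc k) (geom_ratfun ^ (5 * Suc k + 1))"
    unfolding theta_prod_front by (simp add: of_rat_mult)
  also have "R_coeff k * p * 5 = R_coeff (Suc k) * R_factor (Suc k)"
    using R_coeff_Suc[of k] by (simp add: p_def mult_ac)
  finally show ?case
    using R_factor_nonzero[of "Suc k"]
    by (simp add: ratfun_const_eq_of_rat of_rat_mult del: funpow.simps theta_prod.simps)
qed

section \<open>Two commuting derivations of Q(x)[[H]]\<close>

lemma (in derivation) sum: "D (sum f A) = (\<Sum>a\<in>A. D (f a))"
  by (induction A rule: infinite_finite_induct) (simp_all add: add)

definition fps_coeff_deriv :: "rat poly fract fps \<Rightarrow> rat poly fract fps" where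
  "fps_coeff_deriv f = Abs_fps (\<lambda>n. ratfun_deriv (fps_nth f n))"

lemma fps_coeff_deriv_nth [simp]: "fps_nth (fps_coeff_deriv f) n = ratfun_deriv (fps_nth f n)"
  by (simp add: fps_coeff_deriv_def)

interpretation md: derivation fps_coeff_deriv
  by unfold_locales
    (simp_all add: fps_eq_iff rf.add rf.sum fps_mult_nth rf.mult sum.distrib)

lemma md_const: "fps_coeff_deriv (fps_const c) = fps_const (ratfun_deriv c)"
  by (simp add: fps_eq_iff)

lemma md_X: "fps_coeff_deriv fps_X = 0"
  by (simp add: fps_eq_iff fps_X_def)

lemma md_deriv: "fps_coeff_deriv (fps_deriv f) = fps_deriv (fps_coeff_deriv f)"
  by (simp add: fps_eq_iff rf.mult del: of_nat_Suc of_nat_add)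

text \<open>
  In the coordinates \<open>t = 25 H / x\<^sup>5\<close> and \<open>w = 1 / x\<^sup>5\<close>, \<open>Dt\<close> is \<open>d/dt\<close> at fixed \<open>w\<close> and \<open>Dw\<close> is
  \<open>d/dw\<close> at fixed \<open>t\<close>.
\<close>

definition Dt :: "rat poly fract fps \<Rightarrow> rat poly fract fps" where
  "Dt f = fps_const (ratfun_X ^ 5 / 25) * fps_deriv f"

definition Dw :: "rat poly fract fps \<Rightarrow> rat poly fract fps" where
  "Dw f = - fps_const (ratfun_X ^ 5 / 5) *
            (fps_const ratfun_X * fps_coeff_deriv f + 5 * fps_X * fps_deriv f)"

interpretation Dt: derivation Dt
  by unfold_locales (simp_all add: Dt_def algebra_simps)

interpretation Dw: derivation Dw
  by unfold_locales (simp_all add: Dw_def md.add md.mult algebra_simps)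

lemma md_const_mult: "fps_coeff_deriv (fps_const c * f) = fps_const c * fps_coeff_deriv f + fps_const (ratfun_deriv c) * f"
  by (simp add: md.mult md_const)

text \<open>Partial derivatives in independent coordinates commute. In the computation the term 5 f'
  comes on one side from differentiating H and on the other from x d/dx applied to x^5/25.\<close>

lemma Dt_Dw: "Dt (Dw f) = Dw (Dt f)"
proof -
  define c where "c = fps_const (ratfun_X ^ 5 / 25)"
  define x where "x = fps_const ratfun_X"
  define f' where "f' = fps_deriv f"
  define f'' where "f'' = fps_deriv f'"
  define m where "m = fps_coeff_deriv f'"
  have c5: "fps_const (ratfun_X ^ 5 / 5) = 5 * c"
    by (simp add: c_def numeral_fps_const)
  have dc: "x * fps_const (ratfun_deriv (ratfun_X ^ 5 / 25)) = 5 * c"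
    by (simp add: c_def x_def numeral_fps_const rf_deriv_divide_numeral rf.power_numeral ratfun_deriv_X)
       (simp add: eval_nat_numeral)
  have cc: "fps_deriv c = 0" "fps_deriv x = 0" by (simp_all add: c_def x_def)
  have e1: "Dt (Dw f) = - (5 * c * c) * (x * m + 5 * f' + 5 * fps_X * f'')"
    unfolding Dt_def Dw_def c5 c_def [symmetric] x_def [symmetric]
    by (simp add: cc m_def f'_def f''_def md_deriv algebra_simps)
  have e2: "Dw (Dt f) = - (5 * c) * (c * x * m + (5 * c) * f' + 5 * fps_X * (c * f''))"
  proof -
    have "Dw (Dt f) = - (5 * c) * (x * (c * m + fps_const (ratfun_deriv (ratfun_X ^ 5 / 25)) * f') + 5 * fps_X * (c * f''))"
    unfolding Dt_def Dw_def c5 md_const_mult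
    unfolding c_def [symmetric] x_def [symmetric]
    by (simp add: cc m_def f'_def f''_def md_deriv)
    then show ?thesis
      unfolding dc [symmetric] by (simp only: distrib_left mult_ac)
  qed
  show ?thesis unfolding e1 e2 by (simp add: algebra_simps)
qed

text \<open>The solutions of \<open>Dt f = \<phi> * Dw f\<close> are closed under products, powers
  and inverses, so the equation passes from r to \<phi> = (r/(r+1))^5 itself, as Lagrange inversion
  requires.\<close>

lemma Dt_eq_mult:
  assumes "Dt f = \<phi> * Dw f" "Dt g = \<phi> * Dw g"
  shows "Dt (f * g) = \<phi> * Dw (f * g)"
  using assms by (simp add: Dt.mult Dw.mult algebra_simps)

lemma Dt_eq_power:
  assumes "Dt f = \<phi> * Dw f"
  shows "Dt (f ^ n) = \<phi> * Dw (f ^ n)"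
  by (induction n) (simp_all add: Dt_eq_mult assms)

lemma Dt_eq_reciprocal:
  assumes "Dt v = \<phi> * Dw v" "u * v = 1"
  shows "Dt u = \<phi> * Dw u"
  using assms by (simp add: Dt.reciprocal[OF assms(2)] Dw.reciprocal[OF assms(2)])

section \<open>The implicit series and its Lagrange coefficients\<close>

text \<open>With r = a + v the equation reads \<psi>(v) = X for a power series \<psi> without
  constant term. Its linear coefficient 5 (a+1)^5 / (a c) is nonzero because a is neither 0 nor -1,
  so v is the compositional inverse of \<psi>.\<close>

lemma ex_implicit_series:
  fixes a c :: "'a :: field_char_0"
  assumes a: "a \<noteq> 0" "a \<noteq> -1" and c: "c \<noteq> 0"
  obtains r where "fps_nth r 0 = a"
    "(r ^ 5 - fps_const a ^ 5) * (r + 1) ^ 5 = fps_const c * fps_X * r ^ 5"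
proof -
  define A where "A = fps_const a + fps_X"
  define N where "N = (A ^ 5 - fps_const a ^ 5) * (A + 1) ^ 5"
  define \<psi> where "\<psi> = N * inverse (A ^ 5) * fps_const (1 / c)"
  define v where "v = fps_inv \<psi>"
  have A0: "fps_nth (A ^ 5) 0 \<noteq> 0" using a by (simp add: A_def)
  have N1: "fps_deriv N $ 0 = 5 * a ^ 4 * (a + 1) ^ 5"
    by (simp add: N_def A_def fps_deriv_power eval_nat_numeral)
  have N: "fps_nth N 0 = 0" "fps_nth N 1 = 5 * a ^ 4 * (a + 1) ^ 5"
    using N1 by (simp_all add: N_def A_def fps_power_zeroth)
  have psi0: "fps_nth \<psi> 0 = 0" by (simp add: \<psi>_def N)
  have "fps_nth \<psi> 1 = 5 * a ^ 4 * (a + 1) ^ 5 * inverse (a ^ 5) * (1 / c)"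
    unfolding \<psi>_def using N by (simp add: fps_mult_nth A_def fps_power_zeroth)
  also have "\<dots> \<noteq> 0" using a c by (simp add: eq_neg_iff_add_eq_0)
  finally have inv: "\<psi> oo v = fps_X"
    unfolding v_def by (intro fps_inv_right psi0)
  have v0: "fps_nth v 0 = 0" by (simp add: v_def fps_inv_def)
  have "\<psi> * A ^ 5 * fps_const c = N * (inverse (A ^ 5) * A ^ 5) * (fps_const (1 / c) * fps_const c)"
    by (simp add: \<psi>_def)
  also have "\<dots> = N"
    unfolding inverse_mult_eq_1[OF A0] using c by simp
  finally have "(\<psi> * A ^ 5 * fps_const c) oo v = N oo v" by simp
  moreover have "A oo v = fps_const a + v"
    by (simp add: A_def fps_compose_add_distrib v0)
  ultimately have "fps_X * (fps_const a + v) ^ 5 * fps_const c =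
      ((fps_const a + v) ^ 5 - fps_const a ^ 5) * (fps_const a + v + 1) ^ 5"
    by (simp add: N_def fps_compose_mult_distrib v0 inv fps_compose_power [symmetric]
        fps_compose_add_distrib fps_compose_sub_distrib del: fps_const_power)
  then show thesis
    using that[of "fps_const a + v"] v0 by (simp add: mult_ac)
qed

lemma funpow_Dt: "(Dt ^^ n) f = fps_const (ratfun_X ^ 5 / 25) ^ n * fps_nth_deriv n f"
proof (induction n)
  case (Suc n)
  have "(Dt ^^ Suc n) f = fps_const (ratfun_X ^ 5 / 25) * (fps_const (ratfun_X ^ 5 / 25) ^ n * fps_deriv (fps_nth_deriv n f))"
    by (simp add: Suc Dt_def del: fps_nth_deriv.simps)
  then show ?case by (simp only: fps_nth_deriv_commute power_Suc mult_ac)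
qed simp

text \<open>d/dw on functions of x alone, where w = x^(-5); this is the action of \<open>Dw\<close>
  on constant terms.\<close>

definition dw0 :: "rat poly fract \<Rightarrow> rat poly fract" where
  "dw0 u = - (ratfun_X ^ 6 / 5) * ratfun_deriv u"

lemma funpow_Dw_nth_0: "fps_nth ((Dw ^^ n) f) 0 = (dw0 ^^ n) (fps_nth f 0)"
  by (induction n) (simp_all add: Dw_def dw0_def eval_nat_numeral)

lemma funpow_Dt_nth_0: "fps_nth ((Dt ^^ n) f) 0 = (ratfun_X ^ 5 / 25) ^ n * fact n * fps_nth f n"
  by (simp add: funpow_Dt fps_const_power fps_deriv_maclauren_0)

text \<open>d/dw = - x^5 (\<theta>/5), and moving the accumulated x^(5k) to the left shifts
  \<theta>/5 by k. This is where the Euler products of the closed form reappear.\<close>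

lemma funpow_dw0: "(dw0 ^^ k) u = ratfun_X ^ (5 * k) * (-1) ^ k * theta_prod 0 k u"
proof (induction k)
  case (Suc k)
  define v where "v = theta_prod 0 k u"
  have d: "ratfun_X * ratfun_deriv (ratfun_X ^ n) = of_nat n * ratfun_X ^ n" for n
    by (cases n) (simp_all add: rf.power ratfun_deriv_X algebra_simps del: power_Suc, simp)
  have "ratfun_X * ratfun_deriv (ratfun_X ^ (5 * k) * (-1) ^ k * v) =
     (-1) ^ k * ((ratfun_X * ratfun_deriv (ratfun_X ^ (5 * k))) * v + ratfun_X ^ (5 * k) * (ratfun_X * ratfun_deriv v))"
  proof -
    have "ratfun_deriv ((-1) ^ k) = 0"
      by (cases k) (simp_all add: rf.power rf.minus del: power_Suc)
    then show ?thesis by (simp add: rf.mult algebra_simps)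
  qed
  also have "\<dots> = 5 * (-1) ^ k * ratfun_X ^ (5 * k) * theta_prod 0 (Suc k) u"
    unfolding d by (simp add: v_def algebra_simps)
  finally have *: "ratfun_X * ratfun_deriv ((dw0 ^^ k) u) = \<dots>"
    unfolding Suc v_def .
  have "(dw0 ^^ Suc k) u = - (ratfun_X ^ 5 / 5) * (ratfun_X * ratfun_deriv ((dw0 ^^ k) u))"
    by (simp add: dw0_def eval_nat_numeral)
  then show ?case unfolding * by (simp add: power_add del: theta_prod.simps)
qed simp

lemma dw0_inverse_X: "dw0 (1 / ratfun_X) = ratfun_X ^ 4 / 5"
proof -
  have "ratfun_deriv (1 / ratfun_X) = - ((1 / ratfun_X) ^ 2)"
    using rf.reciprocal[of "1 / ratfun_X" ratfun_X] by (simp add: ratfun_deriv_X)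
  then show ?thesis
    by (simp add: dw0_def field_simps eval_nat_numeral)
qed

text \<open>Here z = r^5 solves z = w + t \<phi> with \<phi> = (r/(r+1))^5, which is (1 + x)^(-5) at
  t = 0. For (r+1)^5 the initial derivative is d/dw (1/x + 1)^5 = (1 + x)^4, which lowers the
  exponent 5(k+1) to 5k+1. The coefficients of r itself serve to prove regularity at x = 1.\<close>

lemma lagrange_r:
  obtains r where "fps_nth r 0 = 1 / ratfun_X"
    "(r ^ 5 - fps_const (1 / ratfun_X) ^ 5) * (r + 1) ^ 5 = fps_const (25 / ratfun_X ^ 5) * fps_X * r ^ 5"
    "\<And>k. fps_nth r (Suc k) = (25 / ratfun_X ^ 5) ^ Suc k / fact (Suc k) *
           (dw0 ^^ k) (geom_ratfun ^ (5 * Suc k) * (ratfun_X ^ 4 / 5))"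
    "\<And>k. fps_nth ((r + 1) ^ 5) (Suc k) = (25 / ratfun_X ^ 5) ^ Suc k / fact (Suc k) *
           (dw0 ^^ k) (geom_ratfun ^ (5 * k + 1))"
proof -
  have X1: "1 / ratfun_X \<noteq> -1"
    using one_plus_ratfun_X_nonzero by (metis add.right_inverse divide_eq_minus_1_iff minus_minus ratfun_X_nonzero)
  have X2: "1 / ratfun_X + 1 \<noteq> 0"
    using X1 by (simp add: eq_neg_iff_add_eq_0)
  define a where "a = 1 / ratfun_X"
  have a: "a \<noteq> 0" "a + 1 \<noteq> 0" using X2 by (simp_all add: a_def)
  obtain r where r0: "fps_nth r 0 = a"
    and r: "(r ^ 5 - fps_const a ^ 5) * (r + 1) ^ 5 = fps_const (25 / ratfun_X ^ 5) * fps_X * r ^ 5"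
    using ex_implicit_series[of "1 / ratfun_X" "25 / ratfun_X ^ 5"] X1 unfolding a_def by auto
  define w where "w = fps_const (a ^ 5)"
  define t where "t = fps_const (25 / ratfun_X ^ 5) * fps_X"
  have eq: "(r ^ 5 - w) * (r + 1) ^ 5 = t * r ^ 5"
    using r by (simp add: w_def t_def)
  \<comment> \<open>B is the partial derivative of the equation with respect to r. Implicit
    differentiation with \<open>Dt w = 0\<close>, \<open>Dt t = 1\<close>, \<open>Dw t = 0\<close>,
    \<open>Dw w = 1\<close> then gives B times both derivatives of r, and B cancels because its
    constant term is nonzero.\<close>
  define B where "B = 5 * r ^ 4 * (r + 1) ^ 5 + 5 * (r ^ 5 - w) * (r + 1) ^ 4 - 5 * t * r ^ 4"
  have D: "B * D r = D w * (r + 1) ^ 5 + D t * r ^ 5" if "derivation D" for D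
  proof -
    interpret D: derivation D by fact
    have "D ((r ^ 5 - w) * (r + 1) ^ 5) = D (t * r ^ 5)" by (simp add: eq)
    then show ?thesis
      by (simp add: D.mult D.diff D.add D.power_numeral B_def algebra_simps)
  qed
  have da: "ratfun_deriv a = - (a ^ 2)"
    using rf.reciprocal[of "1 / ratfun_X" ratfun_X] by (simp add: a_def ratfun_deriv_X)
  have aX: "a * ratfun_X = 1" by (simp add: a_def)
  have t': "t = fps_const (25 * a ^ 5) * fps_X" by (simp add: t_def a_def power_divide)
  have "Dt w = 0" by (simp add: Dt_def w_def)
  moreover have "Dt t = 1"
    by (simp add: Dt_def t_def)
  moreover have "Dw t = 0"
  proof -
    have "fps_coeff_deriv t = fps_const (- 125 * a ^ 6) * fps_X"
      by (simp add: t' md_const_mult md_X rf.mult rf.power_numeral da eval_nat_numeral)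
    moreover have "fps_const ratfun_X * fps_const (- 125 * a ^ 6) = fps_const (- 125 * a ^ 5 * (a * ratfun_X))"
      by (simp add: eval_nat_numeral)
    ultimately have "fps_const ratfun_X * fps_coeff_deriv t = - (5 * fps_X * fps_const (25 * a ^ 5))"
      by (simp add: aX numeral_fps_const mult.assoc [symmetric] del: fps_const_mult)
    then show ?thesis unfolding Dw_def by (simp add: t')
  qed
  moreover have "Dw w = 1"
  proof -
    have "ratfun_deriv (a ^ 5) = - 5 * a ^ 6"
      by (simp add: rf.power_numeral da, (simp add: eval_nat_numeral)?)
    then have "ratfun_X ^ 5 * ratfun_X * ratfun_deriv (a ^ 5) = - 5 * (a * ratfun_X) ^ 6"
      by (simp add: power_mult_distrib, (simp add: eval_nat_numeral)?)
    then show ?thesis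
      by (simp add: Dw_def w_def md_const aX)
  qed
  ultimately have Bt: "B * Dt r = r ^ 5" and Bw: "B * Dw r = (r + 1) ^ 5"
    using D[OF Dt.derivation_axioms] D[OF Dw.derivation_axioms] by simp_all
  have "fps_nth B 0 = 5 * a ^ 4 * (a + 1) ^ 5"
    by (simp add: B_def r0 w_def t_def fps_power_zeroth)
  then have "B \<noteq> 0" using a by auto
  moreover have "B * (Dt r * (r + 1) ^ 5) = B * (r ^ 5 * Dw r)"
    using Bt Bw by (metis mult.assoc mult.commute)
  ultimately have tw: "Dt r * (r + 1) ^ 5 = r ^ 5 * Dw r" by simp
  define u where "u = inverse (r + 1)"
  have u: "u * (r + 1) = 1" unfolding u_def by (rule inverse_mult_eq_1) (simp add: r0 a)
  define \<phi> where "\<phi> = (r * u) ^ 5"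
  have "Dt r = Dt r * (u * (r + 1)) ^ 5" by (simp add: u)
  also have "\<dots> = (Dt r * (r + 1) ^ 5) * u ^ 5" by (simp add: power_mult_distrib)
  also have "\<dots> = \<phi> * Dw r" by (simp add: tw \<phi>_def power_mult_distrib)
  finally have Dr: "Dt r = \<phi> * Dw r" .
  then have Dr1: "Dt (r + 1) = \<phi> * Dw (r + 1)" by (simp add: Dt.add Dw.add)
  have Dphi: "Dt \<phi> = \<phi> * Dw \<phi>"
    using Dt_eq_power[OF Dt_eq_mult[OF Dr Dt_eq_reciprocal[OF Dr1 u]]] unfolding \<phi>_def .
  have "fps_nth u 0 = inverse (a + 1)" by (simp add: u_def r0)
  moreover have "a * inverse (a + 1) = geom_ratfun"
    using one_plus_ratfun_X_nonzero by (simp add: a_def divide_simps add.commute)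
  ultimately have phi0: "fps_nth \<phi> 0 = geom_ratfun ^ 5" by (simp add: \<phi>_def r0 fps_power_zeroth)
  have coeff: "fps_nth g (Suc k) = (25 / ratfun_X ^ 5) ^ Suc k / fact (Suc k) *
           (dw0 ^^ k) (geom_ratfun ^ (5 * Suc k) * dw0 (fps_nth g 0))"
    if g: "Dt g = \<phi> * Dw g" for g k
  proof -
    have "fps_nth ((Dt ^^ Suc k) g) 0 = fps_nth ((Dw ^^ k) (\<phi> ^ Suc k * Dw g)) 0"
      using commuting_derivations_funpow[OF Dt.derivation_axioms Dw.derivation_axioms Dt_Dw Dphi g] by simp
    moreover have "fps_nth (Dw g) 0 = dw0 (fps_nth g 0)"
      using funpow_Dw_nth_0[of 1 g] by simp
    ultimately have "(ratfun_X ^ 5 / 25) ^ Suc k * fact (Suc k) * fps_nth g (Suc k) =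
        (dw0 ^^ k) (geom_ratfun ^ (5 * Suc k) * dw0 (fps_nth g 0))"
      unfolding funpow_Dt_nth_0 funpow_Dw_nth_0 fps_mult_nth_0 fps_power_zeroth phi0 by (simp only: power_mult)
    moreover have "h = c' ^ n / d * e" if "c ^ n * d * h = e" "c' * c = 1" "d \<noteq> 0" for c c' d e h :: "rat poly fract" and n
    proof -
      have "c' ^ n / d * e = (c' ^ n * c ^ n) * h"
        unfolding that(1) [symmetric] using that(3) by simp
      also have "c' ^ n * c ^ n = 1" using that(2) by (simp flip: power_mult_distrib)
      finally show ?thesis by simp
    qed
    moreover have "(25 / ratfun_X ^ 5) * (ratfun_X ^ 5 / 25) = 1" by simp
    ultimately show ?thesis using fact_nonzero by blast
  qed
  have "Dt ((r + 1) ^ 5) = \<phi> * Dw ((r + 1) ^ 5)" by (rule Dt_eq_power[OF Dr1])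
  note coeff5 = coeff[OF this]
  have "dw0 ((a + 1) ^ 5) = 5 * (a + 1) ^ 4 * dw0 a"
    by (simp add: dw0_def rf.power_numeral rf.add)
  also have "\<dots> = ((a + 1) * ratfun_X) ^ 4"
    unfolding a_def dw0_inverse_X by (simp add: power_mult_distrib)
  also have "(a + 1) * ratfun_X = 1 + ratfun_X" by (simp add: a_def field_simps)
  finally have d5: "dw0 (fps_nth ((r + 1) ^ 5) 0) = (1 + ratfun_X) ^ 4" by (simp add: r0 fps_power_zeroth)
  have g5: "geom_ratfun ^ (5 * Suc k) * (1 + ratfun_X) ^ 4 = geom_ratfun ^ (5 * k + 1)" for k
  proof -
    have "5 * Suc k = (5 * k + 1) + 4" by simp
    then have "geom_ratfun ^ (5 * Suc k) * (1 + ratfun_X) ^ 4 = geom_ratfun ^ (5 * k + 1) * (geom_ratfun * (1 + ratfun_X)) ^ 4"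
      by (simp only: power_add power_mult_distrib mult_ac)
    then show ?thesis by simp
  qed
  show thesis
  proof (rule that)
    show "fps_nth r 0 = 1 / ratfun_X" by (simp add: r0 a_def)
    show "(r ^ 5 - fps_const (1 / ratfun_X) ^ 5) * (r + 1) ^ 5 = fps_const (25 / ratfun_X ^ 5) * fps_X * r ^ 5"
      using r unfolding a_def .
    show "fps_nth r (Suc k) = (25 / ratfun_X ^ 5) ^ Suc k / fact (Suc k) *
           (dw0 ^^ k) (geom_ratfun ^ (5 * Suc k) * (ratfun_X ^ 4 / 5))" for k
      using coeff[OF Dr, of k] unfolding r0 a_def dw0_inverse_X .
    show "fps_nth ((r + 1) ^ 5) (Suc k) = (25 / ratfun_X ^ 5) ^ Suc k / fact (Suc k) *
           (dw0 ^^ k) (geom_ratfun ^ (5 * k + 1))" for k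
      using coeff5[of k] unfolding d5 g5 .
  qed
qed

section \<open>Evaluation at x = 1\<close>

abbreviation "regular1 f \<equiv> ratfun_regular f 1"

text \<open>\<open>ratfun_eval\<close> takes the value 0 at a pole, so it respects sums and products
  only where both functions are regular. Regularity is therefore carried along with every
  operation.\<close>

lemma regular1_add: "regular1 f \<Longrightarrow> regular1 g \<Longrightarrow> regular1 (f + g)"
  and ratfun_eval_add: "regular1 f \<Longrightarrow> regular1 g \<Longrightarrow> ratfun_eval (f + g) 1 = ratfun_eval f 1 + ratfun_eval g 1"
proof -
  assume f: "regular1 f" and g: "regular1 g"
  obtain a b where f: "f = Fraction_Field.Fract a b" "poly b 1 \<noteq> 0" using f by (rule ratfun_regularE)
  obtain c d where g: "g = Fraction_Field.Fract c d" "poly d 1 \<noteq> 0" using g by (rule ratfun_regularE)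
  have "b \<noteq> 0" "d \<noteq> 0" using f(2) g(2) by auto
  then have s: "f + g = Fraction_Field.Fract (a * d + c * b) (b * d)" by (simp add: f(1) g(1))
  show "regular1 (f + g)" unfolding s using f(2) g(2) by (simp add: ratfun_regular_Fract)
  show "ratfun_eval (f + g) 1 = ratfun_eval f 1 + ratfun_eval g 1"
    using f(2) g(2) ratfun_eval_Fract[of "b * d" 1 "a * d + c * b"] ratfun_eval_Fract[OF f(2), of a]
      ratfun_eval_Fract[OF g(2), of c]
    unfolding s unfolding f(1) g(1) by (simp add: add_frac_eq)
qed

lemma regular1_mult: "regular1 f \<Longrightarrow> regular1 g \<Longrightarrow> regular1 (f * g)"
  and ratfun_eval_mult: "regular1 f \<Longrightarrow> regular1 g \<Longrightarrow> ratfun_eval (f * g) 1 = ratfun_eval f 1 * ratfun_eval g 1"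
proof -
  assume f: "regular1 f" and g: "regular1 g"
  obtain a b where f: "f = Fraction_Field.Fract a b" "poly b 1 \<noteq> 0" using f by (rule ratfun_regularE)
  obtain c d where g: "g = Fraction_Field.Fract c d" "poly d 1 \<noteq> 0" using g by (rule ratfun_regularE)
  have s: "f * g = Fraction_Field.Fract (a * c) (b * d)" by (simp add: f(1) g(1))
  show "regular1 (f * g)" unfolding s using f(2) g(2) by (simp add: ratfun_regular_Fract)
  show "ratfun_eval (f * g) 1 = ratfun_eval f 1 * ratfun_eval g 1"
    unfolding s f(1) g(1) using f(2) g(2) by (simp add: ratfun_eval_Fract)
qed

lemma regular1_of_rat [simp]: "regular1 (of_rat c)"
  and ratfun_eval_of_rat [simp]: "ratfun_eval (of_rat c) 1 = c"
  using ratfun_regular_Fract[of 1 1 "[:c:]"] ratfun_eval_Fract[of 1 1 "[:c:]"]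
  by (simp_all add: ratfun_const_eq_of_rat [symmetric] to_fract_def)

lemma regular1_X [simp]: "regular1 ratfun_X"
  and ratfun_eval_X [simp]: "ratfun_eval ratfun_X 1 = 1"
  using ratfun_regular_Fract[of 1 1 "[:0,1:]"] ratfun_eval_Fract[of 1 1 "[:0,1:]"]
  by (simp_all add: to_fract_def)

lemma regular1_simps [simp]: "regular1 0" "regular1 1" "regular1 (numeral n)" "regular1 (of_nat k)"
  "ratfun_eval 0 1 = 0" "ratfun_eval 1 1 = 1" "ratfun_eval (numeral n) 1 = numeral n" "ratfun_eval (of_nat k) 1 = of_nat k"
  using regular1_of_rat[of 0] regular1_of_rat[of 1] regular1_of_rat[of "numeral n"] regular1_of_rat[of "of_nat k"]
    ratfun_eval_of_rat[of 0] ratfun_eval_of_rat[of 1] ratfun_eval_of_rat[of "numeral n"] ratfun_eval_of_rat[of "of_nat k"]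
  by simp_all

lemma regular1_uminus: "regular1 f \<Longrightarrow> regular1 (- f)"
  using regular1_mult[OF regular1_of_rat[of "-1"], of f] by simp

lemma regular1_power: "regular1 f \<Longrightarrow> regular1 (f ^ n)"
  by (induction n) (simp_all add: regular1_mult)

lemma regular1_geom: "regular1 geom_ratfun"
  unfolding one_plus_ratfun_X by (simp add: ratfun_regular_Fract)

lemma regular1_inverse_X: "regular1 (inverse ratfun_X)"
  by (simp add: to_fract_def ratfun_regular_Fract)

lemma regular1_inverse_X_power: "regular1 (inverse (ratfun_X ^ n))"
  using regular1_power[OF regular1_inverse_X, of n] by (simp only: power_inverse)

lemma regular1_divide: "regular1 f \<Longrightarrow> regular1 (inverse g) \<Longrightarrow> regular1 (f / g)"
  by (simp add: divide_inverse regular1_mult)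

lemma regular1_inverse_of_rat: "regular1 (inverse (of_rat c))"
  by (simp flip: of_rat_inverse)

lemma regular1_inverse_numeral: "regular1 (inverse (numeral n))"
  using regular1_inverse_of_rat[of "numeral n"] by simp

lemma of_rat_fact: "of_rat (fact n) = (fact n :: 'a :: field_char_0)"
  using of_rat_of_nat_eq[of "fact n"] by (simp only: of_nat_fact)

lemma regular1_funpow_dw0: "regular1 f \<Longrightarrow> regular1 ((dw0 ^^ n) f)"
proof (induction n)
  case (Suc n)
  then have "regular1 (ratfun_deriv ((dw0 ^^ n) f))"
    by (simp add: ratfun_regular_deriv)
  then show ?case
    unfolding funpow.simps o_def dw0_def[of "(dw0 ^^ n) f"]
    by (intro regular1_mult regular1_divide regular1_uminus regular1_power regular1_inverse_numeral regular1_X)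
qed simp

definition regular1_fps :: "rat poly fract fps \<Rightarrow> bool" where
  "regular1_fps f \<longleftrightarrow> (\<forall>n. regular1 (fps_nth f n))"

definition fps_eval1 :: "rat poly fract fps \<Rightarrow> rat fps" where
  "fps_eval1 f = Abs_fps (\<lambda>n. ratfun_eval (fps_nth f n) 1)"

lemma fps_eval1_nth [simp]: "fps_nth (fps_eval1 f) n = ratfun_eval (fps_nth f n) 1"
  by (simp add: fps_eval1_def)

lemma regular1_sum: "(\<And>i. i \<in> A \<Longrightarrow> regular1 (f i)) \<Longrightarrow> regular1 (sum f A)"
  and ratfun_eval_sum: "(\<And>i. i \<in> A \<Longrightarrow> regular1 (f i)) \<Longrightarrow> ratfun_eval (sum f A) 1 = (\<Sum>i\<in>A. ratfun_eval (f i) 1)"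
proof -
  assume "\<And>i. i \<in> A \<Longrightarrow> regular1 (f i)"
  then have "regular1 (sum f A) \<and> ratfun_eval (sum f A) 1 = (\<Sum>i\<in>A. ratfun_eval (f i) 1)"
    by (induction A rule: infinite_finite_induct) (simp_all add: regular1_add ratfun_eval_add)
  then show "regular1 (sum f A)" "ratfun_eval (sum f A) 1 = (\<Sum>i\<in>A. ratfun_eval (f i) 1)" by auto
qed

lemma regular1_fps_add: "regular1_fps f \<Longrightarrow> regular1_fps g \<Longrightarrow> regular1_fps (f + g)"
  and fps_eval1_add: "regular1_fps f \<Longrightarrow> regular1_fps g \<Longrightarrow> fps_eval1 (f + g) = fps_eval1 f + fps_eval1 g"
  by (simp_all add: regular1_fps_def fps_eq_iff regular1_add ratfun_eval_add)

lemma regular1_fps_mult: "regular1_fps f \<Longrightarrow> regular1_fps g \<Longrightarrow> regular1_fps (f * g)"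
  and fps_eval1_mult: "regular1_fps f \<Longrightarrow> regular1_fps g \<Longrightarrow> fps_eval1 (f * g) = fps_eval1 f * fps_eval1 g"
  by (simp_all add: regular1_fps_def fps_eq_iff fps_mult_nth regular1_mult ratfun_eval_mult regular1_sum ratfun_eval_sum)

lemma regular1_fps_const: "regular1 c \<Longrightarrow> regular1_fps (fps_const c)"
  and fps_eval1_const: "fps_eval1 (fps_const c) = fps_const (ratfun_eval c 1)"
  by (simp_all add: regular1_fps_def fps_eq_iff)

lemma regular1_fps_X: "regular1_fps fps_X"
  and fps_eval1_X: "fps_eval1 fps_X = fps_X"
  by (simp_all add: regular1_fps_def fps_eq_iff fps_X_def)

lemma regular1_fps_power: "regular1_fps f \<Longrightarrow> regular1_fps (f ^ n)"
  and fps_eval1_power: "regular1_fps f \<Longrightarrow> fps_eval1 (f ^ n) = fps_eval1 f ^ n"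
proof -
  have one: "regular1_fps 1" "fps_eval1 1 = 1"
    using regular1_fps_const[of 1] fps_eval1_const[of 1] by simp_all
  assume f: "regular1_fps f"
  have "regular1_fps (f ^ n) \<and> fps_eval1 (f ^ n) = fps_eval1 f ^ n"
    by (induction n) (simp_all add: one f regular1_fps_mult fps_eval1_mult)
  then show "regular1_fps (f ^ n)" "fps_eval1 (f ^ n) = fps_eval1 f ^ n" by auto
qed

text \<open>Passing to \<sigma> = x * r clears the powers of x from the equation; S is \<sigma> at x
  = 1. The closed form of \<open>R k\<close> and the Lagrange coefficient of (\<sigma> + x)^5
  contain the same Euler product, so only their scalars have to be compared.\<close>

lemma F6_at_one_series:
  obtains S :: "rat fps" where "fps_nth S 0 = 1"
    "(S ^ 5 - 1) * (S + 1) ^ 5 = 25 * fps_X * S ^ 5"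
    "\<And>k. (5 * of_nat k + 1) * ratfun_eval (R k) 1 =
        - (4/125) * fps_nth ((S + 1) ^ 5) (Suc k) + (if k = 0 then 4/5 else 0)"
proof -
  obtain r where r0: "fps_nth r 0 = 1 / ratfun_X"
    and r: "(r ^ 5 - fps_const (1 / ratfun_X) ^ 5) * (r + 1) ^ 5 = fps_const (25 / ratfun_X ^ 5) * fps_X * r ^ 5"
    and rS: "\<And>k. fps_nth r (Suc k) = (25 / ratfun_X ^ 5) ^ Suc k / fact (Suc k) *
           (dw0 ^^ k) (geom_ratfun ^ (5 * Suc k) * (ratfun_X ^ 4 / 5))"
    and yS: "\<And>k. fps_nth ((r + 1) ^ 5) (Suc k) = (25 / ratfun_X ^ 5) ^ Suc k / fact (Suc k) *
           (dw0 ^^ k) (geom_ratfun ^ (5 * k + 1))"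
    by (rule lagrange_r) blast
  have reg_t: "regular1 (25 / ratfun_X ^ 5)"
    by (intro regular1_divide regular1_inverse_X_power) simp
  have reg_fact: "regular1 (inverse (fact n))" for n
    using regular1_inverse_of_rat[of "fact n"] by (simp add: of_rat_fact)
  have reg_r: "regular1_fps r"
    unfolding regular1_fps_def
  proof
    fix n show "regular1 (fps_nth r n)"
    proof (cases n)
      case 0 then show ?thesis by (simp add: r0 regular1_divide regular1_inverse_X)
    next
      case (Suc k)
      show ?thesis unfolding Suc rS
        by (intro regular1_mult regular1_divide regular1_power regular1_funpow_dw0 reg_t reg_fact regular1_geom
            regular1_X regular1_inverse_numeral)
    qed
  qed
  define x where "x = fps_const ratfun_X"
  define \<sigma> where "\<sigma> = x * r"
  have reg_x: "regular1_fps x" by (simp add: x_def regular1_fps_const)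
  have reg: "regular1_fps \<sigma>" by (simp add: \<sigma>_def reg_r reg_x regular1_fps_mult)
  have xa: "x * fps_const (1 / ratfun_X) = 1" by (simp add: x_def)
  have xt: "x ^ 5 * fps_const (25 / ratfun_X ^ 5) = 25"
    by (simp add: x_def fps_const_power numeral_fps_const)
  have "(\<sigma> ^ 5 - (x * fps_const (1 / ratfun_X)) ^ 5) * (\<sigma> + x) ^ 5 = x ^ 10 * ((r ^ 5 - fps_const (1 / ratfun_X) ^ 5) * (r + 1) ^ 5)"
  proof -
    have "\<sigma> + x = x * (r + 1)" by (simp add: \<sigma>_def algebra_simps)
    moreover have "x ^ 10 = x ^ 5 * x ^ 5" by (simp add: power_add [symmetric])
    ultimately show ?thesis
      unfolding \<sigma>_def by (simp only: power_mult_distrib) (simp only: algebra_simps)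
  qed
  also have "\<dots> = x ^ 10 * (fps_const (25 / ratfun_X ^ 5) * fps_X * r ^ 5)" unfolding r ..
  also have "\<dots> = (x ^ 5 * fps_const (25 / ratfun_X ^ 5)) * fps_X * \<sigma> ^ 5"
  proof -
    have "x ^ 10 = x ^ 5 * x ^ 5" by (simp add: power_add [symmetric])
    then show ?thesis by (simp only: \<sigma>_def power_mult_distrib mult_ac)
  qed
  finally have eq: "(\<sigma> ^ 5 - 1) * (\<sigma> + x) ^ 5 = 25 * fps_X * \<sigma> ^ 5"
    unfolding xa xt by simp
  define S where "S = fps_eval1 \<sigma>"
  have evx: "fps_eval1 x = 1" by (simp add: x_def fps_eval1_const)
  have y: "fps_eval1 ((\<sigma> + x) ^ 5) = (S + 1) ^ 5"
    by (simp add: fps_eval1_power regular1_fps_add reg reg_x fps_eval1_add evx S_def)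
  \<comment> \<open>Rearranged without subtraction, since \<open>fps_eval1\<close> has been shown to
    respect sums and products.\<close>
  have eq': "\<sigma> ^ 5 * (\<sigma> + x) ^ 5 = 25 * fps_X * \<sigma> ^ 5 + (\<sigma> + x) ^ 5"
    using eq by (simp add: algebra_simps)
  have "fps_eval1 (\<sigma> ^ 5 * (\<sigma> + x) ^ 5) = S ^ 5 * (S + 1) ^ 5"
    by (simp add: fps_eval1_mult y regular1_fps_power regular1_fps_add reg reg_x) (simp add: S_def fps_eval1_power reg)
  moreover have "fps_eval1 (fps_const 25 * fps_X * \<sigma> ^ 5 + (\<sigma> + x) ^ 5) = 25 * fps_X * S ^ 5 + (S + 1) ^ 5"
    by (simp add: fps_eval1_mult fps_eval1_add y regular1_fps_power regular1_fps_add reg reg_x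
        regular1_fps_const regular1_fps_mult regular1_fps_X fps_eval1_const fps_eval1_X)
       (simp add: S_def fps_eval1_power reg numeral_fps_const)
  ultimately have S: "(S ^ 5 - 1) * (S + 1) ^ 5 = 25 * fps_X * S ^ 5"
    using eq' by (simp add: algebra_simps numeral_fps_const)
  have S0: "fps_nth S 0 = 1"
    by (simp add: S_def \<sigma>_def x_def r0)
  have key: "(5 * of_nat k + 1) * R k = - (4/125) * fps_nth ((\<sigma> + x) ^ 5) (Suc k) + (if k = 0 then 4/5 else 0)" for k
  proof -
    define T where "T = theta_prod 0 k (geom_ratfun ^ (5 * k + 1))"
    have "\<sigma> + x = x * (r + 1)" by (simp add: \<sigma>_def algebra_simps)
    then have "(\<sigma> + x) ^ 5 = fps_const (ratfun_X ^ 5) * (r + 1) ^ 5"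
      by (simp add: power_mult_distrib x_def)
    then have "fps_nth ((\<sigma> + x) ^ 5) (Suc k) = ratfun_X ^ 5 * ((25 / ratfun_X ^ 5) ^ Suc k / fact (Suc k) * (ratfun_X ^ (5 * k) * (-1) ^ k * T))"
      using yS[of k] by (simp add: funpow_dw0 T_def)
    also have "\<dots> = 25 ^ Suc k / fact (Suc k) * (-1) ^ k * T"
      by (simp add: power_divide power_mult [symmetric] del: fact_Suc)
    also have "\<dots> = of_rat (25 * (-25) ^ k / fact (Suc k)) * T"
    proof -
      have "(-25 :: rat) ^ k = (-1) ^ k * 25 ^ k" by (simp flip: power_mult_distrib)
      then have "of_rat (25 * (-25) ^ k / fact (Suc k)) = (25 * ((-1) ^ k * 25 ^ k) / fact (Suc k) :: rat poly fract)"
        by (simp add: of_rat_mult of_rat_divide of_rat_power of_rat_minus of_rat_fact del: fact_Suc)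
      then show ?thesis by simp
    qed
    finally have yk: "fps_nth ((\<sigma> + x) ^ 5) (Suc k) = of_rat (25 * (-25) ^ k / fact (Suc k)) * T" .
    have "(5 * of_nat k + 1) * R_coeff k = - (4/125) * (25 * (-25) ^ k / fact (Suc k))"
    proof -
      define n where "n = (5 * of_nat k + 1 :: rat)"
      have "n > 0" unfolding n_def by (simp add: add_nonneg_pos)
      moreover have "R_coeff k = - (4/5) * (-25) ^ k / (n * fact (Suc k))"
        by (simp add: R_coeff_def n_def add.commute)
      ultimately have "n * R_coeff k = - (4/5) * (-25) ^ k / fact (Suc k)"
        by (simp del: fact_Suc)
      then show ?thesis by (simp add: n_def del: fact_Suc)
    qed
    then have "of_rat ((5 * of_nat k + 1) * R_coeff k) = (of_rat (- (4/125) * (25 * (-25) ^ k / fact (Suc k))) :: rat poly fract)"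
      by (rule arg_cong)
    then have c: "(5 * of_nat k + 1) * of_rat (R_coeff k) = - (4/125) * (of_rat (25 * (-25) ^ k / fact (Suc k)) :: rat poly fract)"
      by (simp only: of_rat_mult of_rat_add of_rat_minus of_rat_divide of_rat_of_nat_eq of_rat_numeral_eq of_rat_1)
    have "(5 * of_nat k + 1) * R k = ((5 * of_nat k + 1) * of_rat (R_coeff k)) * T + (if k = 0 then 4/5 else 0)"
      unfolding R_closed_form[of k] T_def by (simp add: algebra_simps del: theta_prod.simps)
    then show ?thesis unfolding c yk by (simp add: mult.assoc)
  qed
  show thesis
  proof (rule that)
    show "fps_nth S 0 = 1" by (rule S0)
    show "(S ^ 5 - 1) * (S + 1) ^ 5 = 25 * fps_X * S ^ 5" by (rule S)
    fix k
    have regy: "regular1 (fps_nth ((\<sigma> + x) ^ 5) (Suc k))"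
      using regular1_fps_power[OF regular1_fps_add[OF reg reg_x], of 5] by (simp add: regular1_fps_def)
    have l: "ratfun_eval ((5 * of_nat k + 1) * R k) 1 = (5 * of_nat k + 1) * ratfun_eval (R k) 1"
      by (simp add: ratfun_eval_mult ratfun_eval_add R_regular_at_one regular1_add regular1_mult del: R.simps)
    have 45: "(if k = 0 then 4/5 else 0) = (of_rat (if k = 0 then 4/5 else 0) :: rat poly fract)"
      by (simp add: of_rat_divide)
    have 4125: "- (4/125) = (of_rat (- (4/125)) :: rat poly fract)"
      by (simp only: of_rat_divide of_rat_minus of_rat_numeral_eq)
    have "ratfun_eval (- (4/125) * fps_nth ((\<sigma> + x) ^ 5) (Suc k) + (if k = 0 then 4/5 else 0)) 1
        = - (4/125) * ratfun_eval (fps_nth ((\<sigma> + x) ^ 5) (Suc k)) 1 + (if k = 0 then 4/5 else 0)"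
      unfolding 45 4125 by (simp only: ratfun_eval_add ratfun_eval_mult regular1_mult regular1_of_rat regy ratfun_eval_of_rat)
    also have "ratfun_eval (fps_nth ((\<sigma> + x) ^ 5) (Suc k)) 1 = fps_nth ((S + 1) ^ 5) (Suc k)"
      unfolding y [symmetric] by simp
    finally show "(5 * of_nat k + 1) * ratfun_eval (R k) 1 =
        - (4/125) * fps_nth ((S + 1) ^ 5) (Suc k) + (if k = 0 then 4/5 else 0)"
      using key[of k] l by simp
  qed
qed

section \<open>The algebraic closed form of F_6(1,H)\<close>

lemma fps_numeral_mult_nth: "fps_nth (numeral m * f) n = numeral m * fps_nth f n" for f :: "'a :: comm_ring_1 fps"
  by (simp add: numeral_fps_const)

text \<open>125 F + 32 and the rational function y of S satisfy the same inhomogeneous first order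
  equation. Their difference Z satisfies (5n - 4) Z_n = 0 for every n, hence vanishes, and no
  initial values need to be compared.\<close>

lemma F6_at_one_closed_form:
  obtains S :: "rat fps" where "fps_nth S 0 = 1"
    "(S ^ 5 - 1) * (S + 1) ^ 5 = 25 * fps_X * S ^ 5"
    "(125 * F6_at 1 + 32) * S ^ 5 = (S + 1) ^ 4 * (5 * S ^ 5 + S - 4)"
proof -
  obtain S :: "rat fps" where S0: "fps_nth S 0 = 1"
    and S: "(S ^ 5 - 1) * (S + 1) ^ 5 = 25 * fps_X * S ^ 5"
    and RS: "\<And>k. (5 * of_nat k + 1) * ratfun_eval (R k) 1 =
        - (4/125) * fps_nth ((S + 1) ^ 5) (Suc k) + (if k = 0 then 4/5 else 0)"
    by (rule F6_at_one_series) blast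
  define F where "F = F6_at 1"
  define T where "T = inverse S"
  have ST: "T * S = 1" unfolding T_def by (rule inverse_mult_eq_1) (simp add: S0)
  have FR: "fps_nth F 0 = 0" "fps_nth F (Suc k) = ratfun_eval (R k) 1" for k
    by (simp_all add: F_def F6_at_def F6_def del: R.simps)
  have ode: "125 * (5 * fps_X * fps_deriv F - 4 * F) = 100 * fps_X - 4 * ((S + 1) ^ 5 - 32)"
  proof (rule fps_ext)
    fix n
    show "fps_nth (125 * (5 * fps_X * fps_deriv F - 4 * F)) n = fps_nth (100 * fps_X - 4 * ((S + 1) ^ 5 - 32)) n"
    proof (cases n)
      case 0
      then show ?thesis by (simp add: FR(1) S0 fps_power_zeroth numeral_fps_const)
    next
      case (Suc k)
      have "125 * ((5 * of_nat k + 1) * ratfun_eval (R k) 1) = - 4 * fps_nth ((S + 1) ^ 5) (Suc k) + (if k = 0 then 100 else 0)"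
        unfolding RS by (simp add: algebra_simps)
      then show ?thesis
        unfolding Suc mult.assoc fps_sub_nth fps_numeral_mult_nth FR
        by (simp add: FR fps_numeral_nth algebra_simps)
    qed
  qed
  define v where "v = (S + 1) ^ 3"
  have v: "(S + 1) ^ 3 = v" "(S + 1) ^ 4 = v * (S + 1)" "(S + 1) ^ 5 = v * (S + 1) * (S + 1)"
    by (simp_all add: v_def eval_nat_numeral mult_ac)
  have S6: "S ^ 6 = S * S ^ 5" by (simp add: eval_nat_numeral)
  interpret d: derivation "fps_deriv :: rat fps \<Rightarrow> _"
    by unfold_locales (simp_all add: algebra_simps)
  define s' where "s' = fps_deriv S"
  have S1: "S + 1 \<noteq> 0" "S \<noteq> 0" "S ^ 6 + 1 \<noteq> 0"
    using S0 by (auto simp: fps_eq_iff fps_power_zeroth intro!: exI[of _ 0])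
  \<comment> \<open>Implicit differentiation of the curve gives s' = 5 S^6 / ((S+1)^4 (S^6+1)); with
    the curve equation this becomes 5 H s' = S (S+1) (S^5-1) / (S^6+1), which removes H from the
    equation for y.\<close>
  have "fps_deriv ((S ^ 5 - 1) * (S + 1) ^ 5) = fps_deriv (25 * fps_X * S ^ 5)"
    by (simp only: S)
  then have "5 * S ^ 4 * s' * (S + 1) ^ 5 + (S ^ 5 - 1) * (5 * (S + 1) ^ 4 * s') = 25 * S ^ 5 + 25 * fps_X * (5 * S ^ 4 * s')"
    by (simp add: d.power_numeral s'_def ac_simps)
  then have "S * (5 * S ^ 4 * s' * (S + 1) ^ 5 + (S ^ 5 - 1) * (5 * (S + 1) ^ 4 * s')) = S * (25 * S ^ 5 + 25 * fps_X * (5 * S ^ 4 * s'))"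
    by simp
  also have "\<dots> = 25 * S ^ 6 + 5 * s' * (25 * fps_X * S ^ 5)"
    by (simp add: algebra_simps eval_nat_numeral)
  also have "\<dots> = 25 * S ^ 6 + 5 * s' * ((S ^ 5 - 1) * (S + 1) ^ 5)"
    unfolding S ..
  finally have "5 * ((S + 1) ^ 4 * (S ^ 6 + 1) * s') = 5 * (5 * S ^ 6)"
    unfolding v by (simp add: algebra_simps eval_nat_numeral)
  then have s': "(S + 1) ^ 4 * (S ^ 6 + 1) * s' = 5 * S ^ 6"
    by (simp add: numeral_fps_const)
  have "S ^ 5 * (S + 1) ^ 4 * (5 * fps_X * (S ^ 6 + 1) * s') = 5 * fps_X * S ^ 5 * ((S + 1) ^ 4 * (S ^ 6 + 1) * s')"
    by (simp add: mult_ac)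
  also have "\<dots> = (25 * fps_X * S ^ 5) * S ^ 6" unfolding s' by (simp add: mult_ac)
  also have "\<dots> = S ^ 5 * (S + 1) ^ 4 * ((S ^ 5 - 1) * (S + 1) * S)"
    unfolding S [symmetric] by (simp add: eval_nat_numeral mult_ac)
  finally have Xs: "5 * fps_X * (S ^ 6 + 1) * s' = (S ^ 5 - 1) * (S + 1) * S"
    using S1 by simp
  define p where "p = 5 * S ^ 5 + S - 4"
  define y where "y = (S + 1) ^ 4 * p * T ^ 5"
  have p': "fps_deriv p = (25 * S ^ 4 + 1) * s'"
    by (simp add: p_def s'_def d.power_numeral algebra_simps)
  have TS5: "T ^ 5 * S ^ 5 = 1" using ST by (metis power_mult_distrib power_one)
  have yS: "y * S ^ 5 = (S + 1) ^ 4 * p"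
    by (simp add: y_def mult.assoc TS5)
  \<comment> \<open>The goal of this computation is dy/ds = 20 (s+1)^3 (s^6+1) / s^6, stated without
    denominators. The right side has no term in 1/s, which is why its primitive y is
    rational.\<close>
  have "fps_deriv y * S ^ 5 + y * (5 * S ^ 4 * s') = (S + 1) ^ 4 * ((25 * S ^ 4 + 1) * s') + 4 * (S + 1) ^ 3 * s' * p"
    using arg_cong[OF yS, of fps_deriv] by (simp add: d.power_numeral p' s'_def [symmetric] ac_simps)
  then have "S * (fps_deriv y * S ^ 5 + y * (5 * S ^ 4 * s')) = S * ((S + 1) ^ 4 * ((25 * S ^ 4 + 1) * s') + 4 * (S + 1) ^ 3 * s' * p)"
    by simp
  then have "fps_deriv y * S ^ 6 = S * ((S + 1) ^ 4 * ((25 * S ^ 4 + 1) * s') + 4 * (S + 1) ^ 3 * s' * p) - 5 * s' * (y * S ^ 5)"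
    by (simp add: algebra_simps eval_nat_numeral)
  also have "\<dots> = 20 * (S + 1) ^ 3 * (S ^ 6 + 1) * s'"
    unfolding yS p_def v by (simp add: algebra_simps eval_nat_numeral)
  finally have dy: "fps_deriv y * S ^ 6 = 20 * (S + 1) ^ 3 * (S ^ 6 + 1) * s'" .
  have "5 * fps_X * fps_deriv y * S ^ 6 = 5 * fps_X * (fps_deriv y * S ^ 6)"
    by (simp only: mult_ac)
  also have "\<dots> = 20 * (S + 1) ^ 3 * (5 * fps_X * (S ^ 6 + 1) * s')"
    unfolding dy by (simp only: mult_ac)
  also have "\<dots> = S * (20 * (S + 1) ^ 4 * (S ^ 5 - 1))"
    unfolding Xs v by (simp only: mult_ac)
  finally have "S * (5 * fps_X * fps_deriv y * S ^ 5) = S * (20 * (S + 1) ^ 4 * (S ^ 5 - 1))"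
    unfolding S6 by (simp only: mult_ac)
  then have "5 * fps_X * fps_deriv y * S ^ 5 = 20 * (S + 1) ^ 4 * (S ^ 5 - 1)"
    using S1 by simp
  also have "\<dots> = 4 * ((S + 1) ^ 4 * p) + 4 * ((S ^ 5 - 1) * (S + 1) ^ 5) - 4 * (S + 1) ^ 5 * S ^ 5"
    unfolding p_def v by (simp add: algebra_simps eval_nat_numeral)
  also have "\<dots> = (4 * y + 100 * fps_X - 4 * (S + 1) ^ 5) * S ^ 5"
    unfolding S yS [symmetric] by (simp add: algebra_simps)
  finally have yode: "5 * fps_X * fps_deriv y = 4 * y + 100 * fps_X - 4 * (S + 1) ^ 5"
    using S1 by simp
  define Z where "Z = 125 * F + 32 - y"
  have Zode: "5 * fps_X * fps_deriv Z = 4 * Z"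
  proof -
    have "5 * fps_X * fps_deriv Z = 125 * (5 * fps_X * fps_deriv F - 4 * F) + 4 * (125 * F) - 5 * fps_X * fps_deriv y"
      by (simp add: Z_def algebra_simps)
    then show ?thesis unfolding ode yode by (simp add: Z_def algebra_simps)
  qed
  have "5 * of_nat n * fps_nth Z n = 4 * fps_nth Z n" for n
  proof -
    have "fps_nth (5 * (fps_X * fps_deriv Z)) n = fps_nth (4 * Z) n"
      using Zode by (simp only: mult.assoc)
    then show ?thesis
      unfolding fps_numeral_mult_nth by (cases n) simp_all
  qed
  moreover have "5 * of_nat n \<noteq> (4 :: rat)" for n
  proof
    assume "5 * of_nat n = (4 :: rat)"
    then have "of_nat (5 * n) = (of_nat 4 :: rat)" by simp
    then have "5 * n = 4" by (simp only: of_nat_eq_iff)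
    then show False by presburger
  qed
  ultimately have "Z = 0" by (auto simp: fps_eq_iff)
  then have "125 * F + 32 = y" by (simp add: Z_def)
  then show thesis using that[OF S0 S] yS by (simp add: F_def p_def)
qed

section \<open>The bivariate polynomial\<close>

text \<open>
  The characteristic polynomial of \<open>v = y - 2 h\<close> over \<open>\<rat>(h\<^sup>2)\<close>, where \<open>h = 25 H\<close> and \<open>y = 125 F + 32\<close>;
  its coefficients are the solution of a linear system.
\<close>

definition elim_poly :: "'a :: comm_ring_1 \<Rightarrow> 'a \<Rightarrow> 'a" where
  "elim_poly e v =
     v^10 - 10 * v^9 + (-585 - 20*e) * v^8 + (-3830 + 160*e) * v^7
     + (705 + 13020*e + 160*e^2) * v^6 + (-32 + 82140*e - 7210*e^2) * v^5
     + (-43320*e - 58830*e^2 - 640*e^3) * v^4 + (2000*e + 3092970*e^2 - 247440*e^3) * v^3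
     + (25914500*e^2 + 3395440*e^3 + 1280*e^4) * v^2
     + (-4500000*e^2 + 137821500*e^3 - 502560*e^4) * v
     + (200000*e^2 + 888000000*e^3 + 13241625*e^4 - 1024*e^5)"

text \<open>Horner form in v, and in e within each coefficient, for evaluating at explicit
  polynomials in q.\<close>

lemma elim_poly_horner:
  "elim_poly e v = ((((((((((v - 10) * v + (-585 - 20*e)) * v + (-3830 + 160*e)) * v
     + (705 + e*(13020 + 160*e))) * v + (-32 + e*(82140 - 7210*e))) * v
     + e*(-43320 + e*(- 58830 - 640*e))) * v + e*(2000 + e*(3092970 - 247440*e))) * v
     + e*(e*(25914500 + e*(3395440 + 1280*e)))) * v
     + e*(e*(-4500000 + e*(137821500 - 502560*e)))) * v
     + e*(e*(200000 + e*(888000000 + e*(13241625 - 1024*e)))))"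
  unfolding elim_poly_def eval_nat_numeral BitM.simps power_Suc power_0
  by (simp add: algebra_simps)

lemma (in comm_ring_hom) hom_elim_poly: "hom (elim_poly e v) = elim_poly (hom e) (hom v)"
  by (simp add: elim_poly_def hom_distribs)

text \<open>The two arguments are h^2 and y - 2 h written as polynomials in q. The identity is
  computed once in Z[q] and transported to every commutative ring by evaluation at q.\<close>

lemma elim_poly_identity_int:
  "elim_poly [:0,0,0,0,0,-4,25,-50,35,-10,1:] [:0,0,10,-30,15,-2:] = (0 :: int poly)"
  unfolding elim_poly_horner by (simp add: numeral_poly)

lemma elim_poly_identity:
  fixes q :: "'a :: comm_ring_1"
  shows "elim_poly (q^5 * (q - 4) * (q^2 - 3*q + 1)^2) (q^2 * (10 - 30*q + 15*q^2 - 2*q^3)) = 0"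
proof -
  interpret h: comm_ring_hom "\<lambda>p. poly (of_int_poly p) q"
    by unfold_locales (simp_all add: of_int_poly_hom.hom_add of_int_poly_hom.hom_mult)
  have 1: "q^5 * (q - 4) * (q^2 - 3*q + 1)^2 = poly (of_int_poly [:0,0,0,0,0,-4,25,-50,35,-10,1:]) q"
    by (simp add: algebra_simps eval_nat_numeral)
  have 2: "q^2 * (10 - 30*q + 15*q^2 - 2*q^3) = poly (of_int_poly [:0,0,10,-30,15,-2:]) q"
    by (simp add: algebra_simps eval_nat_numeral)
  show ?thesis
    unfolding 1 2 h.hom_elim_poly [symmetric] elim_poly_identity_int by simp
qed

text \<open>
  With \<open>w = s + 1/s\<close> and \<open>q = w + 2\<close>, both \<open>h\<^sup>2\<close> and \<open>y - 2 h\<close> are invariant under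
  \<open>s \<mapsto> 1/s\<close>, hence polynomials in \<open>q\<close>.
\<close>

lemma elim_poly_vanishes:
  fixes s t h y :: "'a :: comm_ring_1"
  assumes st: "s * t = 1" and h: "h * s^5 = (s^5 - 1) * (s + 1)^5"
    and y: "y * s^5 = (s + 1)^4 * (5 * s^5 + s - 4)"
  shows "elim_poly (h^2) (y - 2 * h) = 0"
proof -
  define q where "q = s + t + 2"
  define w where "w = s + t"
  have st5: "s ^ 5 * t ^ 5 = 1" "s ^ 3 * t ^ 3 = 1" "s ^ 2 * t ^ 2 = 1"
    using st by (simp_all flip: power_mult_distrib)
  have q: "q = (s + 1)^2 * t"
  proof -
    have "(s + 1)^2 * t = s * (s * t) + 2 * (s * t) + t" by (simp add: algebra_simps power2_eq_square)
    then show ?thesis by (simp add: st q_def)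
  qed
  have red: "s * (t * x) = x" for x by (simp add: st flip: mult.assoc)
  have w2: "w^2 = s^2 + t^2 + 2"
    by (simp add: w_def algebra_simps eval_nat_numeral red st)
  have w3: "w^3 = s^3 + t^3 + 3 * w"
    by (simp add: w_def algebra_simps eval_nat_numeral red st)
  have w5: "w^5 = s^5 + t^5 + 5 * w^3 - 5 * w"
    by (simp add: w_def algebra_simps eval_nat_numeral red st)
  have s5: "s^5 * t^5 = 1" by (rule st5)
  have hq: "h = (s^5 - 1) * (s + 1)^5 * t^5"
  proof -
    have "h = h * s^5 * t^5" by (simp add: mult.assoc s5)
    then show ?thesis by (simp add: h)
  qed
  have yq: "y = (s + 1)^4 * (5 * s^5 + s - 4) * t^5"
  proof -
    have "y = y * s^5 * t^5" by (simp add: mult.assoc s5)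
    then show ?thesis by (simp add: y)
  qed
  have "h^2 = ((s + 1)^2 * t)^5 * ((s^5 - 1)^2 * t^5)"
    unfolding hq by (simp add: power_mult_distrib power_mult [symmetric]) (simp add: mult_ac power2_eq_square)
  also have "(s^5 - 1)^2 * t^5 = s^5 * (s^5 * t^5) - 2 * (s^5 * t^5) + t^5"
    by (simp add: power2_eq_square algebra_simps)
  also have "\<dots> = w^5 - 5 * w^3 + 5 * w - 2" unfolding w5 s5 by simp
  also have "\<dots> = (q - 4) * (q^2 - 3*q + 1)^2"
    unfolding q_def w_def [symmetric] by (simp add: algebra_simps eval_nat_numeral)
  finally have e: "h^2 = q^5 * (q - 4) * (q^2 - 3*q + 1)^2"
    unfolding q [symmetric] by (simp add: mult.assoc)
  \<comment> \<open>Under s \<mapsto> 1/s, h changes sign and y(s) - y(1/s) = 4 h. Subtracting 2 h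
    therefore leaves the mean of y(s) and y(1/s), which is symmetric.\<close>
  have "y - 2 * h = (s + 1)^4 * t^5 * (5 * s^5 + s - 4 - 2 * (s^5 - 1) * (s + 1))"
    unfolding hq yq by (simp add: algebra_simps eval_nat_numeral)
  also have "\<dots> = (s + 1)^4 * t^2 * (t^3 * (-2*s^6 + 3*s^5 + 3*s - 2))"
    by (simp add: algebra_simps eval_nat_numeral)
  also have "t^3 * (-2*s^6 + 3*s^5 + 3*s - 2) = -2*s^3 + 3*s^2 + 3*t^2 - 2*t^3"
    by (simp add: algebra_simps eval_nat_numeral red st)
  also have "\<dots> = -2 * (w^3 - 3 * w) + 3 * (w^2 - 2)"
    unfolding w3 w2 by (simp add: algebra_simps)
  also have "\<dots> = 10 - 30*q + 15*q^2 - 2*q^3"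
    unfolding q_def w_def [symmetric] by (simp add: algebra_simps eval_nat_numeral)
  also have "(s + 1)^4 * t^2 = q^2"
    unfolding q by (simp add: power_mult_distrib flip: power_mult)
  finally have v: "y - 2 * h = q^2 * (10 - 30*q + 15*q^2 - 2*q^3)" .
  show ?thesis unfolding e v by (rule elim_poly_identity)
qed

text \<open>The arguments are (25 H)^2 and 125 F + 32 - 50 H. The factor 5^(-30) = 125^(-10) makes
  the polynomial monic in F.\<close>

definition F6_poly :: "rat poly poly" where
  "F6_poly = [:[:1 / 5^30:]:] * elim_poly [:[:0, 0, 625:]:] [:[:32, -50:], [:125:]:]"

interpretation fps_of_poly_hom: map_poly_comm_ring_hom "fps_of_poly :: rat poly \<Rightarrow> rat fps"
  by unfold_locales (simp_all add: fps_of_poly_add fps_of_poly_mult)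

lemma eval_at_series_F6_poly:
  "eval_at_series F6_poly S = fps_const (1 / 5^30) * elim_poly ((25 * fps_X)^2) (125 * S + 32 - 2 * (25 * fps_X))"
proof -
  interpret h: comm_ring_hom "\<lambda>p. eval_at_series p S"
    unfolding eval_at_series_def
    by unfold_locales (simp_all add: fps_of_poly_hom.hom_add fps_of_poly_hom.hom_mult)
  show ?thesis
    unfolding F6_poly_def h.hom_mult h.hom_elim_poly
    by (simp add: eval_at_series_def fps_of_poly_pCons numeral_fps_const algebra_simps power2_eq_square
        fps_const_neg [symmetric] del: fps_const_neg)
qed

lemma specialize_H_F6_poly:
  "specialize_H a F6_poly = [:1 / 5^30:] * elim_poly [:(25 * a)^2:] [:32 - 50 * a, 125:]"
proof -
  interpret e: map_poly_comm_ring_hom "\<lambda>c. poly c a" by unfold_locales simp_all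
  interpret h: comm_ring_hom "specialize_H a"
    unfolding specialize_H_def
    by unfold_locales (simp_all add: e.hom_add e.hom_mult)
  show ?thesis
    unfolding F6_poly_def h.hom_mult h.hom_elim_poly
    by (simp add: specialize_H_def power2_eq_square mult_ac)
qed

text \<open>The fibre over h = 0: q = 4 (s = 1) gives v = 32, the fivefold root q = 0 (s = -1) gives
  v = 0, and the primitive fifth roots of unity, where q^2 - 3q + 1 = 0, give the squared quadratic
  factor.\<close>

lemma elim_poly_zero: "elim_poly 0 v = (v - 32) * v^5 * (v^2 + 11 * v - 1)^2"
  by (simp add: elim_poly_def algebra_simps eval_nat_numeral)

lemma specialize_H_0_F6_poly:
  "specialize_H 0 F6_poly =
      Polynomial.smult (1 / 5 ^ 21) ([:0, 1:] * [:32, 125:] ^ 5 * [:11, 75, 125:] ^ 2)"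
proof -
  have 1: "[:32, 125:] - 32 = [:125:] * [:0, 1 :: rat:]" by (simp add: numeral_poly)
  have 2: "[:32, 125:]^2 + 11 * [:32, 125:] - 1 = [:125:] * [:11, 75, 125 :: rat:]"
    by (simp add: numeral_poly power2_eq_square one_pCons)
  have c: "[:1 / 5^30:] * ([:125:] * [:125:]^2) = [:1 / 5 ^ 21 :: rat:]"
    by (simp add: power2_eq_square)
  have 0: "[:(25 * 0)^2:] = (0 :: rat poly)" "[:32 - 50 * 0, 125:] = [:32, 125 :: rat:]" by simp_all
  have "specialize_H 0 F6_poly = ([:1 / 5^30:] * ([:125:] * [:125:]^2)) * ([:0, 1:] * [:32, 125:] ^ 5 * [:11, 75, 125:] ^ 2)"
    unfolding specialize_H_F6_poly 0 elim_poly_zero 1 2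
    by (simp only: power_mult_distrib mult_ac)
  then show ?thesis unfolding c by simp
qed

lemma elim_poly_leading:
  fixes e v :: "'a :: idom poly"
  assumes e: "degree e = 0" and v: "degree v = 1"
  shows "degree (elim_poly e v) = 10" "coeff (elim_poly e v) 10 = coeff v 1 ^ 10"
proof -
  obtain r where r: "elim_poly e v = v^10 + r" "degree r \<le> 9"
  proof
    let ?r = "(- 10) * v^9 + (-585 - 20*e) * v^8 + (-3830 + 160*e) * v^7
     + (705 + 13020*e + 160*e^2) * v^6 + (-32 + 82140*e - 7210*e^2) * v^5
     + (-43320*e - 58830*e^2 - 640*e^3) * v^4 + (2000*e + 3092970*e^2 - 247440*e^3) * v^3
     + (25914500*e^2 + 3395440*e^3 + 1280*e^4) * v^2
     + (-4500000*e^2 + 137821500*e^3 - 502560*e^4) * v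
     + (200000*e^2 + 888000000*e^3 + 13241625*e^4 - 1024*e^5)"
    show "elim_poly e v = v^10 + ?r" unfolding elim_poly_def by simp
    obtain c where c: "e = [:c:]" using e by (metis degree_eq_zeroE)
    have vj: "degree (v ^ j) \<le> j" for j using degree_power_le[of v j] v by simp
    have num: "numeral n = [:numeral n:]" for n by (simp add: numeral_poly)
    have t: "degree (e' * v ^ j) \<le> 9" if "degree e' = 0" "j \<le> 9" for e' j
      using degree_mult_le[of e' "v ^ j"] vj[of j] that by linarith
    have t1: "degree (e' * v) \<le> 9" if "degree e' = 0" for e'
      using t[of e' 1] that by simp
    show "degree ?r \<le> 9"
      unfolding c num
      by (intro degree_add_le degree_diff_le t t1; simp add: t power2_eq_square eval_nat_numeral)
  qed
  have "degree (v^10) = 10" using v by (subst degree_power_eq) auto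
  then show "degree (elim_poly e v) = 10" using r by (simp add: degree_add_eq_left)
  have "coeff (v^10) 10 = coeff v 1 ^ 10"
    using lead_coeff_power[of v 10] \<open>degree (v^10) = 10\<close> v by simp
  then show "coeff (elim_poly e v) 10 = coeff v 1 ^ 10"
    using r coeff_eq_0[of r 10] by simp
qed

lemma F6_poly_monic: "degree F6_poly = 10" "coeff F6_poly 10 = 1"
proof -
  have "degree [:[:32, -50:], [:125 :: rat:]:] = 1" by simp
  note l = elim_poly_leading[OF _ this, of "[:[:0, 0, 625:]:]", simplified degree_pCons_0, OF refl]
  show "degree F6_poly = 10" unfolding F6_poly_def by (simp add: l)
  show "coeff F6_poly 10 = 1" unfolding F6_poly_def by (simp add: l poly_const_pow)
qed

section \<open>Algebraic integers\<close>

text \<open>Finitely generated subgroups of C stand behind the proof that algebraic integers are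
  closed under sum and product.\<close>

inductive_set int_span :: "complex set \<Rightarrow> complex set" for S where
  zero: "0 \<in> int_span S"
| add: "x \<in> int_span S \<Longrightarrow> s \<in> S \<Longrightarrow> x + s \<in> int_span S"
| diff: "x \<in> int_span S \<Longrightarrow> s \<in> S \<Longrightarrow> x - s \<in> int_span S"

lemma int_span_base: "s \<in> S \<Longrightarrow> s \<in> int_span S"
  using int_span.add[OF int_span.zero] by fastforce

lemma int_span_plus:
  assumes "x \<in> int_span S" "y \<in> int_span S"
  shows "x + y \<in> int_span S"
  using assms(2)
proof induction
  case (add y s)
  then show ?case using int_span.add[of "x + y" S s] by (simp add: add.assoc)
next
  case (diff y s)
  then show ?case using int_span.diff[of "x + y" S s] by (simp add: add_diff_eq)
qed (simp add: assms)

lemma int_span_uminus: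
  assumes "x \<in> int_span S"
  shows "- x \<in> int_span S"
  using assms
proof induction
  case (add x s)
  then show ?case using int_span.diff[of "- x" S s] by (simp only: minus_add_distrib diff_conv_add_uminus)
next
  case (diff x s)
  then show ?case using int_span.add[of "- x" S s] by (simp add: algebra_simps)
qed (simp add: int_span.zero)

lemma int_span_of_int_mult:
  assumes "x \<in> int_span S"
  shows "of_int c * x \<in> int_span S"
proof -
  have nat: "of_nat n * x \<in> int_span S" for n
    by (induction n) (simp_all add: int_span.zero int_span_plus assms distrib_right)
  show ?thesis
    using nat[of "nat c"] int_span_uminus[OF nat[of "nat (- c)"]]
    by (cases "c \<ge> 0") simp_all
qed

lemma int_span_sum: "(\<And>i. i \<in> A \<Longrightarrow> f i \<in> int_span S) \<Longrightarrow> sum f A \<in> int_span S"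
  by (induction A rule: infinite_finite_induct) (simp_all add: int_span.zero int_span_plus)

lemma int_span_mult:
  assumes "x \<in> int_span S" "y \<in> int_span T"
  shows "x * y \<in> int_span ((\<lambda>(s, t). s * t) ` (S \<times> T))" (is "_ \<in> int_span ?U")
proof -
  have s: "s * y \<in> int_span ?U" if "s \<in> S" for s
    using assms(2)
  proof induction
    case (add y t)
    then show ?case using int_span.add[of "s * y" ?U "s * t"] that by (auto simp: algebra_simps)
  next
    case (diff y t)
    then show ?case using int_span.diff[of "s * y" ?U "s * t"] that by (auto simp: algebra_simps)
  qed (simp add: int_span.zero)
  show ?thesis
    using assms(1)
  proof induction
    case (add x t)
    then show ?case using int_span_plus[OF add.IH s] by (simp add: algebra_simps)
  next
    case (diff x t)
    then show ?case using int_span_plus[OF diff.IH int_span_uminus[OF s]] by (simp add: algebra_simps)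
  qed (simp add: int_span.zero)
qed

lemma int_span_coeffs:
  assumes "finite S" "x \<in> int_span S"
  shows "\<exists>c :: complex \<Rightarrow> int. x = (\<Sum>s\<in>S. of_int (c s) * s)"
  using assms(2)
proof induction
  case zero
  then show ?case by (intro exI[of _ "\<lambda>_. 0"]) simp
next
  case (add x s)
  then obtain c where c: "x = (\<Sum>s\<in>S. of_int (c s) * s)" by auto
  have "(\<Sum>t\<in>S. of_int (c t + (if t = s then 1 else 0)) * t) = x + s"
    using assms(1) add.hyps by (simp add: c distrib_right sum.distrib if_distrib[of "\<lambda>u. u * _"] if_distrib[of of_int] sum.delta cong: if_cong)
  then show ?case by metis
next
  case (diff x s)
  then obtain c where c: "x = (\<Sum>s\<in>S. of_int (c s) * s)" by auto
  have "(\<Sum>t\<in>S. of_int (c t + (if t = s then -1 else 0)) * t) = x - s"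
    using assms(1) diff.hyps by (simp add: c distrib_right sum.distrib if_distrib[of "\<lambda>u. u * _"] if_distrib[of of_int] sum.delta cong: if_cong)
  then show ?case by metis
qed

text \<open>A number that maps a finitely generated additive group into itself is an eigenvalue of an
  integer matrix.\<close>

lemma algebraic_int_if_int_span_stable:
  assumes fin: "finite S" and nz: "s0 \<in> S" "s0 \<noteq> 0" and stable: "\<And>s. s \<in> S \<Longrightarrow> x * s \<in> int_span S"
  shows "algebraic_int x"
proof -
  define n where "n = card S"
  obtain e where e: "bij_betw e {..<n} S"
    using fin n_def by (metis atLeast0LessThan ex_bij_betw_nat_finite)
  have "\<exists>c :: complex \<Rightarrow> int. x * e i = (\<Sum>s\<in>S. of_int (c s) * s)" if "i < n" for i
    using int_span_coeffs[OF fin stable] e that by (auto simp: bij_betw_def)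
  then obtain c :: "nat \<Rightarrow> complex \<Rightarrow> int" where c: "\<And>i. i < n \<Longrightarrow> x * e i = (\<Sum>s\<in>S. of_int (c i s) * s)"
    by metis
  have c': "x * e i = (\<Sum>j<n. of_int (c i (e j)) * e j)" if "i < n" for i
    unfolding c[OF that] by (rule sum.reindex_bij_betw[OF e, symmetric])
  define A :: "int mat" where "A = mat n n (\<lambda>(i, j). c i (e j))"
  define A' :: "complex mat" where "A' = map_mat of_int A"
  have A: "A \<in> carrier_mat n n" "A' \<in> carrier_mat n n" by (simp_all add: A_def A'_def)
  define v where "v = vec n e"
  have "A' *\<^sub>v v = x \<cdot>\<^sub>v v"
    by (rule eq_vecI)
      (auto simp: A'_def A_def v_def scalar_prod_def c' atLeast0LessThan intro!: sum.cong)
  moreover have "v \<noteq> 0\<^sub>v n"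
  proof
    assume "v = 0\<^sub>v n"
    then have "e i = 0" if "i < n" for i using that by (metis v_def index_vec index_zero_vec(1))
    moreover obtain i where "i < n" "e i = s0" using nz e by (auto simp: bij_betw_def)
    ultimately show False using nz by auto
  qed
  ultimately have "eigenvalue A' x"
    unfolding eigenvalue_def eigenvector_def
    by (intro exI[of _ v]) (simp add: v_def A'_def A_def)
  then have "poly (char_poly A') x = 0" using eigenvalue_root_char_poly[OF A(2)] by simp
  moreover have "char_poly A' = of_int_poly (char_poly A)"
    unfolding A'_def by (rule of_int_hom.char_poly_hom[OF A(1)])
  moreover have "lead_coeff (char_poly A) = 1"
    using degree_monic_char_poly[OF A(1)] by simp
  ultimately show ?thesis unfolding algebraic_int_altdef_ipoly by auto
qed

text \<open>Z[a] is spanned by 1, a, ..., a^(n-1), because the monic equation of degree n expresses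
  a^n through lower powers.\<close>

lemma algebraic_int_power_span:
  fixes a :: complex
  assumes "algebraic_int a"
  obtains S where "finite S" "1 \<in> S" "\<And>s. s \<in> int_span S \<Longrightarrow> a * s \<in> int_span S"
proof -
  obtain p where p: "poly (of_int_poly p) a = 0" "lead_coeff p = 1"
    using assms by (auto simp: algebraic_int_altdef_ipoly)
  define n where "n = degree p"
  have n: "n > 0"
  proof (rule ccontr)
    assume "\<not> n > 0"
    then have "p = 1" using p(2) by (metis degree_eq_zeroE lead_coeff_pCons(2) n_def not_gr_zero one_pCons)
    then show False using p(1) by simp
  qed
  define S where "S = (\<lambda>k. a ^ k) ` {..<n}"
  have "a ^ n \<in> int_span S"
  proof -
    have "poly (of_int_poly p) a = (\<Sum>k\<le>n. of_int (coeff p k) * a ^ k)"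
      by (simp add: poly_altdef n_def)
    also have "\<dots> = a ^ n + (\<Sum>k<n. of_int (coeff p k) * a ^ k)"
      using p(2) by (simp add: lessThan_Suc_atMost [symmetric] n_def)
    finally have "a ^ n = - (\<Sum>k<n. of_int (coeff p k) * a ^ k)"
      using p(1) by (simp add: eq_neg_iff_add_eq_0)
    moreover have "(\<Sum>k<n. of_int (coeff p k) * a ^ k) \<in> int_span S"
      by (intro int_span_sum int_span_of_int_mult int_span_base) (auto simp: S_def)
    ultimately show ?thesis by (simp add: int_span_uminus)
  qed
  then have step: "a * s \<in> int_span S" if sS: "s \<in> S" for s
  proof -
    obtain k where k: "k < n" "s = a ^ k" using sS by (auto simp: S_def)
    show ?thesis
    proof (cases "Suc k = n")
      case True
      then show ?thesis using \<open>a ^ n \<in> int_span S\<close> k by auto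
    next
      case False
      then have "a ^ Suc k \<in> S" using k unfolding S_def by (intro imageI) simp
      then show ?thesis using k int_span_base by simp
    qed
  qed
  show thesis
  proof
    show "finite S" by (simp add: S_def)
    show "1 \<in> S" unfolding S_def using n by (intro image_eqI[of _ _ 0]) simp_all
    show "a * s \<in> int_span S" if "s \<in> int_span S" for s
      using that
    proof induction
      case (add x s)
      then show ?case using int_span_plus[OF add.IH step[OF add.hyps(2)]] by (simp add: algebra_simps)
    next
      case (diff x s)
      then show ?case using int_span_plus[OF diff.IH int_span_uminus[OF step[OF diff.hyps(2)]]] by (simp add: algebra_simps)
    qed (simp add: int_span.zero)
  qed
qed

text \<open>The products of generators of Z[a] and Z[b] span a group that contains 1 and is stable
  under multiplication by a and by b, hence by a + b and a * b.\<close>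

lemma
  fixes a b :: complex
  assumes a: "algebraic_int a" and b: "algebraic_int b"
  shows algebraic_int_plus: "algebraic_int (a + b)"
    and algebraic_int_times: "algebraic_int (a * b)"
proof -
  obtain S where S: "finite S" "1 \<in> S" "\<And>s. s \<in> int_span S \<Longrightarrow> a * s \<in> int_span S"
    using algebraic_int_power_span[OF a] by metis
  obtain T where T: "finite T" "1 \<in> T" "\<And>s. s \<in> int_span T \<Longrightarrow> b * s \<in> int_span T"
    using algebraic_int_power_span[OF b] by metis
  define U where "U = (\<lambda>(s, t). s * t) ` (S \<times> T)"
  have U: "finite U" "1 \<in> U" unfolding U_def using S T by (auto intro!: image_eqI[of _ _ "(1, 1)"])
  have mem: "x * y \<in> int_span U" if "x \<in> int_span S" "y \<in> int_span T" for x y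
    unfolding U_def by (rule int_span_mult) (use that in auto)
  have prod: "a * u \<in> int_span U" "b * u \<in> int_span U" "a * b * u \<in> int_span U" if uU: "u \<in> U" for u
  proof -
    obtain s t where u: "u = s * t" "s \<in> S" "t \<in> T" using uU by (auto simp: U_def)
    note st = int_span_base[OF u(2)] int_span_base[OF u(3)]
    show "a * u \<in> int_span U" using mem[OF S(3)[OF st(1)] st(2)] by (simp add: u mult_ac)
    show "b * u \<in> int_span U" using mem[OF st(1) T(3)[OF st(2)]] by (simp add: u mult_ac)
    show "a * b * u \<in> int_span U" using mem[OF S(3)[OF st(1)] T(3)[OF st(2)]] by (simp add: u mult_ac)
  qed
  show "algebraic_int (a + b)"
    by (rule algebraic_int_if_int_span_stable[OF U(1,2)])
      (auto simp: distrib_right intro!: int_span_plus prod)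
  show "algebraic_int (a * b)"
    by (rule algebraic_int_if_int_span_stable[OF U(1,2)]) (auto intro!: prod)
qed

lemma algebraic_int_sum:
  "(\<And>i. i \<in> A \<Longrightarrow> algebraic_int (f i :: complex)) \<Longrightarrow> algebraic_int (sum f A)"
  by (induction A rule: infinite_finite_induct) (simp_all add: algebraic_int_plus)

section \<open>Reduction modulo a prime\<close>

text \<open>M is a prime ideal over p of the subring A. The ambient ring is left general because the
  locale is used for the algebraic integers and then twice more, for polynomials over them in one
  and in two variables.\<close>

locale prime_over =
  fixes A M :: "'a :: comm_ring_1 set" and p :: nat
  assumes A_1: "1 \<in> A" and A_add: "a \<in> A \<Longrightarrow> b \<in> A \<Longrightarrow> a + b \<in> A"
    and A_uminus: "a \<in> A \<Longrightarrow> - a \<in> A" and A_mult: "a \<in> A \<Longrightarrow> b \<in> A \<Longrightarrow> a * b \<in> A"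
    and M_A: "M \<subseteq> A" and M_add: "a \<in> M \<Longrightarrow> b \<in> M \<Longrightarrow> a + b \<in> M"
    and M_mult: "a \<in> A \<Longrightarrow> b \<in> M \<Longrightarrow> a * b \<in> M"
    and M_prime: "a \<in> A \<Longrightarrow> b \<in> A \<Longrightarrow> a * b \<in> M \<Longrightarrow> a \<in> M \<or> b \<in> M"
    and M_1: "1 \<notin> M" and M_p: "of_nat p \<in> M" and prime_p: "prime p"

text \<open>Zorn's lemma among the proper ideals containing p. The ideal generated by p is proper
  since 1/p is rational but not an integer, hence not an algebraic integer.\<close>

lemma ex_prime_over:
  assumes p: "prime p"
  shows "\<exists>M. prime_over {x :: complex. algebraic_int x} M p"
proof -
  let ?O = "{x :: complex. algebraic_int x}"
  define ideals where "ideals = {I. I \<subseteq> ?O \<and> (\<forall>a\<in>I. \<forall>b\<in>I. a + b \<in> I) \<and> (\<forall>a\<in>?O. \<forall>b\<in>I. a * b \<in> I) \<and>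
      1 \<notin> I \<and> of_nat p \<in> I}"
  have "{of_nat p * x |x. x \<in> ?O} \<in> ideals"
  proof -
    have "1 \<noteq> of_nat p * x" if "x \<in> ?O" for x :: complex
    proof
      assume x: "1 = of_nat p * x"
      have p0: "(of_nat p :: complex) \<noteq> 0" using p by auto
      have "x = 1 / of_nat p" using x p0 by (simp add: field_simps)
      then have "x \<in> \<rat>" by auto
      then have "x \<in> \<int>" using that rational_algebraic_int_is_int by auto
      then obtain k where "x = of_int k" by (auto elim: Ints_cases)
      then have "of_int 1 = (of_int (int p * k) :: complex)" using x by simp
      then have "int p * k = 1" by (metis of_int_eq_iff)
      then have "int p dvd int 1" by (metis dvd_triv_left of_nat_1)
      then have "p dvd 1" by (simp only: int_dvd_int_iff)
      then show False using p by (simp add: prime_nat_iff)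
    qed
    moreover have "\<exists>z. of_nat p * x + of_nat p * y = of_nat p * z \<and> algebraic_int z" if "algebraic_int x" "algebraic_int y" for x y :: complex
      using that by (intro exI[of _ "x + y"]) (simp add: algebraic_int_plus algebra_simps)
    moreover have "\<exists>z. a * (of_nat p * x) = of_nat p * z \<and> algebraic_int z" if "algebraic_int a" "algebraic_int x" for x a :: complex
      using that by (intro exI[of _ "a * x"]) (simp add: algebraic_int_times algebra_simps)
    moreover have "\<exists>x. of_nat p = of_nat p * x \<and> algebraic_int (x :: complex)"
      by (intro exI[of _ 1]) simp
    ultimately show ?thesis
      unfolding ideals_def by (auto intro: algebraic_int_times)
  qed
  then have ne: "ideals \<noteq> {}" by blast
  have "\<exists>M\<in>ideals. \<forall>Y\<in>ideals. M \<subseteq> Y \<longrightarrow> Y = M"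
  proof (rule subset_Zorn_nonempty[OF ne])
    fix C assume C: "C \<noteq> {}" "subset.chain ideals C"
    have CI: "C \<subseteq> ideals" using C(2) by (simp add: subset.chain_def)
    have "a + b \<in> \<Union>C" if "a \<in> \<Union>C" "b \<in> \<Union>C" for a b
    proof -
      obtain I J where IJ: "I \<in> C" "a \<in> I" "J \<in> C" "b \<in> J" using \<open>a \<in> \<Union>C\<close> \<open>b \<in> \<Union>C\<close> by auto
      have "I \<subseteq> J \<or> J \<subseteq> I" using C(2) IJ by (auto simp: subset_chain_def)
      then show ?thesis using IJ CI unfolding ideals_def by blast
    qed
    then show "\<Union>C \<in> ideals"
      using C(1) CI unfolding ideals_def by blast
  qed
  then obtain M where M: "M \<in> ideals" and max: "\<And>Y. Y \<in> ideals \<Longrightarrow> M \<subseteq> Y \<Longrightarrow> Y = M" by blast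
  have MO: "M \<subseteq> ?O" and Madd: "\<And>a b. a \<in> M \<Longrightarrow> b \<in> M \<Longrightarrow> a + b \<in> M"
    and Mmult: "\<And>a b. algebraic_int a \<Longrightarrow> b \<in> M \<Longrightarrow> a * b \<in> M" and M1: "1 \<notin> M" and Mp: "of_nat p \<in> M"
    using M unfolding ideals_def by auto
  \<comment> \<open>Maximal ideals are prime: Y, generated by M and a, must contain 1, and
    multiplying 1 = m + a c by b puts b into M.\<close>
  have prime: "b \<in> M" if a: "algebraic_int a" and b: "algebraic_int b" and ab: "a * b \<in> M" and an: "a \<notin> M" for a b
  proof -
    define Y where "Y = {m + a * c |m c. m \<in> M \<and> algebraic_int c}"
    have 0: "0 \<in> M" using Mmult[of 0 "of_nat p"] Mp by simp
    have "M \<subseteq> Y" unfolding Y_def using algebraic_int_0 by (force intro: exI[of _ 0])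
    moreover have "a \<in> Y" unfolding Y_def using 0 algebraic_int_1 by (force intro: exI[of _ 1])
    ultimately have "Y \<notin> ideals" using max an by blast
    moreover have "Y \<subseteq> ?O" unfolding Y_def using MO a by (auto intro!: algebraic_int_plus algebraic_int_times)
    moreover have "x + y \<in> Y" if xy: "x \<in> Y" "y \<in> Y" for x y
    proof -
      obtain m c m' c' where "x = m + a * c" "y = m' + a * c'" "m \<in> M" "m' \<in> M" "algebraic_int c" "algebraic_int c'"
        using xy unfolding Y_def by blast
      then show ?thesis unfolding Y_def
        by (intro CollectI exI[of _ "m + m'"] exI[of _ "c + c'"]) (simp add: Madd algebraic_int_plus algebra_simps)
    qed
    moreover have "d * x \<in> Y" if xd: "algebraic_int d" "x \<in> Y" for d x
    proof -
      obtain m c where "x = m + a * c" "m \<in> M" "algebraic_int c"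
        using xd unfolding Y_def by blast
      then show ?thesis unfolding Y_def using xd
        by (intro CollectI exI[of _ "d * m"] exI[of _ "d * c"]) (simp add: Mmult algebraic_int_times algebra_simps)
    qed
    moreover have "of_nat p \<in> Y" using \<open>M \<subseteq> Y\<close> Mp by blast
    ultimately have "1 \<in> Y" unfolding ideals_def by auto
    then obtain m c where mc: "1 = m + a * c" "m \<in> M" "algebraic_int c" unfolding Y_def by blast
    have "b = b * (m + a * c)" using mc(1) by simp
    also have "\<dots> = b * m + c * (a * b)" by (simp add: algebra_simps)
    finally show "b \<in> M" using Madd[OF Mmult[OF b mc(2)] Mmult[OF mc(3) ab]] by simp
  qed
  have prime': "a \<in> M \<or> b \<in> M" if "algebraic_int a" "algebraic_int b" "a * b \<in> M" for a b
    using prime[OF that] by blast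
  have "prime_over ?O M p"
    by (rule prime_over.intro)
      (simp_all add: algebraic_int_plus algebraic_int_times MO Madd Mmult M1 Mp p prime')
  then show ?thesis ..
qed

section \<open>Simple extensions of the rationals\<close>

definition rpoly :: "rat poly \<Rightarrow> complex \<Rightarrow> complex" where
  "rpoly q t = poly (map_poly of_rat q) t"

interpretation of_rat_poly: map_poly_comm_ring_hom "of_rat :: rat \<Rightarrow> complex" ..

lemma rpoly_hom: "comm_ring_hom (\<lambda>q. rpoly q t)"
  unfolding rpoly_def by unfold_locales (simp_all add: of_rat_poly.hom_add of_rat_poly.hom_mult)

interpretation rpoly: comm_ring_hom "\<lambda>q. rpoly q t" for t by (rule rpoly_hom)

lemma rpoly_simps [simp]: "rpoly 0 t = 0" "rpoly 1 t = 1" "rpoly [:c:] t = of_rat c" "rpoly [:0, 1:] t = t"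
  by (simp_all add: rpoly_def of_rat_hom.map_poly_pCons_hom)

lemma rpoly_pcompose: "rpoly (pcompose q r) t = rpoly q (rpoly r t)"
  unfolding rpoly_def by (simp add: of_rat_hom.map_poly_pcompose poly_pcompose)

definition Qadj :: "complex \<Rightarrow> complex set" where
  "Qadj \<theta> = range (\<lambda>q. rpoly q \<theta>)"

lemma Qadj_rpoly [simp, intro]: "rpoly q \<theta> \<in> Qadj \<theta>"
  by (simp add: Qadj_def)

lemma QadjE: assumes "x \<in> Qadj \<theta>" obtains q where "x = rpoly q \<theta>"
  using assms by (auto simp: Qadj_def)

lemma Qadj_add: "x \<in> Qadj \<theta> \<Longrightarrow> y \<in> Qadj \<theta> \<Longrightarrow> x + y \<in> Qadj \<theta>"
  by (metis QadjE Qadj_rpoly rpoly.hom_add)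

lemma Qadj_mult: "x \<in> Qadj \<theta> \<Longrightarrow> y \<in> Qadj \<theta> \<Longrightarrow> x * y \<in> Qadj \<theta>"
  by (metis QadjE Qadj_rpoly rpoly.hom_mult)

lemma Qadj_uminus: "x \<in> Qadj \<theta> \<Longrightarrow> - x \<in> Qadj \<theta>"
  by (metis QadjE Qadj_rpoly rpoly.hom_uminus)

lemma Qadj_diff: "x \<in> Qadj \<theta> \<Longrightarrow> y \<in> Qadj \<theta> \<Longrightarrow> x - y \<in> Qadj \<theta>"
  by (metis QadjE Qadj_rpoly rpoly.hom_minus)

lemma Qadj_of_rat: "of_rat c \<in> Qadj \<theta>"
  by (metis Qadj_rpoly rpoly_simps(3))

lemma Qadj_simps [simp]: "0 \<in> Qadj \<theta>" "1 \<in> Qadj \<theta>" "of_int k \<in> Qadj \<theta>" "numeral w \<in> Qadj \<theta>"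
  using Qadj_of_rat[of 0] Qadj_of_rat[of 1] Qadj_of_rat[of "of_int k"] Qadj_of_rat[of "numeral w"] by simp_all

lemma Qadj_self: "\<theta> \<in> Qadj \<theta>"
  by (metis Qadj_rpoly rpoly_simps(4))

lemma Qadj_power: "x \<in> Qadj \<theta> \<Longrightarrow> x ^ n \<in> Qadj \<theta>"
  by (induction n) (simp_all add: Qadj_mult)

lemma Qadj_sum: "(\<And>i. i \<in> A \<Longrightarrow> f i \<in> Qadj \<theta>) \<Longrightarrow> sum f A \<in> Qadj \<theta>"
  by (induction A rule: infinite_finite_induct) (simp_all add: Qadj_add)

lemma Qadj_subset: "x \<in> Qadj \<theta> \<Longrightarrow> Qadj x \<subseteq> Qadj \<theta>"
  by (auto simp: Qadj_def simp flip: rpoly_pcompose)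

text \<open>A generator of the ideal of rational polynomials vanishing at \<theta>, determined up to
  a scalar.\<close>

definition is_min_poly :: "complex \<Rightarrow> rat poly \<Rightarrow> bool" where
  "is_min_poly \<theta> m \<longleftrightarrow> m \<noteq> 0 \<and> (\<forall>q. rpoly q \<theta> = 0 \<longleftrightarrow> m dvd q)"

lemma rpoly_zero_iff_algebraic: "algebraic \<theta> \<longleftrightarrow> (\<exists>q. q \<noteq> 0 \<and> rpoly q \<theta> = 0)"
proof
  assume "algebraic \<theta>"
  then obtain p where p: "\<forall>i. coeff p i \<in> \<rat>" "p \<noteq> 0" "poly p \<theta> = 0"
    by (auto simp: algebraic_altdef)
  have "\<forall>i. \<exists>r. coeff p i = of_rat r" using p(1) by (auto elim: Rats_cases)
  then obtain c where "\<forall>i. coeff p i = of_rat (c i)" using choice[of "\<lambda>i r. coeff p i = of_rat r"] by auto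
  then have c: "\<And>i. coeff p i = of_rat (c i)" by simp
  define q where "q = Abs_poly c"
  have "coeff q i = c i" for i
    unfolding q_def
  proof (subst coeff_Abs_poly)
    show "c i = 0" if "i > degree p" for i
      using c[of i] coeff_eq_0[OF that] by simp
  qed simp
  then have "map_poly of_rat q = p" by (intro poly_eqI) (simp add: c)
  then show "\<exists>q. q \<noteq> 0 \<and> rpoly q \<theta> = 0"
    using p by (intro exI[of _ q]) (auto simp: rpoly_def)
next
  assume "\<exists>q. q \<noteq> 0 \<and> rpoly q \<theta> = 0"
  then obtain q where q: "q \<noteq> 0" "rpoly q \<theta> = 0" by blast
  show "algebraic \<theta>"
    unfolding algebraic_altdef
    using q by (intro exI[of _ "map_poly of_rat q"]) (auto simp: rpoly_def)
qed

lemma ex_min_poly: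
  assumes "algebraic \<theta>"
  shows "\<exists>m. is_min_poly \<theta> m"
proof -
  obtain m where m: "m \<noteq> 0" "rpoly m \<theta> = 0"
    and least: "\<And>q. q \<noteq> 0 \<Longrightarrow> rpoly q \<theta> = 0 \<Longrightarrow> degree m \<le> degree q"
    using assms ex_has_least_nat[of "\<lambda>q. q \<noteq> 0 \<and> rpoly q \<theta> = 0" _ degree]
    unfolding rpoly_zero_iff_algebraic by blast
  have "m dvd q" if "rpoly q \<theta> = 0" for q
  proof -
    have "rpoly (m * (q div m) + q mod m) \<theta> = 0" using that by simp
    then have "rpoly (q mod m) \<theta> = 0" by (simp only: rpoly.hom_add rpoly.hom_mult m) simp
    then have "q mod m = 0"
      using least[of "q mod m"] degree_mod_less[OF m(1), of q] by fastforce
    then show ?thesis by (simp add: dvd_eq_mod_eq_0)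
  qed
  then show ?thesis
    unfolding is_min_poly_def using m by (metis dvdE mult_zero_left rpoly.hom_mult)
qed

text \<open>Write m = gcd m q * k. The gcd does not vanish at \<theta>, since otherwise q would; so
  k vanishes there, m divides k, and the gcd is a unit.\<close>

lemma min_poly_bezout:
  assumes m: "is_min_poly \<theta> m" and q: "rpoly q \<theta> \<noteq> 0"
  obtains u v where "u * m + v * q = 1"
proof -
  have "gcd m q = 1"
  proof -
    obtain k where k: "m = gcd m q * k" by (meson dvdE gcd_dvd1)
    have m0: "m \<noteq> 0" and root: "\<And>r. rpoly r \<theta> = 0 \<longleftrightarrow> m dvd r" using m by (auto simp: is_min_poly_def)
    have "rpoly (gcd m q) \<theta> \<noteq> 0" using q root dvd_trans by (metis gcd_dvd2)
    moreover have "rpoly (gcd m q) \<theta> * rpoly k \<theta> = 0"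
      using root[of m] k by (metis dvd_refl rpoly.hom_mult)
    ultimately have "m dvd k" using root by simp
    then obtain l where l: "k = m * l" by blast
    have "m * (gcd m q * l) = m * 1" using k l by (metis mult.assoc mult.commute mult_1_right)
    then have "gcd m q * l = 1" using m0 by (simp only: mult_cancel_left) simp
    then have "is_unit (gcd m q)" by (metis dvdI)
    then show ?thesis using coprime_imp_gcd_eq_1 is_unit_gcd by blast
  qed
  then show thesis
    using that bezout_coefficients_fst_snd[of m q] by metis
qed

lemma Qadj_inverse:
  assumes "algebraic \<theta>" "x \<in> Qadj \<theta>"
  shows "inverse x \<in> Qadj \<theta>"
proof (cases "x = 0")
  case False
  obtain m where m: "is_min_poly \<theta> m" using ex_min_poly[OF assms(1)] by blast
  obtain q where q: "x = rpoly q \<theta>" using assms(2) by (rule QadjE)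
  obtain u v where uv: "u * m + v * q = 1" using min_poly_bezout[OF m, of q] False q by metis
  have "rpoly m \<theta> = 0" using m by (auto simp: is_min_poly_def)
  then have "rpoly v \<theta> * x = 1"
    using arg_cong[OF uv, of "\<lambda>q. rpoly q \<theta>"] by (simp add: rpoly.hom_add rpoly.hom_mult q)
  then have "inverse x = rpoly v \<theta>" by (metis inverse_unique mult.commute)
  then show ?thesis by simp
qed simp

lemma Qadj_divide: "algebraic \<theta> \<Longrightarrow> x \<in> Qadj \<theta> \<Longrightarrow> y \<in> Qadj \<theta> \<Longrightarrow> x / y \<in> Qadj \<theta>"
  by (simp add: divide_inverse Qadj_mult Qadj_inverse)

definition Qadj_poly :: "complex \<Rightarrow> complex poly set" where
  "Qadj_poly \<theta> = {p. \<forall>i. coeff p i \<in> Qadj \<theta>}"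

lemma Qadj_poly_add: "p \<in> Qadj_poly \<theta> \<Longrightarrow> q \<in> Qadj_poly \<theta> \<Longrightarrow> p + q \<in> Qadj_poly \<theta>"
  by (simp add: Qadj_poly_def Qadj_add)

lemma Qadj_poly_diff: "p \<in> Qadj_poly \<theta> \<Longrightarrow> q \<in> Qadj_poly \<theta> \<Longrightarrow> p - q \<in> Qadj_poly \<theta>"
  by (simp add: Qadj_poly_def Qadj_diff)

lemma Qadj_poly_mult: "p \<in> Qadj_poly \<theta> \<Longrightarrow> q \<in> Qadj_poly \<theta> \<Longrightarrow> p * q \<in> Qadj_poly \<theta>"
  by (simp add: Qadj_poly_def coeff_mult Qadj_sum Qadj_mult)

lemma Qadj_poly_pCons: "c \<in> Qadj \<theta> \<Longrightarrow> p \<in> Qadj_poly \<theta> \<Longrightarrow> pCons c p \<in> Qadj_poly \<theta>"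
  by (simp add: Qadj_poly_def coeff_pCons split: nat.split)

lemma Qadj_poly_0: "0 \<in> Qadj_poly \<theta>"
  by (simp add: Qadj_poly_def)

lemma Qadj_poly_monom: "c \<in> Qadj \<theta> \<Longrightarrow> monom c n \<in> Qadj_poly \<theta>"
  by (simp add: Qadj_poly_def)

lemma Qadj_poly_of_rat: "map_poly of_rat q \<in> Qadj_poly \<theta>"
  by (simp add: Qadj_poly_def Qadj_of_rat)

lemma Qadj_poly_pcompose:
  assumes "r \<in> Qadj_poly \<theta>" "p \<in> Qadj_poly \<theta>"
  shows "pcompose p r \<in> Qadj_poly \<theta>"
  using assms(2)
proof (induction p)
  case (pCons c p)
  have "coeff (pCons c p) 0 \<in> Qadj \<theta>" "\<And>i. coeff (pCons c p) (Suc i) \<in> Qadj \<theta>"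
    using pCons.prems by (auto simp only: Qadj_poly_def)
  then have "c \<in> Qadj \<theta>" "p \<in> Qadj_poly \<theta>" by (simp_all add: Qadj_poly_def)
  then show ?case
    using pCons.IH assms(1) by (simp add: pcompose_pCons Qadj_poly_add Qadj_poly_pCons Qadj_poly_0 Qadj_poly_mult)
qed simp

text \<open>Remainders are taken in C[X], but each step of long division only divides by the leading
  coefficient of u, so the coefficients stay in the field Q(\<theta>).\<close>

lemma Qadj_poly_mod:
  assumes alg: "algebraic \<theta>" and u: "u \<in> Qadj_poly \<theta>" "u \<noteq> 0"
  shows "p \<in> Qadj_poly \<theta> \<Longrightarrow> p mod u \<in> Qadj_poly \<theta>"
proof (induction "degree p" arbitrary: p rule: less_induct)
  case less
  show ?case
  proof (cases "degree u = 0")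
    case True
    then have "is_unit u" using u(2) by (simp add: is_unit_iff_degree)
    then have "p mod u = 0" by (meson dvd_imp_mod_0 unit_imp_dvd)
    then show ?thesis by (simp add: Qadj_poly_0)
  next
    case u0: False
    show ?thesis
    proof (cases "degree p < degree u")
      case True
      then show ?thesis using less.prems by (simp add: mod_poly_less)
    next
      case False
      define w where "w = monom (lead_coeff p / lead_coeff u) (degree p - degree u)"
      have p0: "p \<noteq> 0" using False u0 by auto
      have lcu: "lead_coeff u \<noteq> 0" using u(2) by simp
      have w0: "lead_coeff p / lead_coeff u \<noteq> 0" using p0 u(2) by simp
      have w: "degree w = degree p - degree u" "lead_coeff w = lead_coeff p / lead_coeff u"
        unfolding w_def using w0 by (simp_all add: degree_monom_eq)
      have "w \<noteq> 0" using w0 by (simp add: w_def)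
      have deg: "degree (w * u) = degree p"
        using \<open>w \<noteq> 0\<close> u(2) False by (simp add: degree_mult_eq w)
      have "coeff (w * u) (degree p) = lead_coeff p"
        using lead_coeff_mult[of w u] w(2) lcu unfolding deg by simp
      then have "p - w * u = 0 \<or> degree (p - w * u) < degree p"
        by (intro eq_zero_or_degree_less) (simp_all add: degree_diff_le deg)
      moreover have "degree p > 0" using u0 False by simp
      ultimately have lt: "degree (p - w * u) < degree p" by auto
      have "lead_coeff p \<in> Qadj \<theta>" "lead_coeff u \<in> Qadj \<theta>" using less.prems u(1) by (auto simp: Qadj_poly_def)
      then have "w \<in> Qadj_poly \<theta>" unfolding w_def by (intro Qadj_poly_monom Qadj_divide alg)
      then have "p - w * u \<in> Qadj_poly \<theta>" by (intro Qadj_poly_diff Qadj_poly_mult u less.prems)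
      moreover have "(p - w * u) mod u = p mod u" using mod_mult_self1[of "p - w * u" w u] by simp
      ultimately show ?thesis using less.hyps[OF lt] by simp
    qed
  qed
qed

text \<open>For all but finitely many c, b is the only common root of F and G(\<gamma> - c X). As b
  is a simple root of F, their common divisor over Q(\<gamma>) is linear and its coefficients
  exhibit b in Q(\<gamma>).\<close>

lemma primitive_element_two:
  fixes a b :: complex
  assumes a: "algebraic a" and f: "f \<noteq> 0" "rpoly f b = 0" "rpoly (pderiv f) b \<noteq> 0"
    and alg: "\<And>c :: int. algebraic (a + of_int c * b)"
  obtains c :: int where "a \<in> Qadj (a + of_int c * b)" "b \<in> Qadj (a + of_int c * b)"
proof -
  obtain g where g: "g \<noteq> 0" "rpoly g a = 0" using a by (auto simp: rpoly_zero_iff_algebraic)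
  define F where "F = (map_poly of_rat f :: complex poly)"
  define G where "G = (map_poly of_rat g :: complex poly)"
  have FG: "F \<noteq> 0" "G \<noteq> 0" "poly F b = 0" "poly G a = 0" "poly (pderiv F) b \<noteq> 0"
    using f g by (simp_all add: F_def G_def rpoly_def of_rat_hom.map_poly_pderiv)
  \<comment> \<open>The values of c with \<gamma> = a' + c r for a root a' of G and a root r
    \<noteq> b of F. Pairs with r = b only add the value 0, from division by zero.\<close>
  define bad where "bad = (\<lambda>(a', r). (a' - a) / (b - r)) ` ({a'. poly G a' = 0} \<times> {r. poly F r = 0})"
  have "finite bad" unfolding bad_def using FG by (intro finite_imageI finite_cartesian_product) (auto intro: poly_roots_finite)
  moreover have "infinite (range (of_int :: int \<Rightarrow> complex))"
    using finite_imageD[of "of_int :: int \<Rightarrow> complex" UNIV] infinite_UNIV_int by (auto simp: inj_on_def)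
  ultimately obtain c :: int where c: "of_int c \<notin> bad"
    by (metis (mono_tags) finite_subset image_subsetI rangeI subsetI rangeE)
  define \<gamma> where "\<gamma> = a + of_int c * b"
  have alg\<gamma>: "algebraic \<gamma>" using alg by (simp add: \<gamma>_def)
  define I where "I = {u. u \<in> Qadj_poly \<gamma> \<and> poly u b = 0}"
  have "F \<in> I" using FG by (simp add: I_def F_def Qadj_poly_of_rat)
  define G' where "G' = pcompose G [:\<gamma>, - of_int c:]"
  have "G' \<in> I"
  proof -
    have "[:\<gamma>, - of_int c:] \<in> Qadj_poly \<gamma>"
      by (intro Qadj_poly_pCons Qadj_poly_0 Qadj_self Qadj_uminus) simp
    then have "G' \<in> Qadj_poly \<gamma>" unfolding G'_def G_def by (intro Qadj_poly_pcompose Qadj_poly_of_rat)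
    moreover have "poly G' b = 0" using FG by (simp add: G'_def poly_pcompose \<gamma>_def algebra_simps)
    ultimately show ?thesis by (simp add: I_def)
  qed
  \<comment> \<open>\<mu> has least degree among the nonzero polynomials over Q(\<gamma>) that
    vanish at b, so it divides both F and G'.\<close>
  obtain \<mu> where \<mu>: "\<mu> \<in> I" "\<mu> \<noteq> 0" and least: "\<And>u. u \<in> I \<Longrightarrow> u \<noteq> 0 \<Longrightarrow> degree \<mu> \<le> degree u"
    using ex_has_least_nat[of "\<lambda>u. u \<in> I \<and> u \<noteq> 0" F degree] \<open>F \<in> I\<close> FG(1) by blast
  have dvd: "\<mu> dvd u" if "u \<in> I" for u
  proof -
    have "u mod \<mu> \<in> Qadj_poly \<gamma>" using \<mu> that alg\<gamma> by (intro Qadj_poly_mod) (auto simp: I_def)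
    moreover have "poly (u mod \<mu>) b = 0"
    proof -
      have "poly (\<mu> * (u div \<mu>) + u mod \<mu>) b = 0" using that by (simp add: I_def)
      then show ?thesis using \<mu>(1) by (simp only: poly_add poly_mult) (simp add: I_def)
    qed
    ultimately have "u mod \<mu> \<in> I" by (simp add: I_def)
    then have "u mod \<mu> = 0"
      using least[of "u mod \<mu>"] degree_mod_less[OF \<mu>(2), of u] by fastforce
    then show ?thesis by (simp add: dvd_eq_mod_eq_0)
  qed
  have roots: "r = b" if r: "poly \<mu> r = 0" for r
  proof (rule ccontr)
    assume "r \<noteq> b"
    have "poly F r = 0" "poly G' r = 0"
      using dvd[OF \<open>F \<in> I\<close>] dvd[OF \<open>G' \<in> I\<close>] r by (auto elim!: dvdE)
    then have "poly G (\<gamma> - of_int c * r) = 0" by (simp add: G'_def poly_pcompose algebra_simps)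
    moreover have "of_int c = ((\<gamma> - of_int c * r) - a) / (b - r)"
      using \<open>r \<noteq> b\<close> by (simp add: \<gamma>_def field_simps)
    ultimately have "of_int c \<in> bad"
      unfolding bad_def using \<open>poly F r = 0\<close> by (intro image_eqI[of _ _ "(\<gamma> - of_int c * r, r)"]) simp_all
    then show False using c by simp
  qed
  have "poly \<mu> b = 0" using \<mu> by (simp add: I_def)
  then obtain \<nu> where \<nu>: "\<mu> = [:-b, 1:] * \<nu>" by (metis poly_eq_0_iff_dvd dvdE)
  \<comment> \<open>Every complex root of \<mu> is b, so a nonconstant cofactor \<nu> would vanish
    at b again and make b a double root of F.\<close>
  have "degree \<nu> = 0"
  proof (rule ccontr)
    assume "degree \<nu> \<noteq> 0"
    then have "\<not> constant (poly \<nu>)" by (simp add: constant_degree)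
    then obtain r where "poly \<nu> r = 0" using fundamental_theorem_of_algebra by blast
    moreover then have "r = b" using roots \<nu> by simp
    ultimately obtain \<kappa> where \<kappa>: "\<nu> = [:-b, 1:] * \<kappa>" by (metis poly_eq_0_iff_dvd dvdE)
    obtain k where k: "F = \<mu> * k" using dvd[OF \<open>F \<in> I\<close>] by (auto elim: dvdE)
    have "poly (pderiv F) b = 0"
    proof -
      define w where "w = [:-b, 1:]"
      have "poly w b = 0" by (simp add: w_def)
      moreover have "F = w * (w * (\<kappa> * k))" unfolding k \<nu> \<kappa> w_def by (simp only: mult.assoc)
      ultimately show ?thesis by (simp add: pderiv_mult)
    qed
    then show False using FG by simp
  qed
  then obtain k where k: "\<nu> = [:k:]" by (auto elim: degree_eq_zeroE)
  have "\<mu> = [:- (b * k), k:]" by (simp add: \<nu> k)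
  moreover have "coeff \<mu> 0 \<in> Qadj \<gamma>" "coeff \<mu> 1 \<in> Qadj \<gamma>" using \<mu>(1) by (simp_all add: I_def Qadj_poly_def)
  ultimately have "- (b * k) \<in> Qadj \<gamma>" "k \<in> Qadj \<gamma>" by simp_all
  moreover have "k \<noteq> 0" using \<mu>(2) \<nu> k by auto
  then have "b = - (- (b * k) / k)" by simp
  ultimately have b: "b \<in> Qadj \<gamma>" using Qadj_uminus Qadj_divide alg\<gamma> by metis
  have "a = \<gamma> - of_int c * b" by (simp add: \<gamma>_def)
  then have "a \<in> Qadj \<gamma>" using b by (metis Qadj_diff Qadj_mult Qadj_self Qadj_simps(3))
  then show thesis using b that[of c] by (simp add: \<gamma>_def)
qed

lemma primitive_element:
  fixes z :: "nat \<Rightarrow> complex"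
  assumes f: "f \<noteq> 0" and z: "\<And>i. i \<in> {1..n} \<Longrightarrow> rpoly f (z i) = 0 \<and> rpoly (pderiv f) (z i) \<noteq> 0"
    and alg: "\<And>c :: nat \<Rightarrow> int. \<And>k. k \<le> n \<Longrightarrow> algebraic (\<Sum>i=1..k. of_int (c i) * z i)"
  shows "\<exists>c :: nat \<Rightarrow> int. \<forall>i\<in>{1..n}. z i \<in> Qadj (\<Sum>i=1..n. of_int (c i) * z i)"
proof -
  have "k \<le> n \<Longrightarrow> \<exists>c :: nat \<Rightarrow> int. \<forall>i\<in>{1..k}. z i \<in> Qadj (\<Sum>i=1..k. of_int (c i) * z i)" for k
  proof (induction k)
    case (Suc k)
    have "k \<le> n" using Suc.prems by simp
    then obtain c :: "nat \<Rightarrow> int" where c: "\<And>i. i \<in> {1..k} \<Longrightarrow> z i \<in> Qadj (\<Sum>i=1..k. of_int (c i) * z i)"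
      using Suc.IH by blast
    define \<theta> where "\<theta> = (\<Sum>i=1..k. of_int (c i) * z i)"
    have upd: "(\<Sum>i=1..Suc k. of_int ((c(Suc k := d)) i) * z i) = \<theta> + of_int d * z (Suc k)" for d
      unfolding \<theta>_def by (simp add: sum.cl_ivl_Suc cong: sum.cong) (intro sum.cong; simp)
    have a1: "algebraic \<theta>" using alg[of k c] Suc.prems by (simp add: \<theta>_def)
    have a2: "algebraic (\<theta> + of_int d * z (Suc k))" for d
      unfolding upd [symmetric] using alg Suc.prems by blast
    obtain d where d: "\<theta> \<in> Qadj (\<theta> + of_int d * z (Suc k))" "z (Suc k) \<in> Qadj (\<theta> + of_int d * z (Suc k))"
      using primitive_element_two[OF a1 f _ _ a2] z[of "Suc k"] Suc.prems by auto
    have "z i \<in> Qadj (\<theta> + of_int d * z (Suc k))" if "i \<in> {1..Suc k}" for i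
    proof (cases "i = Suc k")
      case False
      then have "z i \<in> Qadj \<theta>" using c[of i] that by (simp add: \<theta>_def)
      then show ?thesis using Qadj_subset[OF d(1)] by blast
    qed (simp add: d)
    then show ?case unfolding upd [symmetric] by blast
  qed simp
  then show ?thesis by blast
qed

section \<open>Congruences and Frobenius modulo a prime ideal\<close>

context prime_over
begin

lemma A_0: "0 \<in> A" using A_add[OF A_1 A_uminus[OF A_1]] by simp

lemma A_diff: "a \<in> A \<Longrightarrow> b \<in> A \<Longrightarrow> a - b \<in> A"
  using A_add[of a "- b"] A_uminus by simp

lemma A_power: "a \<in> A \<Longrightarrow> a ^ k \<in> A"
  by (induction k) (simp_all add: A_1 A_mult)

lemma A_sum: "(\<And>i. i \<in> I \<Longrightarrow> f i \<in> A) \<Longrightarrow> sum f I \<in> A"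
  by (induction I rule: infinite_finite_induct) (simp_all add: A_0 A_add)

lemma A_prod: "(\<And>i. i \<in> I \<Longrightarrow> f i \<in> A) \<Longrightarrow> prod f I \<in> A"
  by (induction I rule: infinite_finite_induct) (simp_all add: A_1 A_mult)

lemma A_of_nat: "of_nat k \<in> A"
  by (induction k) (simp_all add: A_0 A_1 A_add)

lemma A_of_int: "of_int k \<in> A"
  by (cases k) (simp_all add: A_of_nat A_uminus A_diff A_1 A_0 flip: of_nat_Suc del: of_nat_Suc)

lemma M_0: "0 \<in> M" using M_mult[OF A_0 M_p] by simp

lemma M_uminus: "a \<in> M \<Longrightarrow> - a \<in> M"
  using M_mult[OF A_uminus[OF A_1], of a] by simp

lemma M_diff: "a \<in> M \<Longrightarrow> b \<in> M \<Longrightarrow> a - b \<in> M"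
  using M_add[of a "- b"] M_uminus by simp

lemma M_sum: "(\<And>i. i \<in> I \<Longrightarrow> f i \<in> M) \<Longrightarrow> sum f I \<in> M"
  by (induction I rule: infinite_finite_induct) (simp_all add: M_0 M_add)

lemma M_prod_prime:
  "finite I \<Longrightarrow> (\<And>i. i \<in> I \<Longrightarrow> f i \<in> A) \<Longrightarrow> prod f I \<in> M \<Longrightarrow> \<exists>i\<in>I. f i \<in> M"
proof (induction I rule: finite_induct)
  case empty
  then show ?case using M_1 by simp
next
  case (insert i I)
  then show ?case using M_prime[of "f i" "prod f I"] A_prod[of I f] by auto
qed

definition cg :: "'a \<Rightarrow> 'a \<Rightarrow> bool" where "cg a b \<longleftrightarrow> a - b \<in> M"

lemma cg_refl [simp]: "cg a a" by (simp add: cg_def M_0)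

lemma cg_sym: "cg a b \<Longrightarrow> cg b a"
  unfolding cg_def using M_uminus by force

lemma cg_trans [trans]: "cg a b \<Longrightarrow> cg b c \<Longrightarrow> cg a c"
  unfolding cg_def using M_add by force

lemma cg_add: "cg a b \<Longrightarrow> cg c d \<Longrightarrow> cg (a + c) (b + d)"
  unfolding cg_def using M_add[of "a - b" "c - d"] by (simp add: algebra_simps)

lemma cg_mult: "a \<in> A \<Longrightarrow> d \<in> A \<Longrightarrow> cg a b \<Longrightarrow> cg c d \<Longrightarrow> cg (a * c) (b * d)"
  unfolding cg_def using M_add[OF M_mult[of a "c - d"] M_mult[of d "a - b"]] by (simp add: algebra_simps)

lemma cg_power: "a \<in> A \<Longrightarrow> b \<in> A \<Longrightarrow> cg a b \<Longrightarrow> cg (a ^ k) (b ^ k)"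
  by (induction k) (simp_all add: cg_mult A_power)

lemma cg_sum: "(\<And>i. i \<in> I \<Longrightarrow> cg (f i) (g i)) \<Longrightarrow> cg (sum f I) (sum g I)"
  by (induction I rule: infinite_finite_induct) (simp_all add: cg_add)

lemma cg_of_int_0: "int p dvd k \<Longrightarrow> of_int k \<in> M"
  using M_mult[OF A_of_int M_p] by (auto elim!: dvdE simp: mult.commute)

lemma cg_of_int: "k mod int p = l mod int p \<Longrightarrow> cg (of_int k) (of_int l)"
  unfolding cg_def using cg_of_int_0[of "k - l"] by (simp add: mod_eq_dvd_iff)

lemma M_p_mult: "a \<in> A \<Longrightarrow> of_nat p * a \<in> M"
  using M_mult[OF _ M_p, of a] by (simp add: mult.commute)

lemma p_pos: "p > 0" using prime_p by (simp add: prime_gt_0_nat)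

lemma cg_frobenius_add:
  assumes "a \<in> A" "b \<in> A"
  shows "cg ((a + b) ^ p) (a ^ p + b ^ p)"
proof -
  have "(a + b) ^ p = (\<Sum>k\<le>p. of_nat (p choose k) * a ^ k * b ^ (p - k))"
    by (rule binomial_ring)
  also have "{..p} = insert 0 (insert p {0<..<p})" using p_pos by auto
  also have "(\<Sum>k\<in>insert 0 (insert p {0<..<p}). of_nat (p choose k) * a ^ k * b ^ (p - k)) =
      b ^ p + (a ^ p + (\<Sum>k\<in>{0<..<p}. of_nat (p choose k) * a ^ k * b ^ (p - k)))"
    using p_pos by simp
  finally have eq: "(a + b) ^ p - (a ^ p + b ^ p) = (\<Sum>k\<in>{0<..<p}. of_nat (p choose k) * a ^ k * b ^ (p - k))"
    by simp
  have mem: "of_nat (p choose k) * a ^ k * b ^ (p - k) \<in> M" if "k \<in> {0<..<p}" for k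
  proof -
    have "p dvd (p choose k)" using that prime_p by (intro dvd_choose_prime) auto
    then have "of_nat (p choose k) \<in> M" using cg_of_int_0[of "int (p choose k)"] by simp
    moreover have "a ^ k * b ^ (p - k) \<in> A" using assms by (simp add: A_mult A_power)
    ultimately have "(a ^ k * b ^ (p - k)) * of_nat (p choose k) \<in> M" by (rule M_mult[rotated])
    then show ?thesis by (simp only: mult_ac)
  qed
  show ?thesis unfolding cg_def eq by (rule M_sum) (rule mem)
qed

lemma cg_frobenius_sum:
  "(\<And>i. i \<in> I \<Longrightarrow> f i \<in> A) \<Longrightarrow> cg (sum f I ^ p) (\<Sum>i\<in>I. f i ^ p)"
proof (induction I rule: infinite_finite_induct)
  case (insert i I)
  then have "cg ((f i + sum f I) ^ p) (f i ^ p + sum f I ^ p)"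
    by (intro cg_frobenius_add A_sum) auto
  also have "cg (f i ^ p + sum f I ^ p) (f i ^ p + (\<Sum>i\<in>I. f i ^ p))"
    using insert by (intro cg_add) simp_all
  finally show ?case using insert by simp
qed (simp_all add: zero_power p_pos)

lemma cg_fermat: "cg (of_int k ^ p) (of_int k)"
proof -
  have nat: "cg (of_nat j ^ p) (of_nat j)" for j
  proof (induction j)
    case (Suc j)
    have "cg ((of_nat j + 1) ^ p) (of_nat j ^ p + 1 ^ p)"
      by (intro cg_frobenius_add A_of_nat A_1)
    also have "cg (of_nat j ^ p + 1 ^ p) (of_nat j + 1)"
      using Suc by (intro cg_add) simp_all
    finally show ?case by (simp add: add.commute)
  qed (simp add: zero_power p_pos)
  define j where "j = nat (k mod int p)"
  have "k mod int p = int j mod int p" using p_pos by (simp add: j_def)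
  then have kj: "cg (of_int k) (of_nat j)" using cg_of_int[of k "int j"] by simp
  have "cg (of_int k ^ p) (of_nat j ^ p)" by (intro cg_power A_of_int A_of_nat kj)
  also note nat
  also have "cg (of_nat j) (of_int k)" using kj by (rule cg_sym)
  finally show ?thesis .
qed

text \<open>Gauss's lemma: if neither factor has all its coefficients in M, the lowest coefficients
  outside M multiply to a coefficient of the product that is outside M, up to an element of
  M.\<close>

lemma prime_over_poly: "prime_over {q. \<forall>k. coeff q k \<in> A} {q. \<forall>k. coeff q k \<in> M} p"
proof (rule prime_over.intro)
  fix a b :: "'a poly"
  assume a: "a \<in> {q. \<forall>k. coeff q k \<in> A}" and b: "b \<in> {q. \<forall>k. coeff q k \<in> A}"
  show "a * b \<in> {q. \<forall>k. coeff q k \<in> A}"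
    using a b by (auto simp: coeff_mult intro!: A_sum A_mult)
  assume ab: "a * b \<in> {q. \<forall>k. coeff q k \<in> M}"
  show "a \<in> {q. \<forall>k. coeff q k \<in> M} \<or> b \<in> {q. \<forall>k. coeff q k \<in> M}"
  proof (rule ccontr)
    assume "\<not> ?thesis"
    then obtain i' j' where ij': "coeff a i' \<notin> M" "coeff b j' \<notin> M" by auto
    define i where "i = (LEAST i. coeff a i \<notin> M)"
    define j where "j = (LEAST j. coeff b j \<notin> M)"
    have i: "coeff a i \<notin> M" "\<And>k. k < i \<Longrightarrow> coeff a k \<in> M"
      unfolding i_def using LeastI[of "\<lambda>i. coeff a i \<notin> M", OF ij'(1)] not_less_Least by blast+
    have j: "coeff b j \<notin> M" "\<And>k. k < j \<Longrightarrow> coeff b k \<in> M"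
      unfolding j_def using LeastI[of "\<lambda>j. coeff b j \<notin> M", OF ij'(2)] not_less_Least by blast+
    have other: "coeff a k * coeff b (i + j - k) \<in> M" if "k \<in> {..i + j} - {i}" for k
    proof (cases "k < i")
      case True
      then show ?thesis using M_mult[of "coeff b (i + j - k)" "coeff a k"] i b by (simp add: mult.commute)
    next
      case False
      then have "i + j - k < j" using that by auto
      then show ?thesis using M_mult[of "coeff a k"] j a by simp
    qed
    have "coeff (a * b) (i + j) = coeff a i * coeff b j + (\<Sum>k\<in>{..i + j} - {i}. coeff a k * coeff b (i + j - k))"
      unfolding coeff_mult by (subst sum.remove[of _ i]) auto
    then have "coeff a i * coeff b j = coeff (a * b) (i + j) - (\<Sum>k\<in>{..i + j} - {i}. coeff a k * coeff b (i + j - k))"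
      by simp
    also have "\<dots> \<in> M" using ab other by (intro M_diff M_sum) auto
    finally show False using M_prime[of "coeff a i" "coeff b j"] i j a b by auto
  qed
next
  fix a b :: "'a poly"
  assume "a \<in> {q. \<forall>k. coeff q k \<in> A}" "b \<in> {q. \<forall>k. coeff q k \<in> M}"
  then show "a * b \<in> {q. \<forall>k. coeff q k \<in> M}"
    by (auto simp: coeff_mult intro!: M_sum M_mult)
next
  have "coeff 1 0 \<notin> M" using M_1 by simp
  then show "1 \<notin> {q. \<forall>k. coeff q k \<in> M}" by blast
  have c1: "coeff 1 k \<in> A" for k using A_1 A_0 by (cases k) simp_all
  then show "1 \<in> {q. \<forall>k. coeff q k \<in> A}" by blast
  have "coeff [:of_nat p:] k \<in> M" for k using M_0 M_p by (cases k) simp_all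
  then show "of_nat p \<in> {q. \<forall>k. coeff q k \<in> M}" unfolding of_nat_poly by blast
  show "{q. \<forall>k. coeff q k \<in> M} \<subseteq> {q. \<forall>k. coeff q k \<in> A}" using M_A by blast
qed (simp_all add: A_add M_add A_uminus prime_p)

end

text \<open>The substitution of U^p for U, which is what raising to the power p does modulo p to a
  polynomial in U with integer coefficients.\<close>

definition dilate :: "nat \<Rightarrow> 'a :: comm_ring_1 poly \<Rightarrow> 'a poly" where
  "dilate p q = pcompose q (monom 1 p)"

lemma dilate_monom: "dilate p (monom c k) = monom c (p * k)"
proof (induction k)
  case 0
  then show ?case by (simp add: dilate_def monom_0)
next
  case (Suc k)
  then show ?case by (simp add: dilate_def monom_Suc pcompose_pCons mult_monom)
qed

lemma comm_ring_hom_dilate: "comm_ring_hom (dilate p)"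
  by unfold_locales (simp_all add: dilate_def pcompose_add pcompose_mult pcompose_1)

interpretation dilate: comm_ring_hom "dilate p" for p by (rule comm_ring_hom_dilate)

lemma dilate_altdef: "dilate p q = (\<Sum>k\<le>degree q. monom (coeff q k) (p * k))"
proof -
  have "dilate p q = dilate p (\<Sum>k\<le>degree q. monom (coeff q k) k)"
    by (simp add: poly_as_sum_of_monoms)
  then show ?thesis by (simp add: dilate.hom_sum dilate_monom)
qed

lemma coeff_dilate: "p > 0 \<Longrightarrow> coeff (dilate p q) (p * i) = coeff q i"
  by (simp add: dilate_altdef coeff_sum coeff_monom coeff_eq_0)

section \<open>Conjugates and Dedekind's theorem\<close>

text \<open>The splitting field of f, presented as Q(\<theta>) inside C with \<theta> an integer
  combination of the roots.\<close>

locale galois_roots =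
  fixes n :: nat and z :: "nat \<Rightarrow> complex" and f :: "int poly" and c :: "nat \<Rightarrow> int"
    and \<theta> :: complex and m :: "rat poly"
  assumes f_monic: "lead_coeff f = 1"
    and f_prod: "of_int_poly f = (\<Prod>i=1..n. [:- z i, 1:])"
    and inj_z: "inj_on z {1..n}"
    and theta: "\<theta> = (\<Sum>i=1..n. of_int (c i) * z i)"
    and z_Qadj: "\<And>i. i \<in> {1..n} \<Longrightarrow> z i \<in> Qadj \<theta>"
    and min: "is_min_poly \<theta> m"
begin

definition conjugates :: "complex set" where "conjugates = {t. rpoly m t = 0}"

text \<open>The embedding of Q(\<theta>) into C that sends \<theta> to t. The chosen q does not
  matter, since two choices differ by a multiple of m and m vanishes at t.\<close>

definition conj :: "complex \<Rightarrow> complex \<Rightarrow> complex" where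
  "conj t x = rpoly (SOME q. rpoly q \<theta> = x) t"

lemma m_nonzero: "m \<noteq> 0" and m_dvd: "rpoly q \<theta> = 0 \<longleftrightarrow> m dvd q"
  using min by (auto simp: is_min_poly_def)

lemma theta_conjugate: "\<theta> \<in> conjugates"
  by (simp add: conjugates_def m_dvd)

lemma conj_rpoly:
  assumes "t \<in> conjugates"
  shows "conj t (rpoly q \<theta>) = rpoly q t"
proof -
  define q' where "q' = (SOME q'. rpoly q' \<theta> = rpoly q \<theta>)"
  have "rpoly q' \<theta> = rpoly q \<theta>" unfolding q'_def by (rule someI) simp
  then have "m dvd q' - q" by (simp add: rpoly.hom_minus flip: m_dvd)
  then have "rpoly (q' - q) t = 0" using assms by (auto simp: conjugates_def rpoly.hom_mult elim!: dvdE)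
  then show ?thesis by (simp add: conj_def q'_def rpoly.hom_minus)
qed

lemma conj_add: "t \<in> conjugates \<Longrightarrow> x \<in> Qadj \<theta> \<Longrightarrow> y \<in> Qadj \<theta> \<Longrightarrow> conj t (x + y) = conj t x + conj t y"
  by (elim QadjE) (simp add: conj_rpoly flip: rpoly.hom_add)

lemma conj_mult: "t \<in> conjugates \<Longrightarrow> x \<in> Qadj \<theta> \<Longrightarrow> y \<in> Qadj \<theta> \<Longrightarrow> conj t (x * y) = conj t x * conj t y"
  by (elim QadjE) (simp add: conj_rpoly flip: rpoly.hom_mult)

lemma conj_of_rat: "t \<in> conjugates \<Longrightarrow> conj t (of_rat r) = of_rat r"
  using conj_rpoly[of t "[:r:]"] by simp

lemma conj_0: "t \<in> conjugates \<Longrightarrow> conj t 0 = 0" and conj_1: "t \<in> conjugates \<Longrightarrow> conj t 1 = 1"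
  using conj_of_rat[of t 0] conj_of_rat[of t 1] by simp_all

lemma conj_theta: "t \<in> conjugates \<Longrightarrow> conj t \<theta> = t"
  using conj_rpoly[of t "[:0, 1:]"] by simp

lemma conj_theta_id: "x \<in> Qadj \<theta> \<Longrightarrow> conj \<theta> x = x"
  by (elim QadjE) (simp add: conj_rpoly theta_conjugate)

lemma conj_compose_rpoly: "t \<in> conjugates \<Longrightarrow> x \<in> Qadj \<theta> \<Longrightarrow> conj t (rpoly g x) = rpoly g (conj t x)"
  by (elim QadjE) (simp add: conj_rpoly flip: rpoly_pcompose)

lemma conj_eq_0: "t \<in> conjugates \<Longrightarrow> x \<in> Qadj \<theta> \<Longrightarrow> conj t x = 0 \<Longrightarrow> x = 0"
proof (elim QadjE, rule ccontr)
  fix q assume t: "t \<in> conjugates" and x: "x = rpoly q \<theta>" "conj t x = 0" "x \<noteq> 0"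
  obtain u v where uv: "u * m + v * q = 1" using min_poly_bezout[OF min] x by metis
  have "rpoly m t = 0" "rpoly q t = 0" using t x by (simp_all add: conj_rpoly) (simp add: conjugates_def)
  then show False using arg_cong[OF uv, of "\<lambda>q. rpoly q t"] by (simp add: rpoly.hom_add rpoly.hom_mult)
qed

lemma conj_uminus: "t \<in> conjugates \<Longrightarrow> x \<in> Qadj \<theta> \<Longrightarrow> conj t (- x) = - conj t x"
  by (elim QadjE) (simp add: conj_rpoly flip: rpoly.hom_uminus)

lemma conj_inj: "t \<in> conjugates \<Longrightarrow> inj_on (conj t) (Qadj \<theta>)"
proof (rule inj_onI)
  fix x y assume t: "t \<in> conjugates" and xy: "x \<in> Qadj \<theta>" "y \<in> Qadj \<theta>" "conj t x = conj t y"
  have "conj t (x + - y) = 0" using xy t by (simp only: conj_add conj_uminus Qadj_uminus) simp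
  then have "x + - y = 0" by (rule conj_eq_0[OF t Qadj_add[OF xy(1) Qadj_uminus[OF xy(2)]]])
  then show "x = y" by simp
qed

lemma conj_sum: "t \<in> conjugates \<Longrightarrow> (\<And>i. i \<in> I \<Longrightarrow> g i \<in> Qadj \<theta>) \<Longrightarrow> conj t (sum g I) = (\<Sum>i\<in>I. conj t (g i))"
  by (induction I rule: infinite_finite_induct) (simp_all add: conj_0 conj_add Qadj_sum)

lemma algebraic_theta: "algebraic \<theta>"
  unfolding rpoly_zero_iff_algebraic by (intro exI[of _ m]) (simp add: m_nonzero m_dvd)

lemma f_root_iff: "poly (of_int_poly f) x = 0 \<longleftrightarrow> x \<in> z ` {1..n}"
  by (auto simp: f_prod poly_prod)

lemma conj_root:
  assumes t: "t \<in> conjugates" and i: "i \<in> {1..n}"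
  shows "conj t (z i) \<in> z ` {1..n}"
proof -
  have r: "rpoly (of_int_poly f) x = poly (of_int_poly f) x" for x
    by (simp add: rpoly_def map_poly_map_poly o_def)
  have "rpoly (of_int_poly f) (conj t (z i)) = conj t (rpoly (of_int_poly f) (z i))"
    using conj_compose_rpoly[OF t z_Qadj[OF i]] by simp
  also have "rpoly (of_int_poly f) (z i) = 0" unfolding r using f_root_iff i by blast
  finally show ?thesis using t by (simp add: conj_0 r f_root_iff)
qed

text \<open>Normality: an embedding permutes the roots z i, so the image t of \<theta> is again an
  integer combination of them.\<close>

lemma conjugate_in_Qadj: "t \<in> conjugates \<Longrightarrow> t \<in> Qadj \<theta>"
proof -
  assume t: "t \<in> conjugates"
  have "t = conj t (\<Sum>i=1..n. of_int (c i) * z i)" using conj_theta[OF t] theta by simp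
  also have "\<dots> = (\<Sum>i=1..n. of_int (c i) * conj t (z i))"
    using t by (subst conj_sum) (auto simp: conj_mult Qadj_mult z_Qadj conj_of_rat[of t "of_int _", simplified] intro!: sum.cong)
  also have "\<dots> \<in> Qadj \<theta>"
    using conj_root[OF t] z_Qadj by (intro Qadj_sum Qadj_mult) (simp, fastforce)
  finally show ?thesis .
qed

lemma conj_conjugate: "s \<in> conjugates \<Longrightarrow> t \<in> conjugates \<Longrightarrow> conj s t \<in> conjugates"
  using conj_compose_rpoly[of s t m] conjugate_in_Qadj[of t] conj_0[of s] by (simp add: conjugates_def)

text \<open>The conjugates of \<theta> thus label the elements of the Galois group, with product
  \<open>conj s t\<close>.\<close>

lemma conj_conj: "s \<in> conjugates \<Longrightarrow> t \<in> conjugates \<Longrightarrow> x \<in> Qadj \<theta> \<Longrightarrow> conj s (conj t x) = conj (conj s t) x"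
  by (elim QadjE) (simp add: conj_rpoly conj_compose_rpoly conjugate_in_Qadj conj_conjugate)

lemma finite_conjugates: "finite conjugates"
  unfolding conjugates_def rpoly_def by (rule poly_roots_finite) (simp add: m_nonzero)

lemma bij_conj: "s \<in> conjugates \<Longrightarrow> bij_betw (conj s) conjugates conjugates"
  unfolding bij_betw_def
proof (rule conjI)
  assume s: "s \<in> conjugates"
  show inj: "inj_on (conj s) conjugates"
    using conj_inj[OF s] conjugate_in_Qadj by (meson inj_on_subset subsetI)
  show "conj s ` conjugates = conjugates"
    by (rule endo_inj_surj[OF finite_conjugates _ inj]) (use conj_conjugate[OF s] in blast)
qed

lemma degree_m_pos: "degree m > 0"
proof (rule ccontr)
  assume "\<not> ?thesis"
  then obtain k where "m = [:k:]" by (auto elim: degree_eq_zeroE)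
  moreover have "rpoly m \<theta> = 0" by (simp add: m_dvd)
  ultimately show False using m_nonzero by simp
qed

lemma card_conjugates: "card conjugates = degree m"
proof -
  let ?m = "map_poly of_rat m :: complex poly"
  have "rpoly (pderiv m) \<theta> \<noteq> 0"
  proof
    assume "rpoly (pderiv m) \<theta> = 0"
    then have "m dvd pderiv m" by (simp add: m_dvd)
    moreover have "pderiv m \<noteq> 0" using degree_m_pos by (simp add: pderiv_eq_0_iff)
    ultimately have "degree m \<le> degree (pderiv m)" by (rule dvd_imp_degree_le)
    then show False using degree_m_pos by (simp add: degree_pderiv)
  qed
  then obtain u v where uv: "u * m + v * pderiv m = 1" using min_poly_bezout[OF min] by metis
  have "rsquarefree ?m"
    unfolding rsquarefree_roots
  proof (intro allI notI)
    fix a assume a: "poly ?m a = 0 \<and> poly (pderiv ?m) a = 0"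
    then have "rpoly m a = 0" "rpoly (pderiv m) a = 0" by (simp_all add: rpoly_def of_rat_hom.map_poly_pderiv)
    then show False using arg_cong[OF uv, of "\<lambda>q. rpoly q a"] by (simp add: rpoly.hom_add rpoly.hom_mult)
  qed
  then have "smult (lead_coeff ?m) (\<Prod>z|poly ?m z = 0. [:-z, 1:]) = ?m"
    by (rule complex_poly_decompose_rsquarefree)
  moreover have "lead_coeff ?m \<noteq> 0" using m_nonzero by simp
  ultimately have "degree ?m = degree (\<Prod>z|poly ?m z = 0. [:-z, 1:])"
    by (metis (no_types) degree_smult_eq)
  also have "\<dots> = card {z. poly ?m z = 0}" by (subst degree_prod_sum_eq) simp_all
  finally show ?thesis by (simp add: conjugates_def rpoly_def)
qed

text \<open>Write x = r(\<theta>) with degree r < degree m. If r takes the value x at every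
  conjugate, then r - x has more roots than its degree allows, so r is constant.\<close>

lemma conj_fixed_rational:
  assumes x: "x \<in> Qadj \<theta>" and fixed: "\<And>t. t \<in> conjugates \<Longrightarrow> conj t x = x"
  shows "x \<in> \<rat>"
proof -
  obtain q where q: "x = rpoly q \<theta>" using x by (rule QadjE)
  define r where "r = q mod m"
  have r: "rpoly r t = x" if "t \<in> conjugates" for t
  proof -
    have "rpoly (m * (q div m) + r) t = x" using fixed[OF that] that by (simp add: q conj_rpoly r_def)
    then show ?thesis using that by (simp only: rpoly.hom_add rpoly.hom_mult) (simp add: conjugates_def)
  qed
  define G where "G = map_poly of_rat r - [:x:]"
  have "G = 0"
  proof (rule ccontr)
    assume "G \<noteq> 0"
    have "conjugates \<subseteq> {t. poly G t = 0}" using r by (auto simp: G_def rpoly_def)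
    then have "card conjugates \<le> card {t. poly G t = 0}" by (intro card_mono poly_roots_finite \<open>G \<noteq> 0\<close>)
    also have "\<dots> \<le> degree G" by (rule card_poly_roots_bound[OF \<open>G \<noteq> 0\<close>])
    also have "\<dots> \<le> degree r" unfolding G_def by (intro degree_diff_le) simp_all
    also have "\<dots> < degree m" using degree_mod_less[OF m_nonzero, of q] degree_m_pos unfolding r_def by auto
    finally show False by (simp add: card_conjugates)
  qed
  then have "coeff (map_poly of_rat r) 0 = x" by (simp add: G_def)
  then show ?thesis by auto
qed

end

lemma poly_of_int_poly_altdef:
  "poly (of_int_poly g) x = (\<Sum>k\<le>degree g. of_int (coeff g k) * x ^ k)" for x :: "'a :: comm_ring_1"
proof -
  have "degree (of_int_poly g :: 'a poly) \<le> degree g" by (rule degree_le) (simp add: coeff_eq_0)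
  moreover have "of_int (coeff g k) = (0 :: 'a)" if "k > degree (of_int_poly g :: 'a poly)" for k
    using coeff_eq_0[OF that] by simp
  ultimately show ?thesis
    unfolding poly_altdef by (intro sum.mono_neutral_cong_left) auto
qed

lemma (in prime_over) cg_frobenius_poly:
  assumes x: "x \<in> A"
  shows "cg (poly (of_int_poly g) x ^ p) (poly (of_int_poly g) (x ^ p))"
proof -
  have "cg ((\<Sum>k\<le>degree g. of_int (coeff g k) * x ^ k) ^ p) (\<Sum>k\<le>degree g. (of_int (coeff g k) * x ^ k) ^ p)"
    by (intro cg_frobenius_sum A_mult A_of_int A_power x)
  also have "cg \<dots> (\<Sum>k\<le>degree g. of_int (coeff g k) * (x ^ p) ^ k)"
  proof (rule cg_sum)
    fix k
    have "cg (of_int (coeff g k) ^ p * (x ^ p) ^ k) (of_int (coeff g k) * (x ^ p) ^ k)"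
      by (intro cg_mult A_power A_of_int x cg_fermat) simp_all
    then show "cg ((of_int (coeff g k) * x ^ k) ^ p) (of_int (coeff g k) * (x ^ p) ^ k)"
      by (simp add: power_mult_distrib power_mult [symmetric] mult.commute)
  qed
  finally show ?thesis unfolding poly_of_int_poly_altdef .
qed

section \<open>The permutation action on the roots and Dedekind's theorem\<close>

context galois_roots
begin

definition perm :: "complex \<Rightarrow> nat \<Rightarrow> nat" where
  "perm t i = (if i \<in> {1..n} then THE j. j \<in> {1..n} \<and> conj t (z i) = z j else i)"

lemma perm_eqI:
  assumes i: "i \<in> {1..n}" and j: "j \<in> {1..n}" and eq: "conj t (z i) = z j"
  shows "perm t i = j"
  unfolding perm_def if_P[OF i]
proof (rule the_equality)
  show "j \<in> {1..n} \<and> conj t (z i) = z j" using j eq by (rule conjI)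
  fix k assume "k \<in> {1..n} \<and> conj t (z i) = z k"
  then have "k \<in> {1..n}" "z k = z j" using eq by auto
  then show "k = j" using inj_onD[OF inj_z] j by blast
qed

lemma perm: assumes "t \<in> conjugates" "i \<in> {1..n}"
  shows perm_mem: "perm t i \<in> {1..n}" and z_perm: "z (perm t i) = conj t (z i)"
proof -
  obtain j where j: "j \<in> {1..n}" "conj t (z i) = z j" using conj_root[OF assms] by auto
  then have "perm t i = j" using perm_eqI assms by blast
  then show "perm t i \<in> {1..n}" "z (perm t i) = conj t (z i)" using j by simp_all
qed

lemma perm_permutes:
  assumes t: "t \<in> conjugates"
  shows "perm t permutes {1..n}"
proof (rule bij_imp_permutes)
  have inj: "inj_on (perm t) {1..n}"
  proof (rule inj_onI)
    fix i j assume ij: "i \<in> {1..n}" "j \<in> {1..n}" "perm t i = perm t j"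
    then have "conj t (z i) = conj t (z j)" using z_perm[OF t] by metis
    then have "z i = z j" using conj_inj[OF t] z_Qadj ij by (meson inj_onD)
    then show "i = j" using inj_z ij by (meson inj_onD)
  qed
  have "perm t ` {1..n} = {1..n}"
    by (rule endo_inj_surj[OF _ _ inj]) (use perm_mem[OF t] in auto)
  with inj show "bij_betw (perm t) {1..n} {1..n}" by (simp add: bij_betw_def)
qed (auto simp: perm_def)

lemma perm_comp:
  assumes "s \<in> conjugates" "t \<in> conjugates"
  shows "perm s \<circ> perm t = perm (conj s t)"
proof
  fix i
  show "(perm s \<circ> perm t) i = perm (conj s t) i"
  proof (cases "i \<in> {1..n}")
    case True
    have "z (perm s (perm t i)) = conj s (conj t (z i))"
      using z_perm assms True perm_mem by metis
    also have "\<dots> = conj (conj s t) (z i)" using conj_conj assms z_Qadj True by blast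
    finally have "perm (conj s t) i = perm s (perm t i)"
      by (intro perm_eqI perm_mem assms True) simp
    then show ?thesis by simp
  qed (auto simp: perm_def)
qed

definition perms :: "(nat \<Rightarrow> nat) set" where "perms = perm ` conjugates"

lemma perms_permutes: "g \<in> perms \<Longrightarrow> g permutes {1..n}"
  using perm_permutes unfolding perms_def by blast

lemma perms_comp: "g \<in> perms \<Longrightarrow> h \<in> perms \<Longrightarrow> g \<circ> h \<in> perms"
  by (auto simp: perms_def perm_comp conj_conjugate)

lemma perm_theta: "perm \<theta> = id"
proof
  fix i show "perm \<theta> i = id i"
  proof (cases "i \<in> {1..n}")
    case True
    show ?thesis using perm_eqI[OF True True] conj_theta_id[OF z_Qadj[OF True]] by simp
  qed (auto simp: perm_def)
qed

lemma perms_inv: assumes "g \<in> perms" shows "inv' g \<in> perms"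
proof -
  obtain s where s: "s \<in> conjugates" "g = perm s" using assms by (auto simp: perms_def)
  obtain t where t: "t \<in> conjugates" "conj s t = \<theta>"
    using bij_conj[OF s(1)] theta_conjugate by (metis bij_betw_imp_surj_on imageE)
  have "g \<circ> perm t = id" using perm_comp[OF s(1) t(1)] by (simp add: t s perm_theta)
  then have "inv' g = perm t"
    using perms_permutes[OF assms] by (metis inv_unique_comp permutes_inv_o(2) comp_assoc comp_id id_comp)
  then show ?thesis using t by (simp add: perms_def)
qed

lemma algebraic_int_z: "i \<in> {1..n} \<Longrightarrow> algebraic_int (z i)"
  unfolding algebraic_int_altdef_ipoly using f_monic f_root_iff by blast

text \<open>
  \<open>resolvent\<close> has integer coefficients because every embedding permutes its factors. Modulo a prime
  over \<open>p\<close>, raising it to the power \<open>p\<close> therefore only replaces the variable \<open>U\<close> of \<open>Theta\<close> by \<open>U\<^sup>p\<close>,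
  which turns its root \<open>\<Sum> U\<^sup>i z\<^sub>i\<close> into \<open>\<Sum> U\<^sup>i z\<^sub>i\<^sup>p\<close>.
\<close>

definition Theta :: "complex \<Rightarrow> complex poly" where
  "Theta t = (\<Sum>i=1..n. monom (conj t (z i)) i)"

definition resolvent :: "complex poly poly" where
  "resolvent = (\<Prod>t\<in>conjugates. [:- Theta t, 1:])"

text \<open>The factors are lifted to polynomials W t over Q. Evaluating the product N at a
  conjugate s turns the factor of t into that of \<open>conj s t\<close>, which only reindexes the
  product; so each coefficient is the value of one rational polynomial at all conjugates.\<close>

lemma resolvent_coeff_rational: "coeff (coeff resolvent j) k \<in> \<rat>"
proof -
  have "\<forall>i\<in>{1..n}. \<exists>q. z i = rpoly q \<theta>" using z_Qadj unfolding Qadj_def by blast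
  then obtain h where h: "\<And>i. i \<in> {1..n} \<Longrightarrow> z i = rpoly (h i) \<theta>" by metis
  have "\<forall>t\<in>conjugates. \<exists>q. t = rpoly q \<theta>" using conjugate_in_Qadj unfolding Qadj_def by blast
  then obtain \<tau> where \<tau>: "\<And>t. t \<in> conjugates \<Longrightarrow> t = rpoly (\<tau> t) \<theta>" by metis
  define W where "W t = (\<Sum>i=1..n. monom (pcompose (h i) (\<tau> t)) i)" for t
  define N where "N = (\<Prod>t\<in>conjugates. [:- W t, 1:])"
  have *: "coeff (coeff resolvent j) k = rpoly (coeff (coeff N j) k) s" if s: "s \<in> conjugates" for s
  proof -
    interpret e: map_poly_comm_ring_hom "\<lambda>q. rpoly q s" ..
    interpret ee: map_poly_comm_ring_hom "map_poly (\<lambda>q. rpoly q s)" ..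
    have W: "map_poly (\<lambda>q. rpoly q s) (W t) = Theta (conj s t)" if t: "t \<in> conjugates" for t
    proof -
      have "rpoly (pcompose (h i) (\<tau> t)) s = conj (conj s t) (z i)" if i: "i \<in> {1..n}" for i
      proof -
        have "rpoly (pcompose (h i) (\<tau> t)) s = rpoly (h i) (rpoly (\<tau> t) s)" by (rule rpoly_pcompose)
        also have "rpoly (\<tau> t) s = conj s t" using conj_rpoly[OF s, of "\<tau> t"] \<tau>[OF t] by simp
        also have "rpoly (h i) (conj s t) = conj (conj s t) (z i)"
          using conj_rpoly[OF conj_conjugate[OF s t], of "h i"] h[OF i] by simp
        finally show ?thesis .
      qed
      then show ?thesis
        unfolding W_def Theta_def e.hom_sum by (intro sum.cong) (simp_all add: map_poly_monom)
    qed
    have "map_poly (map_poly (\<lambda>q. rpoly q s)) N = (\<Prod>t\<in>conjugates. [:- Theta (conj s t), 1:])"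
      unfolding N_def ee.hom_prod
      by (intro prod.cong) (simp_all add: W map_poly_pCons e.hom_uminus)
    also have "\<dots> = resolvent"
      unfolding resolvent_def by (rule prod.reindex_bij_betw[OF bij_conj[OF s]])
    finally have "resolvent = map_poly (map_poly (\<lambda>q. rpoly q s)) N" ..
    then show ?thesis by (simp add: coeff_map_poly)
  qed
  show ?thesis
  proof (rule conj_fixed_rational)
    show "coeff (coeff resolvent j) k \<in> Qadj \<theta>" using *[OF theta_conjugate] by simp
    fix t assume t: "t \<in> conjugates"
    show "conj t (coeff (coeff resolvent j) k) = coeff (coeff resolvent j) k"
      using *[OF theta_conjugate] *[OF t] conj_rpoly[OF t] by metis
  qed
qed

text \<open>The function \<pi> records which root z i ^ p is congruent to. The p-th power of the
  vanishing value of \<open>resolvent\<close> at \<open>Theta \<theta>\<close> is congruent to the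
  product of all \<open>dilate p (Th - Theta t)\<close>; one factor lies in the prime ideal, and its
  coefficients are the desired congruences.\<close>

lemma dedekind:
  assumes M: "prime_over {x. algebraic_int x} M p"
    and \<pi>: "\<And>i. i \<in> {1..n} \<Longrightarrow> \<pi> i \<in> {1..n} \<and> z i ^ p - z (\<pi> i) \<in> M"
  shows "\<exists>t\<in>conjugates. \<forall>i\<in>{1..n}. z (\<pi> i) - conj t (z i) \<in> M"
proof -
  interpret M: prime_over "{x. algebraic_int x}" M p by (fact M)
  define B where "B = {q. \<forall>k. coeff q k \<in> {x :: complex. algebraic_int x}}"
  define J where "J = {q. \<forall>k. coeff q k \<in> M}"
  interpret P: prime_over B J p unfolding B_def J_def by (rule M.prime_over_poly)
  interpret PP: prime_over "{q. \<forall>k. coeff q k \<in> B}" "{q. \<forall>k. coeff q k \<in> J}" p by (rule P.prime_over_poly)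
  have monomB: "monom x k \<in> B" if "algebraic_int x" for x k using that by (simp add: B_def)
  have cg_monom: "P.cg (monom x k) (monom y k)" if "M.cg x y" for x y k
    using that unfolding P.cg_def M.cg_def by (simp add: J_def coeff_monom diff_monom M.M_0)
  have algc: "algebraic_int (conj t (z i))" if "t \<in> conjugates" "i \<in> {1..n}" for t i
    using conj_root[OF that] algebraic_int_z by auto
  have ThetaB: "Theta t \<in> B" if "t \<in> conjugates" for t
    unfolding Theta_def by (intro P.A_sum monomB algc that)
  have "resolvent \<in> {q. \<forall>k. coeff q k \<in> B}"
    unfolding resolvent_def
  proof (rule PP.A_prod)
    fix t assume "t \<in> conjugates"
    then have "coeff [:- Theta t, 1:] k \<in> B" for k
      using ThetaB P.A_uminus P.A_0 P.A_1 by (auto simp: coeff_pCons split: nat.split)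
    then show "[:- Theta t, 1:] \<in> {q. \<forall>k. coeff q k \<in> B}" by blast
  qed
  then have alg: "coeff resolvent j \<in> B" for j by blast
  have int: "coeff (coeff resolvent j) k \<in> \<int>" for j k
    using resolvent_coeff_rational alg[of j] rational_algebraic_int_is_int unfolding B_def by blast
  have dB: "dilate p q \<in> B" if "q \<in> B" for q
    unfolding dilate_altdef using that by (intro P.A_sum monomB) (simp add: B_def)
  have coeff_frob: "P.cg (coeff resolvent j ^ p) (dilate p (coeff resolvent j))" for j
  proof -
    define d where "d = coeff resolvent j"
    have "d = (\<Sum>k\<le>degree d. monom (coeff d k) k)" by (simp add: poly_as_sum_of_monoms)
    moreover have "P.cg ((\<Sum>k\<le>degree d. monom (coeff d k) k) ^ p) (\<Sum>k\<le>degree d. monom (coeff d k) k ^ p)"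
      using alg[of j] by (intro P.cg_frobenius_sum monomB) (simp add: d_def B_def)
    moreover have "P.cg (\<Sum>k\<le>degree d. monom (coeff d k) k ^ p) (dilate p d)"
      unfolding dilate_altdef
    proof (rule P.cg_sum)
      fix k
      obtain a where "coeff d k = of_int a" using int[of j k] by (auto simp: d_def elim: Ints_cases)
      then have "M.cg (coeff d k ^ p) (coeff d k)" using M.cg_fermat[of a] by simp
      then show "P.cg (monom (coeff d k) k ^ p) (monom (coeff d k) (p * k))"
        unfolding monom_power mult.commute[of k p] by (rule cg_monom)
    qed
    ultimately show ?thesis using P.cg_trans unfolding d_def by metis
  qed
  define Th where "Th = (\<Sum>i=1..n. monom (z (\<pi> i)) i)"
  have ThB: "Th \<in> B" unfolding Th_def using \<pi> algebraic_int_z by (intro P.A_sum monomB) blast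
  have Theta_frob: "P.cg (Theta \<theta> ^ p) (dilate p Th)"
  proof -
    have "P.cg ((\<Sum>i=1..n. monom (z i) i) ^ p) (\<Sum>i=1..n. monom (z i) i ^ p)"
      by (intro P.cg_frobenius_sum monomB algebraic_int_z)
    also have "P.cg \<dots> (\<Sum>i=1..n. monom (z (\<pi> i)) (p * i))"
    proof (rule P.cg_sum)
      fix i assume "i \<in> {1..n}"
      then have "M.cg (z i ^ p) (z (\<pi> i))" using \<pi> by (simp add: M.cg_def)
      then show "P.cg (monom (z i) i ^ p) (monom (z (\<pi> i)) (p * i))"
        unfolding monom_power mult.commute[of i p] by (rule cg_monom)
    qed
    also have "(\<Sum>i=1..n. monom (z (\<pi> i)) (p * i)) = dilate p Th"
      by (simp add: Th_def dilate.hom_sum dilate_monom)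
    also have "(\<Sum>i=1..n. monom (z i) i) = Theta \<theta>"
      unfolding Theta_def by (intro sum.cong) (simp_all add: conj_theta_id z_Qadj)
    finally show ?thesis .
  qed
  have poly_res: "poly resolvent y = (\<Prod>t\<in>conjugates. y - Theta t)" for y
    by (simp add: resolvent_def poly_prod)
  let ?I = "{..degree resolvent}"
  have "0 = poly resolvent (Theta \<theta>)"
    unfolding poly_res using finite_conjugates theta_conjugate by (metis diff_self prod_zero)
  also have "\<dots> = (\<Sum>j\<in>?I. coeff resolvent j * Theta \<theta> ^ j)" by (simp add: poly_altdef)
  finally have "0 = (\<Sum>j\<in>?I. coeff resolvent j * Theta \<theta> ^ j) ^ p" using M.p_pos by (simp add: zero_power)
  also have "P.cg \<dots> (\<Sum>j\<in>?I. (coeff resolvent j * Theta \<theta> ^ j) ^ p)"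
    by (intro P.cg_frobenius_sum P.A_mult alg P.A_power ThetaB theta_conjugate)
  also have "P.cg \<dots> (\<Sum>j\<in>?I. dilate p (coeff resolvent j) * dilate p Th ^ j)"
  proof (rule P.cg_sum)
    fix j
    have "P.cg (coeff resolvent j ^ p * (Theta \<theta> ^ p) ^ j) (dilate p (coeff resolvent j) * dilate p Th ^ j)"
      by (intro P.cg_mult P.cg_power coeff_frob Theta_frob P.A_power alg dB ThB ThetaB theta_conjugate)
    then show "P.cg ((coeff resolvent j * Theta \<theta> ^ j) ^ p) (dilate p (coeff resolvent j) * dilate p Th ^ j)"
      by (simp add: power_mult_distrib power_mult [symmetric] mult.commute)
  qed
  also have "(\<Sum>j\<in>?I. dilate p (coeff resolvent j) * dilate p Th ^ j) = dilate p (poly resolvent Th)"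
    by (simp add: poly_altdef dilate.hom_sum dilate.hom_mult dilate.hom_power)
  also have "\<dots> = (\<Prod>t\<in>conjugates. dilate p (Th - Theta t))"
    by (simp add: poly_res dilate.hom_prod)
  finally have "(\<Prod>t\<in>conjugates. dilate p (Th - Theta t)) \<in> J"
    using P.M_uminus by (fastforce simp: P.cg_def)
  then obtain t where t: "t \<in> conjugates" "dilate p (Th - Theta t) \<in> J"
    using P.M_prod_prime[OF finite_conjugates, of "\<lambda>t. dilate p (Th - Theta t)"] dB P.A_diff ThB ThetaB by blast
  have "z (\<pi> i) - conj t (z i) \<in> M" if i: "i \<in> {1..n}" for i
  proof -
    have "coeff (Th - Theta t) i \<in> M"
      using t(2) coeff_dilate[OF M.p_pos, of "Th - Theta t" i] unfolding J_def by (metis mem_Collect_eq)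
    also have "coeff (Th - Theta t) i = z (\<pi> i) - conj t (z i)"
      unfolding Th_def Theta_def using i by (simp add: coeff_sum coeff_monom)
    finally show ?thesis .
  qed
  then show ?thesis using t(1) by blast
qed

text \<open>The derivative condition keeps the residues of the roots distinct, and z i ^ p is again
  a root of f modulo M, hence congruent to exactly one root.\<close>

lemma frobenius_perm:
  assumes M: "prime_over {x. algebraic_int x} M p"
    and sep: "\<And>i. i \<in> {1..n} \<Longrightarrow> poly (of_int_poly (pderiv f)) (z i) \<notin> M"
  shows roots_distinct_mod: "\<And>i j. i \<in> {1..n} \<Longrightarrow> j \<in> {1..n} \<Longrightarrow> z i - z j \<in> M \<Longrightarrow> i = j"
    and ex_frobenius_perm: "\<exists>g\<in>perms. \<forall>i\<in>{1..n}. z i ^ p - z (g i) \<in> M"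
proof -
  interpret M: prime_over "{x. algebraic_int x}" M p by (fact M)
  show dist: "i = j" if ij: "i \<in> {1..n}" "j \<in> {1..n}" "z i - z j \<in> M" for i j
  proof (rule ccontr)
    \<comment> \<open>At z i the derivative of f equals (z i - z j) times an algebraic integer, so
      congruent roots would put it into M.\<close>
    assume "i \<noteq> j"
    define r where "r = (\<Prod>k\<in>{1..n} - {i} - {j}. [:- z k, 1:])"
    have "of_int_poly f = [:- z i, 1:] * ([:- z j, 1:] * r)"
      unfolding f_prod r_def using ij \<open>i \<noteq> j\<close>
      by (subst prod.remove[of _ i], simp, simp, subst prod.remove[of _ j]) auto
    then have pd: "pderiv (of_int_poly f) = [:- z i, 1:] * pderiv ([:- z j, 1:] * r) + [:- z j, 1:] * r * pderiv [:- z i, 1:]"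
      by (simp only: pderiv_mult)
    have "poly (pderiv (of_int_poly f)) (z i) = (z i - z j) * poly r (z i)"
      unfolding pd by (simp add: pderiv_pCons algebra_simps)
    moreover have "algebraic_int (poly r (z i))"
      unfolding r_def poly_prod using M.A_prod[of "{1..n} - {i} - {j}" "\<lambda>k. poly [:- z k, 1:] (z i)"]
        algebraic_int_z ij by (auto intro!: M.A_diff[simplified])
    ultimately have "poly (pderiv (of_int_poly f)) (z i) \<in> M"
      using M.M_mult[of "poly r (z i)" "z i - z j"] ij by (simp add: mult.commute)
    then show False using sep[OF ij(1)] by (simp add: of_int_hom.map_poly_pderiv)
  qed
  have "\<exists>j\<in>{1..n}. z i ^ p - z j \<in> M" if i: "i \<in> {1..n}" for i
  proof -
    have "M.cg (poly (of_int_poly f) (z i) ^ p) (poly (of_int_poly f) (z i ^ p))"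
      using M.cg_frobenius_poly algebraic_int_z i by blast
    moreover have "poly (of_int_poly f) (z i) = 0" using f_root_iff i by blast
    ultimately have "M.cg 0 (poly (of_int_poly f) (z i ^ p))" using M.p_pos by (simp add: zero_power)
    then have "(\<Prod>j=1..n. z i ^ p - z j) \<in> M"
      using M.M_uminus unfolding f_prod poly_prod M.cg_def by fastforce
    then show ?thesis
      using M.M_prod_prime[of "{1..n}" "\<lambda>j. z i ^ p - z j"] algebraic_int_z i M.A_power[of "z i" p]
      by (auto intro!: M.A_diff[simplified])
  qed
  then obtain \<pi> where \<pi>: "\<And>i. i \<in> {1..n} \<Longrightarrow> \<pi> i \<in> {1..n} \<and> z i ^ p - z (\<pi> i) \<in> M" by metis
  obtain t where t: "t \<in> conjugates" "\<And>i. i \<in> {1..n} \<Longrightarrow> z (\<pi> i) - conj t (z i) \<in> M"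
    using dedekind[OF M, of \<pi>] \<pi> by blast
  have "perm t i = \<pi> i" if "i \<in> {1..n}" for i
    using dist[of "\<pi> i" "perm t i"] t that \<pi> perm_mem z_perm by metis
  then have "\<forall>i\<in>{1..n}. z i ^ p - z (perm t i) \<in> M" using \<pi> by simp
  then show "\<exists>g\<in>perms. \<forall>i\<in>{1..n}. z i ^ p - z (g i) \<in> M" using t(1) by (auto simp: perms_def)
qed

end

section \<open>Modular arithmetic on coefficient lists\<close>

text \<open>A list \<open>h\<close> of length \<open>d\<close> stands for the monic polynomial \<open>X\<^sup>d + h\<close>; residues modulo it are
  lists of length \<open>d\<close>.\<close>

definition axpy_mod :: "int \<Rightarrow> int \<Rightarrow> int list \<Rightarrow> int list \<Rightarrow> int list" where
  "axpy_mod p c ys zs = map2 (\<lambda>y z. (c * y + z) mod p) ys zs"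

text \<open>Multiplication by X; the top coefficient is folded back through X^d = - h.\<close>

definition xstep_mod :: "int \<Rightarrow> int list \<Rightarrow> int list \<Rightarrow> int list" where
  "xstep_mod p h as = axpy_mod p (- last as) h (0 # butlast as)"

definition mult_mod :: "int \<Rightarrow> int list \<Rightarrow> int list \<Rightarrow> int list \<Rightarrow> int list" where
  "mult_mod p h xs ys = foldr (\<lambda>c acc. axpy_mod p c ys (xstep_mod p h acc)) xs (replicate (length h) 0)"

definition one_mod :: "int list \<Rightarrow> int list" where
  "one_mod h = 1 # replicate (length h - 1) 0"

text \<open>Horner evaluation of xs at the residue ys, which is how residues of Frobenius powers are
  composed.\<close>

definition compose_mod :: "int \<Rightarrow> int list \<Rightarrow> int list \<Rightarrow> int list \<Rightarrow> int list" where
  "compose_mod p h xs ys =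
     foldr (\<lambda>c acc. axpy_mod p c (one_mod h) (mult_mod p h acc ys)) xs (replicate (length h) 0)"

lemma length_axpy_mod [simp]: "length (axpy_mod p c ys zs) = min (length ys) (length zs)"
  by (simp add: axpy_mod_def)

lemma length_xstep_mod [simp]: "length as = length h \<Longrightarrow> h \<noteq> [] \<Longrightarrow> length (xstep_mod p h as) = length h"
  by (cases as rule: rev_cases) (simp_all add: xstep_mod_def)

lemma length_mult_mod [simp]: "length ys = length h \<Longrightarrow> h \<noteq> [] \<Longrightarrow> length (mult_mod p h xs ys) = length h"
  by (induction xs) (simp_all add: mult_mod_def)

lemma length_one_mod [simp]: "h \<noteq> [] \<Longrightarrow> length (one_mod h) = length h"
  by (cases h) (simp_all add: one_mod_def)

lemma length_compose_mod [simp]: "length ys = length h \<Longrightarrow> h \<noteq> [] \<Longrightarrow> length (compose_mod p h xs ys) = length h"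
  by (cases xs) (simp_all add: compose_mod_def)

abbreviation lval :: "int list \<Rightarrow> 'a :: comm_ring_1 \<Rightarrow> 'a" where
  "lval cs x \<equiv> horner_sum of_int x cs"

lemma lval_append: "lval (cs @ ds) x = lval cs x + x ^ length cs * lval ds x"
  by (induction cs) (simp_all add: algebra_simps)

lemma lval_replicate_0 [simp]: "lval (replicate k 0) x = 0"
  by (induction k) simp_all

lemma lval_one_mod [simp]: "lval (one_mod h) x = 1"
  by (simp add: one_mod_def)

lemma poly_Poly_lval: "poly (of_int_poly (Poly cs)) x = lval cs x" for x :: "'a :: comm_ring_1"
  by (induction cs) (simp_all add: of_int_hom.map_poly_pCons_hom)

context prime_over
begin

lemma A_lval: "x \<in> A \<Longrightarrow> lval cs x \<in> A"
  by (induction cs) (simp_all add: A_0 A_add A_mult A_of_int)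

lemma cg_of_int_mod: "cg (of_int (k mod int p)) (of_int k)"
  by (rule cg_of_int) simp

lemma lval_axpy_mod:
  assumes x: "x \<in> A"
  shows "length ys = length zs \<Longrightarrow> cg (lval (axpy_mod (int p) c ys zs) x) (of_int c * lval ys x + lval zs x)"
proof (induction ys zs rule: list_induct2)
  case (Cons y ys v zs)
  have "cg (of_int ((c * y + v) mod int p) + x * lval (axpy_mod (int p) c ys zs) x)
    (of_int (c * y + v) + x * (of_int c * lval ys x + lval zs x))"
    by (intro cg_add cg_of_int_mod cg_mult x A_add A_mult A_of_int A_lval Cons.IH) simp
  then show ?case by (simp add: axpy_mod_def algebra_simps)
qed (simp add: axpy_mod_def)

definition root_mod :: "int list \<Rightarrow> 'a \<Rightarrow> bool" where
  "root_mod h x \<longleftrightarrow> x \<in> A \<and> lval (h @ [1]) x \<in> M"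

lemma lval_xstep_mod:
  assumes x: "root_mod h x" and len: "length as = length h" "h \<noteq> []"
  shows "cg (lval (xstep_mod (int p) h as) x) (x * lval as x)"
proof -
  have xA: "x \<in> A" using x by (simp add: root_mod_def)
  obtain bs l where as: "as = bs @ [l]" using len by (metis length_0_conv rev_exhaust)
  have len': "length h = length (0 # bs)" using len by (simp add: as)
  have "cg (lval (xstep_mod (int p) h as) x) (of_int (- l) * lval h x + lval (0 # bs) x)"
    using lval_axpy_mod[OF xA len', of "- l"] by (simp add: xstep_mod_def as)
  also have "of_int (- l) * lval h x + lval (0 # bs) x = x * lval as x - of_int l * lval (h @ [1]) x"
    using len' by (simp add: as lval_append algebra_simps)
  also have "cg \<dots> (x * lval as x)"
    using x M_mult[OF A_of_int, of _ l] M_uminus by (simp add: cg_def root_mod_def)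
  finally show ?thesis .
qed

lemma lval_mult_mod:
  assumes x: "root_mod h x" and len: "length ys = length h" "h \<noteq> []"
  shows "cg (lval (mult_mod (int p) h xs ys) x) (lval xs x * lval ys x)"
proof (induction xs)
  case Nil
  then show ?case by (simp add: mult_mod_def)
next
  case (Cons c xs)
  have xA: "x \<in> A" using x by (simp add: root_mod_def)
  define acc where "acc = mult_mod (int p) h xs ys"
  have lacc: "length acc = length h" using len by (simp add: acc_def)
  have "cg (lval (mult_mod (int p) h (c # xs) ys) x) (of_int c * lval ys x + lval (xstep_mod (int p) h acc) x)"
    using lval_axpy_mod[OF xA, of ys "xstep_mod (int p) h acc" c] len lacc by (simp add: mult_mod_def acc_def)
  also have "cg \<dots> (of_int c * lval ys x + x * (lval xs x * lval ys x))"
  proof (rule cg_add[OF cg_refl])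
    have "cg (lval (xstep_mod (int p) h acc) x) (x * lval acc x)" by (rule lval_xstep_mod[OF x lacc len(2)])
    also have "cg (x * lval acc x) (x * (lval xs x * lval ys x))"
      unfolding acc_def by (intro cg_mult xA A_mult A_lval Cons.IH cg_refl)
    finally show "cg (lval (xstep_mod (int p) h acc) x) (x * (lval xs x * lval ys x))" .
  qed
  finally show ?case by (simp add: algebra_simps)
qed

lemma lval_compose_mod:
  assumes x: "root_mod h x" and len: "length ys = length h" "h \<noteq> []"
  shows "cg (lval (compose_mod (int p) h xs ys) x) (lval xs (lval ys x))"
proof (induction xs)
  case Nil
  then show ?case by (simp add: compose_mod_def)
next
  case (Cons c xs)
  have xA: "x \<in> A" using x by (simp add: root_mod_def)
  define acc where "acc = compose_mod (int p) h xs ys"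
  have lacc: "length acc = length h" using len by (simp add: acc_def)
  have "cg (lval (compose_mod (int p) h (c # xs) ys) x) (of_int c * lval (one_mod h) x + lval (mult_mod (int p) h acc ys) x)"
    using lval_axpy_mod[OF xA, of "one_mod h" "mult_mod (int p) h acc ys" c] len by (simp add: compose_mod_def acc_def)
  also have "cg \<dots> (of_int c * lval (one_mod h) x + lval xs (lval ys x) * lval ys x)"
  proof (rule cg_add[OF cg_refl])
    have "cg (lval (mult_mod (int p) h acc ys) x) (lval acc x * lval ys x)" by (rule lval_mult_mod[OF x len])
    also have "cg (lval acc x * lval ys x) (lval xs (lval ys x) * lval ys x)"
      unfolding acc_def by (intro cg_mult xA A_lval Cons.IH cg_refl)
    finally show "cg (lval (mult_mod (int p) h acc ys) x) (lval xs (lval ys x) * lval ys x)" .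
  qed
  finally show ?case by (simp add: algebra_simps)
qed

text \<open>An explicit inverse xs of ys modulo p and h certifies that ys vanishes at no root of h
  modulo M. The separability and non-periodicity checks are certificates of this kind.\<close>

lemma not_in_M_if_unit_mod:
  assumes x: "root_mod h x" and len: "length ys = length h" "h \<noteq> []"
    and one: "mult_mod (int p) h xs ys = one_mod h"
  shows "lval ys x \<notin> M"
proof
  assume "lval ys x \<in> M"
  moreover have "lval xs x \<in> A" using x by (simp add: root_mod_def A_lval)
  ultimately have m: "lval xs x * lval ys x \<in> M" by (rule M_mult[rotated])
  have "cg 1 (lval xs x * lval ys x)" using lval_mult_mod[OF x len, of xs] by (simp add: one)
  then show False using M_add[OF _ m] M_1 by (fastforce simp: cg_def)
qed

lemma cg_lval_cong:
  assumes "x \<in> A" "y \<in> A" "cg x y"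
  shows "cg (lval cs x) (lval cs y)"
  by (induction cs) (simp_all add: cg_add cg_mult assms A_lval)

lemma cg_frobenius_lval: "x \<in> A \<Longrightarrow> cg (lval cs x ^ p) (lval cs (x ^ p))"
  using cg_frobenius_poly[of x "Poly cs"] by (simp add: poly_Poly_lval)

text \<open>The coefficients of h are integers, so x^p is again a root of h modulo M.\<close>

lemma root_mod_frobenius: "root_mod h x \<Longrightarrow> root_mod h (x ^ p ^ k)"
proof (induction k)
  case (Suc k)
  define y where "y = x ^ p ^ k"
  have y: "y \<in> A" "lval (h @ [1]) y \<in> M" using Suc by (simp_all add: y_def root_mod_def del: horner_sum_append)
  have "cg (lval (h @ [1]) y ^ p) (lval (h @ [1]) (y ^ p))" by (rule cg_frobenius_lval[OF y(1)])
  moreover have "lval (h @ [1]) y ^ p \<in> M"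
    unfolding power_minus_mult[OF p_pos, symmetric] by (intro M_mult A_power A_lval y)
  ultimately have "lval (h @ [1]) (y ^ p) \<in> M"
    unfolding cg_def using M_diff by fastforce
  moreover have "x ^ p ^ Suc k = y ^ p" by (simp add: y_def power_mult [symmetric] mult.commute)
  ultimately show ?case using y(1) by (simp only: root_mod_def A_power)
qed simp

text \<open>r stands for X^(p^j) modulo p and h, expressed through its values at the roots of
  h.\<close>

definition frobenius_at :: "int list \<Rightarrow> nat \<Rightarrow> int list \<Rightarrow> bool" where
  "frobenius_at h j r \<longleftrightarrow> h \<noteq> [] \<and> length r = length h \<and> (\<forall>x. root_mod h x \<longrightarrow> cg (x ^ p ^ j) (lval r x))"

lemma frobenius_at_1:
  assumes h: "h \<noteq> []"
  shows "frobenius_at h 1 ((xstep_mod (int p) h ^^ p) (one_mod h))"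
proof -
  have "length ((xstep_mod (int p) h ^^ k) (one_mod h)) = length h \<and>
      (root_mod h x \<longrightarrow> cg (lval ((xstep_mod (int p) h ^^ k) (one_mod h)) x) (x ^ k))" for k x
  proof (induction k)
    case (Suc k)
    define r where "r = (xstep_mod (int p) h ^^ k) (one_mod h)"
    have r: "length r = length h" using Suc by (simp add: r_def)
    have "cg (lval (xstep_mod (int p) h r) x) (x ^ Suc k)" if x: "root_mod h x"
    proof -
      have xA: "x \<in> A" using x by (simp add: root_mod_def)
      have "cg (lval (xstep_mod (int p) h r) x) (x * lval r x)" by (rule lval_xstep_mod[OF x r h])
      also have "cg (x * lval r x) (x * x ^ k)"
        using Suc x by (intro cg_mult xA A_power) (simp_all add: r_def)
      finally show ?thesis by simp
    qed
    then show ?case using r h by (simp add: r_def)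
  qed (simp add: h)
  then show ?thesis using h by (auto simp: frobenius_at_def intro: cg_sym)
qed

text \<open>The residue for a is evaluated at y = x^(p^b), which is legitimate because y is itself a
  root of h modulo M. This reaches X^(7^9) with a few compositions.\<close>

lemma frobenius_at_add:
  assumes a: "frobenius_at h a ra" and b: "frobenius_at h b rb"
  shows "frobenius_at h (a + b) (compose_mod (int p) h ra rb)"
proof -
  have h: "h \<noteq> []" "length ra = length h" "length rb = length h" using a b by (simp_all add: frobenius_at_def)
  have "cg (x ^ p ^ (a + b)) (lval (compose_mod (int p) h ra rb) x)" if x: "root_mod h x" for x
  proof -
    have xA: "x \<in> A" using x by (simp add: root_mod_def)
    define y where "y = x ^ p ^ b"
    have yA: "y \<in> A" by (simp add: y_def A_power xA)
    have "root_mod h y" unfolding y_def by (rule root_mod_frobenius[OF x])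
    then have "cg (y ^ p ^ a) (lval ra y)" using a by (simp add: frobenius_at_def)
    also have "cg (lval ra y) (lval ra (lval rb x))"
      using b x by (intro cg_lval_cong yA A_lval xA) (simp add: frobenius_at_def y_def)
    also have "cg (lval ra (lval rb x)) (lval (compose_mod (int p) h ra rb) x)"
      by (rule cg_sym[OF lval_compose_mod[OF x h(3,1)]])
    also have "y ^ p ^ a = x ^ p ^ (a + b)" by (simp add: y_def power_add mult.commute flip: power_mult)
    finally show ?thesis .
  qed
  then show ?thesis using h by (simp add: frobenius_at_def)
qed

end

section \<open>Generation of the symmetric group\<close>

lemma conjugate_transpose:
  assumes "bij g"
  shows "g \<circ> Transposition.transpose a b \<circ> inv' g = Transposition.transpose (g a) (g b)"
proof
  fix x
  obtain y where x: "x = g y" using assms by (metis bij_pointE)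
  have "inv' g x = y" using assms by (simp add: x bij_is_inj)
  moreover have "g u = g v \<longleftrightarrow> u = v" for u v using assms by (simp add: bij_is_inj inj_eq)
  ultimately show "(g \<circ> Transposition.transpose a b \<circ> inv' g) x = Transposition.transpose (g a) (g b) x"
    by (simp add: x transpose_def)
qed

text \<open>G is transitive, so the given transposition has a conjugate (i0 j) for some j. Powers of
  c fix i0 and move j to every other point, and the transpositions (i0 j) generate all the
  others.\<close>

lemma symmetric_group_generation:
  fixes S :: "'a set" and G :: "('a \<Rightarrow> 'a) set"
  assumes fin: "finite S" and sub: "\<And>g. g \<in> G \<Longrightarrow> g permutes S"
    and comp: "\<And>g h. g \<in> G \<Longrightarrow> h \<in> G \<Longrightarrow> g \<circ> h \<in> G" and inverse: "\<And>g. g \<in> G \<Longrightarrow> inv' g \<in> G"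
    and c: "c \<in> G" and trans: "\<And>i j. i \<in> S - {i0} \<Longrightarrow> j \<in> S - {i0} \<Longrightarrow> \<exists>k. (c ^^ k) i = j"
    and i0: "i0 \<in> S" "c i0 = i0" and moves: "\<exists>g\<in>G. g i0 \<noteq> i0"
    and transp: "Transposition.transpose a b \<in> G" "a \<noteq> b" "a \<in> S"
    and \<tau>: "\<tau> permutes S"
  shows "\<tau> \<in> G"
proof -
  have bij: "bij g" if "g \<in> G" for g using sub[OF that] by (rule permutes_bij)
  have id: "id \<in> G" using comp[OF inverse[OF c] c] permutes_inv_o(2)[OF sub[OF c]] by simp
  have pow: "c ^^ k \<in> G" for k by (induction k) (simp_all only: funpow.simps id comp c)
  have pow_i0: "(c ^^ k) i0 = i0" for k by (induction k) (simp_all add: i0)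
  have conjg: "Transposition.transpose (g u) (g v) \<in> G" if "g \<in> G" "Transposition.transpose u v \<in> G" for g u v
    using comp[OF comp[OF that] inverse[OF that(1)]] conjugate_transpose[OF bij[OF that(1)], of u v] by simp
  obtain g where g: "g \<in> G" "g i0 \<noteq> i0" using moves by blast
  have to_i0: "\<exists>h\<in>G. h i = i0" if i: "i \<in> S" for i
  proof (cases "i = i0")
    case True
    then show ?thesis using id by (intro bexI[of _ id]) simp_all
  next
    case False
    have "g i0 \<in> S - {i0}" using g sub[OF g(1)] i0 by (simp add: permutes_in_image)
    then obtain k where k: "(c ^^ k) i = g i0" using trans i False by blast
    have "inv' g (g i0) = i0" using bij[OF g(1)] by (simp add: bij_is_inj)
    then have "(inv' g \<circ> (c ^^ k)) i = i0" by (simp add: k)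
    then show ?thesis using comp[OF inverse[OF g(1)] pow[of k]] by blast
  qed
  obtain h where h: "h \<in> G" "h a = i0" using to_i0[OF transp(3)] by blast
  have hb: "Transposition.transpose i0 (h b) \<in> G" using conjg[OF h(1) transp(1)] h(2) by simp
  have hb_ne: "h b \<noteq> i0" using transp(2) h bij[OF h(1)] by (metis bij_is_inj injD)
  then have hb_S: "h b \<in> S - {i0}"
  proof -
    have "h b \<in> S"
    proof (rule ccontr)
      assume "h b \<notin> S"
      from permutes_not_in[OF sub[OF hb] this] have "i0 = h b" by simp
      then show False using hb_ne by simp
    qed
    then show ?thesis using hb_ne by simp
  qed
  have star: "Transposition.transpose i0 j \<in> G" if jS: "j \<in> S - {i0}" for j
  proof -
    obtain k where "(c ^^ k) (h b) = j" using trans[OF hb_S jS] by blast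
    then show ?thesis using conjg[OF pow[of k] hb] by (simp add: pow_i0)
  qed
  have all: "Transposition.transpose i j \<in> G" if ij: "i \<in> S" "j \<in> S" for i j
  proof -
    consider "i = j" | "i = i0" "j \<noteq> i0" | "j = i0" "i \<noteq> i0" | "i \<noteq> j" "i \<noteq> i0" "j \<noteq> i0" by blast
    then show ?thesis
    proof cases
      case 1
      then show ?thesis using id by simp
    next
      case 2
      then show ?thesis using star[of j] ij by simp
    next
      case 3
      then show ?thesis using star[of i] ij by (simp add: transpose_commute)
    next
      case 4
      then show ?thesis using conjg[OF star[of i] star[of j]] ij by simp
    qed
  qed
  show ?thesis
    using \<tau> fin
  proof (induction \<tau> rule: permutes_induct)
    case id
    then show ?case by (rule \<open>id \<in> G\<close>)
  next
    case (swap a b q)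
    then show ?case using comp all by blast
  qed
qed

section \<open>The symmetric group at \<open>H = 1\<close>\<close>

lemma axpy_mod_simps:
  "axpy_mod p c [] zs = []" "axpy_mod p c (y # ys) [] = []"
  "axpy_mod p c (y # ys) (z # zs) = ((c * y + z) mod p) # axpy_mod p c ys zs"
  by (simp_all add: axpy_mod_def)

lemma mult_mod_simps:
  "mult_mod p h [] ys = replicate (length h) 0"
  "mult_mod p h (c # xs) ys = axpy_mod p c ys (xstep_mod p h (mult_mod p h xs ys))"
  by (simp_all add: mult_mod_def)

lemma compose_mod_simps:
  "compose_mod p h [] ys = replicate (length h) 0"
  "compose_mod p h (c # xs) ys = axpy_mod p c (one_mod h) (mult_mod p h (compose_mod p h xs ys) ys)"
  by (simp_all add: compose_mod_def)

lemmas mod_list_simps = axpy_mod_simps xstep_mod_def mult_mod_simps compose_mod_simps one_mod_def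

definition s_poly_coeffs :: "int list" where
  "s_poly_coeffs = [-1, -5, -10, -10, -5, -25, 5, 10, 10, 5]"

text \<open>\<open>s_poly\<close> is \<open>(s\<^sup>5 - 1) (s + 1)\<^sup>5 - 25 H s\<^sup>5\<close> at \<open>H = 1\<close>.\<close>

definition s_poly :: "int poly" where "s_poly = Poly (s_poly_coeffs @ [1])"

definition s_poly_deriv :: "int list" where
  "s_poly_deriv = [-5, -20, -30, -20, -125, 30, 70, 80, 45, 10]"

lemma pderiv_s_poly: "pderiv s_poly = Poly s_poly_deriv"
  by (simp add: s_poly_def s_poly_coeffs_def s_poly_deriv_def pderiv_pCons)

text \<open>The first list is the inverse of the derivative modulo 7 and \<open>s_poly\<close>, so
  the reduction of \<open>s_poly\<close> has no double root.\<close>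

lemma s_poly_separable_7:
  "mult_mod 7 s_poly_coeffs [4, 0, 6, 1, 4, 1, 4, 0, 1, 0] s_poly_deriv = one_mod s_poly_coeffs"
  by (simp add: mod_list_simps s_poly_coeffs_def s_poly_deriv_def)

lemma s_poly_separable_47:
  "mult_mod 47 s_poly_coeffs [12, 4, 18, 5, 6, 15, 10, 14, 12, 25] s_poly_deriv = one_mod s_poly_coeffs"
  by (simp add: mod_list_simps s_poly_coeffs_def s_poly_deriv_def)

text \<open>The factor of \<open>s_poly\<close> of degree 9 modulo 7, and below it those of degrees
  7 and 2 modulo 47, constant coefficient first and leading 1 omitted.\<close>

definition h9 :: "int list" where "h9 = [3, 3, 4, 0, 1, 1, 2, 4, 3]"
definition h7 :: "int list" where "h7 = [35, 16, 7, 46, 35, 10, 2]"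
definition h2 :: "int list" where "h2 = [7, 36]"

lemma s_poly_mod_7:
  "s_poly = [:2, 1:] * Poly (h9 @ [1]) + smult 7 (Poly [-1, -2, -3, -2, -1, -4])"
  by (simp add: s_poly_def s_poly_coeffs_def h9_def)

lemma s_poly_mod_47:
  "s_poly = [:14, 1:] * Poly (h2 @ [1]) * Poly (h7 @ [1]) +
     smult 47 (Poly [-73, -414, -226, -190, -581, -451, -151, -35, -13, -1])"
  by (simp add: s_poly_def s_poly_coeffs_def h2_def h7_def)

lemma h9_frobenius_1: "(xstep_mod 7 h9 ^^ 7) (one_mod h9) = [0, 0, 0, 0, 0, 0, 0, 1, 0]"
  by (simp add: mod_list_simps h9_def eval_nat_numeral)

lemma h9_frobenius_2: "compose_mod 7 h9 [0, 0, 0, 0, 0, 0, 0, 1, 0] [0, 0, 0, 0, 0, 0, 0, 1, 0] = [6, 5, 6, 0, 3, 6, 1, 6, 3]"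
  by (simp add: mod_list_simps h9_def)

lemma h9_frobenius_3: "compose_mod 7 h9 [6, 5, 6, 0, 3, 6, 1, 6, 3] [0, 0, 0, 0, 0, 0, 0, 1, 0] = [4, 6, 5, 3, 5, 3, 4, 4, 4]"
  by (simp add: mod_list_simps h9_def)

lemma h9_frobenius_6: "compose_mod 7 h9 [4, 6, 5, 3, 5, 3, 4, 4, 4] [4, 6, 5, 3, 5, 3, 4, 4, 4] = [4, 2, 6, 0, 2, 5, 1, 2, 6]"
  by (simp add: mod_list_simps h9_def)

lemma h9_frobenius_9: "compose_mod 7 h9 [4, 2, 6, 0, 2, 5, 1, 2, 6] [4, 6, 5, 3, 5, 3, 4, 4, 4] = [0, 1, 0, 0, 0, 0, 0, 0, 0]"
  by (simp add: mod_list_simps h9_def)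

text \<open>The second list is X^(7^3) - X, read off from \<open>h9_frobenius_3\<close>. As it is
  invertible, the third power of Frobenius fixes no root of \<open>h9\<close>.\<close>

lemma h9_no_period_3: "mult_mod 7 h9 [4, 1, 6, 4, 2, 6, 3, 3, 6] [4, 5, 5, 3, 5, 3, 4, 4, 4] = one_mod h9"
  by (simp add: mod_list_simps h9_def)

lemma funpow_trans: "(f ^^ a) u = v \<Longrightarrow> (f ^^ b) v = w \<Longrightarrow> (f ^^ (b + a)) u = w"
  by (simp add: funpow_add)

lemma h7_frobenius_1: "(xstep_mod 47 h7 ^^ 47) (one_mod h7) = [17, 35, 18, 45, 21, 10, 3]"
proof -
  let ?f = "xstep_mod 47 h7"
  have 1: "(?f ^^ 12) (one_mod h7) = [1, 29, 0, 8, 43, 42, 35]"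
    by (simp add: mod_list_simps h7_def eval_nat_numeral)
  have 2: "(?f ^^ 12) [1, 29, 0, 8, 43, 42, 35] = [16, 35, 15, 34, 36, 23, 2]"
    by (simp add: mod_list_simps h7_def eval_nat_numeral)
  have 3: "(?f ^^ 12) [16, 35, 15, 34, 36, 23, 2] = [35, 21, 2, 12, 12, 26, 2]"
    by (simp add: mod_list_simps h7_def eval_nat_numeral)
  have 4: "(?f ^^ 11) [35, 21, 2, 12, 12, 26, 2] = [17, 35, 18, 45, 21, 10, 3]"
    by (simp add: mod_list_simps h7_def eval_nat_numeral)
  show ?thesis using funpow_trans[OF funpow_trans[OF funpow_trans[OF 1 2] 3] 4] by simp
qed

lemma h7_frobenius_2: "compose_mod 47 h7 [17, 35, 18, 45, 21, 10, 3] [17, 35, 18, 45, 21, 10, 3] = [13, 39, 9, 15, 33, 0, 29]"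
  by (simp add: mod_list_simps h7_def)

lemma h7_frobenius_3: "compose_mod 47 h7 [13, 39, 9, 15, 33, 0, 29] [17, 35, 18, 45, 21, 10, 3] = [42, 42, 17, 2, 33, 28, 27]"
  by (simp add: mod_list_simps h7_def)

lemma h7_frobenius_6: "compose_mod 47 h7 [42, 42, 17, 2, 33, 28, 27] [42, 42, 17, 2, 33, 28, 27] = [12, 0, 43, 30, 36, 37, 21]"
  by (simp add: mod_list_simps h7_def)

lemma h7_frobenius_7: "compose_mod 47 h7 [12, 0, 43, 30, 36, 37, 21] [17, 35, 18, 45, 21, 10, 3] = [0, 1, 0, 0, 0, 0, 0]"
  by (simp add: mod_list_simps h7_def)

lemma h2_frobenius_1: "(xstep_mod 47 h2 ^^ 47) (one_mod h2) = [11, 46]"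
proof -
  let ?f = "xstep_mod 47 h2"
  have 1: "(?f ^^ 12) (one_mod h2) = [6, 16]"
    by (simp add: mod_list_simps h2_def eval_nat_numeral)
  have 2: "(?f ^^ 12) [6, 16] = [30, 0]"
    by (simp add: mod_list_simps h2_def eval_nat_numeral)
  have 3: "(?f ^^ 12) [30, 0] = [39, 10]"
    by (simp add: mod_list_simps h2_def eval_nat_numeral)
  have 4: "(?f ^^ 11) [39, 10] = [11, 46]"
    by (simp add: mod_list_simps h2_def eval_nat_numeral)
  show ?thesis using funpow_trans[OF funpow_trans[OF funpow_trans[OF 1 2] 3] 4] by simp
qed

lemma h2_frobenius_2: "compose_mod 47 h2 [11, 46] [11, 46] = [0, 1]"
  by (simp add: mod_list_simps h2_def)

text \<open>[11, 45] is X^47 - X, so Frobenius moves every root of \<open>h2\<close>.\<close>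

lemma h2_no_period_1: "mult_mod 47 h2 [36, 2] [11, 45] = one_mod h2"
  by (simp add: mod_list_simps h2_def)

section \<open>Recognizing a 9-cycle and a transposition\<close>

lemma funpow_multiple_fixed: "(g ^^ d) i = i \<Longrightarrow> (g ^^ (d * m)) i = i"
  by (induction m) (simp_all add: funpow_add)

text \<open>A period d < 9 of i would have a multiple congruent to 3 modulo 9, contradicting that
  g^3 moves i. So the orbit of i has nine elements and fills S without i0.\<close>

lemma nine_cycle_transitive:
  assumes g: "g permutes S" and card: "card S = 10" and i0: "i0 \<in> S" "g i0 = i0"
    and period: "\<And>i. i \<in> S - {i0} \<Longrightarrow> (g ^^ 9) i = i \<and> (g ^^ 3) i \<noteq> i"
    and ij: "i \<in> S - {i0}" "j \<in> S - {i0}"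
  shows "\<exists>k. (g ^^ k) i = j"
proof -
  have fin: "finite S" using card by (simp add: card_ge_0_finite)
  have inj: "inj (g ^^ k)" for k using g by (simp add: permutes_inj inj_fn)
  have pow_i0: "(g ^^ k) i0 = i0" for k by (induction k) (simp_all add: i0)
  have no_period: "(g ^^ d) i \<noteq> i" if d: "d \<in> {1..8}" for d
  proof
    assume fixed: "(g ^^ d) i = i"
    \<comment> \<open>For d < 9 the gcd of d and 9 divides 3, so a solution exists; the witnesses m
      and q are listed for d = 1, ..., 8.\<close>
    have "\<exists>m q. d * m = 9 * q + 3"
    proof -
      have "d \<in> {1, 2, 3, 4, 5, 6, 7, 8}" using d by auto
      then show ?thesis
        by (elim insertE)
          (rule exI[of _ 3], rule exI[of _ 0], simp, rule exI[of _ 6], rule exI[of _ 1], simp,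
           rule exI[of _ 1], rule exI[of _ 0], simp, rule exI[of _ 3], rule exI[of _ 1], simp,
           rule exI[of _ 6], rule exI[of _ 3], simp, rule exI[of _ 2], rule exI[of _ 1], simp,
           rule exI[of _ 3], rule exI[of _ 2], simp, rule exI[of _ 6], rule exI[of _ 5], simp, simp)
    qed
    then obtain m q where "d * m = 3 + 9 * q" by (metis add.commute)
    then have "(g ^^ 3) ((g ^^ (9 * q)) i) = i"
      using funpow_multiple_fixed[OF fixed, of m] by (simp only: funpow_add comp_apply)
    moreover have "(g ^^ (9 * q)) i = i" by (rule funpow_multiple_fixed) (use period[OF ij(1)] in blast)
    ultimately show False using period[OF ij(1)] by simp
  qed
  define orbit where "orbit = (\<lambda>k. (g ^^ k) i) ` {..<9}"
  have "inj_on (\<lambda>k. (g ^^ k) i) {..<9}"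
  proof (rule linorder_inj_onI)
    fix k l :: nat assume kl: "k < l" "k \<in> {..<9}" "l \<in> {..<9}"
    have "(g ^^ (l - k)) i \<noteq> i" using kl by (intro no_period) auto
    then have "(g ^^ k) ((g ^^ (l - k)) i) \<noteq> (g ^^ k) i" using inj[of k] by (simp add: inj_eq)
    moreover have "(g ^^ k) ((g ^^ (l - k)) i) = (g ^^ (k + (l - k))) i" by (simp only: funpow_add comp_apply)
    moreover have "k + (l - k) = l" using kl(1) by simp
    ultimately show "(g ^^ k) i \<noteq> (g ^^ l) i" by simp
  qed (simp add: linear)
  then have "card orbit = 9" unfolding orbit_def by (simp add: card_image)
  moreover have "orbit \<subseteq> S - {i0}"
  proof
    fix x assume "x \<in> orbit"
    then obtain k where x: "x = (g ^^ k) i" by (auto simp: orbit_def)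
    have "(g ^^ k) permutes S" by (rule permutes_funpow[OF g])
    then have "x \<in> S" using ij by (simp add: x permutes_in_image)
    moreover have "x \<noteq> i0" using inj[of k] pow_i0[of k] ij by (metis DiffD2 injD insertI1 x)
    ultimately show "x \<in> S - {i0}" by simp
  qed
  moreover have "card (S - {i0}) = 9" using card i0 by simp
  ultimately have "orbit = S - {i0}" by (intro card_subset_eq) (simp_all add: fin)
  then have "j \<in> orbit" using ij(2) by simp
  then show ?thesis by (auto simp: orbit_def)
qed

lemma transposition_criterion:
  assumes g: "g permutes S" and ab: "a \<in> S" "g a = b" "a \<noteq> b"
    and fixed: "\<And>k. k \<in> S \<Longrightarrow> k \<noteq> a \<Longrightarrow> k \<noteq> b \<Longrightarrow> g k = k"
  shows "g = Transposition.transpose a b"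
proof
  fix k
  have inj: "g x = g y \<longleftrightarrow> x = y" for x y using permutes_inj[OF g] by (simp add: inj_eq)
  have bS: "b \<in> S" using permutes_in_image[OF g, of a] ab by simp
  have gb: "g b = a"
  proof (rule ccontr)
    assume ne: "g b \<noteq> a"
    have "g b \<noteq> b" using inj[of a b] ab by auto
    moreover have "g b \<in> S" using bS by (simp add: permutes_in_image[OF g])
    ultimately have "g (g b) = g b" using fixed ne by blast
    then show False using inj \<open>g b \<noteq> b\<close> by simp
  qed
  show "g k = Transposition.transpose a b k"
  proof (cases "k \<in> S")
    case True
    then show ?thesis using ab gb fixed[of k] by (cases "k = a \<or> k = b") (auto simp: transpose_def)
  next
    case False
    then show ?thesis using permutes_not_in[OF g] ab bS by (auto simp: transpose_def)
  qed
qed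

section \<open>Iterated Frobenius acting on the roots\<close>

context galois_roots
begin

lemma id_in_perms: "id \<in> perms"
  using theta_conjugate by (auto simp: perms_def simp flip: perm_theta)

lemma perms_funpow: "g \<in> perms \<Longrightarrow> g ^^ k \<in> perms"
  by (induction k) (simp_all only: funpow.simps id_in_perms perms_comp)

lemma frobenius_funpow:
  assumes M: "prime_over {x. algebraic_int x} M p"
    and g: "g \<in> perms" "\<And>i. i \<in> {1..n} \<Longrightarrow> z i ^ p - z (g i) \<in> M"
    and i: "i \<in> {1..n}"
  shows "prime_over.cg M (z i ^ p ^ k) (z ((g ^^ k) i))"
proof (induction k)
  interpret M: prime_over "{x. algebraic_int x}" M p by (fact M)
  case 0
  show ?case by simp
next
  interpret M: prime_over "{x. algebraic_int x}" M p by (fact M)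
  case (Suc k)
  have gk: "(g ^^ k) i \<in> {1..n}" using perms_permutes[OF perms_funpow[OF g(1)]] i by (simp only: permutes_in_image)
  have "M.cg ((z i ^ p ^ k) ^ p) (z ((g ^^ k) i) ^ p)"
    using algebraic_int_z[OF i] algebraic_int_z[OF gk] by (intro M.cg_power Suc M.A_power) simp_all
  also have "M.cg (z ((g ^^ k) i) ^ p) (z ((g ^^ Suc k) i))" using g(2)[OF gk] by (simp add: M.cg_def)
  also have "(z i ^ p ^ k) ^ p = z i ^ p ^ Suc k" by (simp add: mult.commute flip: power_mult)
  finally show ?case .
qed

text \<open>A root fixed by all of \<open>perms\<close> is rational, and a rational algebraic
  integer is an integer.\<close>

lemma ex_moving_perm:
  assumes no_int_root: "\<And>k. poly f k \<noteq> 0" and i: "i \<in> {1..n}"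
  shows "\<exists>g\<in>perms. g i \<noteq> i"
proof (rule ccontr)
  assume "\<not> ?thesis"
  then have "conj t (z i) = z i" if "t \<in> conjugates" for t
    using z_perm[OF that i] that by (auto simp: perms_def)
  then have "z i \<in> \<rat>" using conj_fixed_rational z_Qadj[OF i] by blast
  then obtain k where k: "z i = of_int k"
    using rational_algebraic_int_is_int[OF algebraic_int_z[OF i]] by (auto elim: Ints_cases)
  have "poly (of_int_poly f) (z i) = 0" using f_root_iff i by blast
  then have "of_int (poly f k) = (0 :: complex)" by (simp add: k)
  then show False using no_int_root[of k] by (simp only: of_int_eq_0_iff)
qed

end

lemma s_poly_no_int_root: "poly s_poly k \<noteq> (0 :: int)"
proof
  assume 0: "poly s_poly k = 0"
  \<comment> \<open>The constant term is -1, so an integer root would have to be 1 or -1.\<close>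
  have "poly s_poly k = k * poly (Poly (tl s_poly_coeffs @ [1])) k - 1"
    by (simp add: s_poly_def s_poly_coeffs_def)
  then have "k * poly (Poly (tl s_poly_coeffs @ [1])) k = 1" using 0 by simp
  then have "k = 1 \<or> k = -1" using zmult_eq_1_iff by blast
  then show False using 0 by (auto simp: s_poly_def s_poly_coeffs_def)
qed

section \<open>Frobenius permutations of the roots of \<open>s_poly\<close>\<close>

locale s_roots = galois_roots 10 z s_poly c \<theta> m for z c \<theta> m
begin

lemma prod_eval: "poly (of_int_poly s_poly) x = (\<Prod>i=1..10. x - z i)"
  unfolding f_prod by (simp add: poly_prod)

lemma root_s_poly: "i \<in> {1..10} \<Longrightarrow> poly (of_int_poly s_poly) (z i) = 0"
  using f_root_iff by blast

lemma ex_root_mod: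
  assumes M: "prime_over {x. algebraic_int x} M p" and x: "algebraic_int x" "poly (of_int_poly s_poly) x \<in> M"
  shows "\<exists>i\<in>{1..10}. x - z i \<in> M"
proof -
  interpret M: prime_over "{x. algebraic_int x}" M p by (fact M)
  show ?thesis
    using M.M_prod_prime[of "{1..10}" "\<lambda>i. x - z i"] x M.A_diff algebraic_int_z unfolding prod_eval by auto
qed

lemma separable_mod:
  assumes M: "prime_over {x. algebraic_int x} M p" and p: "p = 7 \<or> p = 47" and i: "i \<in> {1..10}"
  shows "poly (of_int_poly (pderiv s_poly)) (z i) \<notin> M"
proof -
  interpret M: prime_over "{x. algebraic_int x}" M p by (fact M)
  have "M.root_mod s_poly_coeffs (z i)"
    unfolding M.root_mod_def using algebraic_int_z[OF i] root_s_poly[OF i] M.M_0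
    by (simp only: s_poly_def poly_Poly_lval mem_Collect_eq)
  moreover have "length s_poly_deriv = length s_poly_coeffs" "s_poly_coeffs \<noteq> []"
    by (simp_all add: s_poly_deriv_def s_poly_coeffs_def)
  moreover have "\<exists>xs. mult_mod (int p) s_poly_coeffs xs s_poly_deriv = one_mod s_poly_coeffs"
    using p s_poly_separable_7 s_poly_separable_47 by auto
  ultimately have "lval s_poly_deriv (z i) \<notin> M" using M.not_in_M_if_unit_mod by blast
  then show ?thesis unfolding pderiv_s_poly poly_Poly_lval .
qed

lemma frobenius_data:
  assumes p: "p = 7 \<or> p = 47"
  obtains M g where "prime_over {x. algebraic_int x} M p" "g \<in> perms"
    "\<And>i j. i \<in> {1..10} \<Longrightarrow> j \<in> {1..10} \<Longrightarrow> z i - z j \<in> M \<Longrightarrow> i = j"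
    "\<And>i. i \<in> {1..10} \<Longrightarrow> z i ^ p - z (g i) \<in> M"
    "\<And>i k. i \<in> {1..10} \<Longrightarrow> prime_over.cg M (z i ^ p ^ k) (z ((g ^^ k) i))"
    "\<And>i k. i \<in> {1..10} \<Longrightarrow> (g ^^ k) i \<in> {1..10}"
proof -
  have "prime p" using p by (auto simp: prime_nat_numeral_eq)
  then obtain M where M: "prime_over {x :: complex. algebraic_int x} M p" using ex_prime_over by blast
  have sep: "poly (of_int_poly (pderiv s_poly)) (z i) \<notin> M" if "i \<in> {1..10}" for i
    by (rule separable_mod[OF M p that])
  have dist: "i = j" if "i \<in> {1..10}" "j \<in> {1..10}" "z i - z j \<in> M" for i j
    using roots_distinct_mod[OF M sep] that by blast
  obtain g where g: "g \<in> perms" "\<And>i. i \<in> {1..10} \<Longrightarrow> z i ^ p - z (g i) \<in> M"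
    using ex_frobenius_perm[OF M sep] by blast
  have "(g ^^ k) i \<in> {1..10}" if "i \<in> {1..10}" for i k
    using perms_permutes[OF perms_funpow[OF g(1)]] that by (simp only: permutes_in_image)
  then show thesis using that[OF M g(1) dist g(2) frobenius_funpow[OF M g]] by blast
qed

text \<open>Frobenius at 7 fixes the root congruent to \<open>-2\<close> and permutes the other nine cyclically.\<close>

lemma ex_nine_cycle:
  obtains g i0 where "g \<in> perms" "i0 \<in> {1..10}" "g i0 = i0"
    "\<And>i. i \<in> {1..10} - {i0} \<Longrightarrow> (g ^^ 9) i = i \<and> (g ^^ 3) i \<noteq> i"
proof -
  obtain M g where M: "prime_over {x :: complex. algebraic_int x} M 7" and g1: "g \<in> perms"
    and dist: "\<And>i j. i \<in> {1..10} \<Longrightarrow> j \<in> {1..10} \<Longrightarrow> z i - z j \<in> M \<Longrightarrow> i = j"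
    and g2: "\<And>i. i \<in> {1..10} \<Longrightarrow> z i ^ 7 - z (g i) \<in> M"
    and iter: "\<And>i k. i \<in> {1..10} \<Longrightarrow> prime_over.cg M (z i ^ 7 ^ k) (z ((g ^^ k) i))"
    and gk: "\<And>i k. i \<in> {1..10} \<Longrightarrow> (g ^^ k) i \<in> {1..10}"
    by (rule frobenius_data[of 7]) auto
  interpret M: prime_over "{x. algebraic_int x}" M 7 by (fact M)
  have eval7: "poly (of_int_poly s_poly) x = (x + 2) * lval (h9 @ [1]) x + of_nat 7 * lval [-1, -2, -3, -2, -1, -4] x"
    for x :: complex
    by (subst s_poly_mod_7) (simp only: of_int_poly_hom.hom_add of_int_poly_hom.hom_mult
        of_int_hom.map_poly_hom_smult poly_add poly_mult poly_smult poly_Poly_lval, simp add: add.commute)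
  have M7: "of_nat 7 * y \<in> M" if "algebraic_int y" for y using M.M_p_mult that by simp
  have "poly (of_int_poly s_poly) (-2) = of_nat 7 * lval [-1, -2, -3, -2, -1, -4] (-2 :: complex)"
    unfolding eval7 by simp
  then have "poly (of_int_poly s_poly) (-2) \<in> M"
    using M7[of "lval [-1, -2, -3, -2, -1, -4] (-2)"] M.A_lval[of "-2"] by simp
  then obtain i0 where i0: "i0 \<in> {1..10}" "-2 - z i0 \<in> M"
    using ex_root_mod[OF M, of "-2"] by auto
  have cg0: "M.cg (-2) (z i0)" using i0 by (simp add: M.cg_def)
  \<comment> \<open>By Fermat (-2)^7 is congruent to -2, so Frobenius fixes the residue of z i0; the
    roots are distinct modulo M.\<close>
  have "g i0 = i0"
  proof -
    have "M.cg (z i0) ((-2) ^ 7)"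
      using M.cg_trans[OF M.cg_sym[OF cg0] M.cg_sym[OF M.cg_fermat[of "-2"], simplified]] by simp
    also have "M.cg ((-2) ^ 7) (z i0 ^ 7)"
      using algebraic_int_z[OF i0(1)] by (intro M.cg_power cg0) auto
    also have "M.cg (z i0 ^ 7) (z (g i0))" using g2[OF i0(1)] by (simp add: M.cg_def)
    finally have "z i0 - z (g i0) \<in> M" by (simp add: M.cg_def)
    moreover have "g i0 \<in> {1..10}" using gk[OF i0(1), of 1] by simp
    ultimately show ?thesis using dist[OF i0(1), of "g i0"] by metis
  qed
  have f1: "M.frobenius_at h9 1 [0, 0, 0, 0, 0, 0, 0, 1, 0]"
    using M.frobenius_at_1[of h9] h9_frobenius_1 by (simp add: h9_def)
  have f2: "M.frobenius_at h9 2 [6, 5, 6, 0, 3, 6, 1, 6, 3]"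
    using M.frobenius_at_add[OF f1 f1] h9_frobenius_2 by (simp add: numeral_2_eq_2)
  have f3: "M.frobenius_at h9 3 [4, 6, 5, 3, 5, 3, 4, 4, 4]"
    using M.frobenius_at_add[OF f2 f1] h9_frobenius_3 by simp
  have f6: "M.frobenius_at h9 6 [4, 2, 6, 0, 2, 5, 1, 2, 6]"
    using M.frobenius_at_add[OF f3 f3] h9_frobenius_6 by simp
  have f9: "M.frobenius_at h9 9 [0, 1, 0, 0, 0, 0, 0, 0, 0]"
    using M.frobenius_at_add[OF f6 f3] h9_frobenius_9 by simp
  have "(g ^^ 9) i = i \<and> (g ^^ 3) i \<noteq> i" if i: "i \<in> {1..10} - {i0}" for i
  proof -
    have i': "i \<in> {1..10}" using i by simp
    have zi: "algebraic_int (z i)" by (rule algebraic_int_z[OF i'])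
    have "(z i + 2) * lval (h9 @ [1]) (z i) + of_nat 7 * lval [-1, -2, -3, -2, -1, -4] (z i) = 0"
      using root_s_poly[OF i'] unfolding eval7 .
    then have "(z i + 2) * lval (h9 @ [1]) (z i) = - (of_nat 7 * lval [-1, -2, -3, -2, -1, -4] (z i))"
      by (simp only: eq_neg_iff_add_eq_0)
    also have "\<dots> \<in> M" using M.A_lval[of "z i"] zi by (intro M.M_uminus M7) (simp del: horner_sum_simps)
    finally have "z i + 2 \<in> M \<or> lval (h9 @ [1]) (z i) \<in> M"
      using M.A_lval[of "z i" "h9 @ [1]"] M.A_add[of "z i" 2] zi by (intro M.M_prime) (simp_all del: horner_sum_simps horner_sum_append)
    moreover have "z i + 2 \<notin> M"
    proof
      assume "z i + 2 \<in> M"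
      then have "z i - z i0 \<in> M" using M.M_add[OF _ i0(2), of "z i + 2"] by simp
      then show False using dist[OF i' i0(1)] i by simp
    qed
    ultimately have root: "M.root_mod h9 (z i)" using zi by (simp add: M.root_mod_def del: horner_sum_append)
    have "M.cg (z i ^ 7 ^ 9) (z i)" using f9 root by (auto simp: M.frobenius_at_def)
    then have "M.cg (z ((g ^^ 9) i)) (z i)" using M.cg_trans[OF M.cg_sym[OF iter[OF i', of 9]]] by blast
    then have 9: "(g ^^ 9) i = i" using dist[OF gk[OF i'] i'] by (simp add: M.cg_def)
    have "(g ^^ 3) i \<noteq> i"
    proof
      assume "(g ^^ 3) i = i"
      then have "M.cg (z i ^ 7 ^ 3) (z i)" using iter[OF i', of 3] by simp
      moreover have "M.cg (z i ^ 7 ^ 3) (lval [4, 6, 5, 3, 5, 3, 4, 4, 4] (z i))"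
        using f3 root by (auto simp: M.frobenius_at_def simp del: horner_sum_simps)
      ultimately have "M.cg (lval [4, 6, 5, 3, 5, 3, 4, 4, 4] (z i)) (z i)"
        using M.cg_trans M.cg_sym by blast
      then have "lval [4, 5, 5, 3, 5, 3, 4, 4, 4] (z i) \<in> M"
        by (simp add: M.cg_def algebra_simps)
      moreover have "lval [4, 5, 5, 3, 5, 3, 4, 4, 4] (z i) \<notin> M"
        by (rule M.not_in_M_if_unit_mod[OF root, of _ "[4, 1, 6, 4, 2, 6, 3, 3, 6]"])
          (use h9_no_period_3 in \<open>simp_all add: h9_def\<close>)
      ultimately show False by blast
    qed
    with 9 show ?thesis by blast
  qed
  then show thesis using that[OF g1 i0(1) \<open>g i0 = i0\<close>] by blast
qed

text \<open>Frobenius at 47 has cycle type \<open>(1, 2, 7)\<close>, so that its seventh power is a transposition.\<close>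

lemma ex_transposition:
  obtains a b where "a \<in> {1..10}" "a \<noteq> b" "Transposition.transpose a b \<in> perms"
proof -
  obtain M g where M: "prime_over {x :: complex. algebraic_int x} M 47" and g1: "g \<in> perms"
    and dist: "\<And>i j. i \<in> {1..10} \<Longrightarrow> j \<in> {1..10} \<Longrightarrow> z i - z j \<in> M \<Longrightarrow> i = j"
    and g2: "\<And>i. i \<in> {1..10} \<Longrightarrow> z i ^ 47 - z (g i) \<in> M"
    and iter: "\<And>i k. i \<in> {1..10} \<Longrightarrow> prime_over.cg M (z i ^ 47 ^ k) (z ((g ^^ k) i))"
    and gk: "\<And>i k. i \<in> {1..10} \<Longrightarrow> (g ^^ k) i \<in> {1..10}"
    by (rule frobenius_data[of 47]) auto
  interpret M: prime_over "{x. algebraic_int x}" M 47 by (fact M)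
  define w where "w = [-73, -414, -226, -190, -581, -451, -151, -35, -13, -1 :: int]"
  have eval47: "poly (of_int_poly s_poly) x = (x + 14) * lval (h2 @ [1]) x * lval (h7 @ [1]) x + of_nat 47 * lval w x"
    for x :: complex
    by (subst s_poly_mod_47) (simp only: of_int_poly_hom.hom_add of_int_poly_hom.hom_mult w_def
        of_int_hom.map_poly_hom_smult poly_add poly_mult poly_smult poly_Poly_lval, simp add: add.commute)
  have M47: "of_nat 47 * y \<in> M" if "algebraic_int y" for y using M.M_p_mult that by simp
  have alg_lval: "algebraic_int (lval cs x)" if "algebraic_int x" for cs and x :: complex
    using M.A_lval[of x cs] that by simp
  have q1: "M.frobenius_at h2 1 [11, 46]"
    using M.frobenius_at_1[of h2] h2_frobenius_1 by (simp add: h2_def)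
  have q2: "M.frobenius_at h2 2 [0, 1]"
    using M.frobenius_at_add[OF q1 q1] h2_frobenius_2 by (simp add: numeral_2_eq_2)
  have s1: "M.frobenius_at h7 1 [17, 35, 18, 45, 21, 10, 3]"
    using M.frobenius_at_1[of h7] h7_frobenius_1 by (simp add: h7_def)
  have s2: "M.frobenius_at h7 2 [13, 39, 9, 15, 33, 0, 29]"
    using M.frobenius_at_add[OF s1 s1] h7_frobenius_2 by (simp add: numeral_2_eq_2)
  have s3: "M.frobenius_at h7 3 [42, 42, 17, 2, 33, 28, 27]"
    using M.frobenius_at_add[OF s2 s1] h7_frobenius_3 by simp
  have s6: "M.frobenius_at h7 6 [12, 0, 43, 30, 36, 37, 21]"
    using M.frobenius_at_add[OF s3 s3] h7_frobenius_6 by simp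
  have s7: "M.frobenius_at h7 7 [0, 1, 0, 0, 0, 0, 0]"
    using M.frobenius_at_add[OF s6 s1] h7_frobenius_7 by simp
  have trichotomy: "z i + 14 \<in> M \<or> M.root_mod h2 (z i) \<or> M.root_mod h7 (z i)" if i: "i \<in> {1..10}" for i
  proof -
    have zi: "algebraic_int (z i)" by (rule algebraic_int_z[OF i])
    have "(z i + 14) * lval (h2 @ [1]) (z i) * lval (h7 @ [1]) (z i) = - (of_nat 47 * lval w (z i))"
      using root_s_poly[OF i] unfolding eval47 by (simp only: eq_neg_iff_add_eq_0)
    also have "\<dots> \<in> M" by (intro M.M_uminus M47 alg_lval zi)
    finally have "(z i + 14) * lval (h2 @ [1]) (z i) * lval (h7 @ [1]) (z i) \<in> M" .
    moreover have "z i + 14 \<in> {x. algebraic_int x}" "lval (h2 @ [1]) (z i) \<in> {x. algebraic_int x}" "lval (h7 @ [1]) (z i) \<in> {x. algebraic_int x}"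
      using M.A_add[of "z i" 14] zi alg_lval by (simp_all del: horner_sum_append)
    ultimately have "z i + 14 \<in> M \<or> lval (h2 @ [1]) (z i) \<in> M \<or> lval (h7 @ [1]) (z i) \<in> M"
      using M.M_prime M.A_mult by meson
    then show ?thesis using zi unfolding M.root_mod_def by blast
  qed
  have fixed_if: "(g ^^ 7) i = i" if i: "i \<in> {1..10}" and nq: "\<not> M.root_mod h2 (z i)" for i
    using trichotomy[OF i]
  proof (elim disjE)
    have zi: "algebraic_int (z i)" by (rule algebraic_int_z[OF i])
    assume "z i + 14 \<in> M"
    then have c: "M.cg (z i) (-14)" by (simp add: M.cg_def)
    have "M.cg (z i) ((-14) ^ 47)"
      using M.cg_trans[OF c M.cg_sym[OF M.cg_fermat[of "-14"], simplified]] by simp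
    also have "M.cg ((-14) ^ 47) (z i ^ 47)"
      using zi by (intro M.cg_power M.cg_sym[OF c]) auto
    also have "M.cg (z i ^ 47) (z (g i))" using g2[OF i] by (simp add: M.cg_def)
    finally have "z i - z (g i) \<in> M" by (simp add: M.cg_def)
    moreover have "g i \<in> {1..10}" using gk[OF i, of 1] by simp
    ultimately have "g i = i" using dist[OF i, of "g i"] by metis
    then show ?thesis using funpow_multiple_fixed[of 1 g i 7] by simp
  next
    assume "M.root_mod h7 (z i)"
    then have "M.cg (z i ^ 47 ^ 7) (z i)" using s7 by (auto simp: M.frobenius_at_def)
    then have "M.cg (z ((g ^^ 7) i)) (z i)" using M.cg_trans[OF M.cg_sym[OF iter[OF i, of 7]]] by blast
    then show ?thesis using dist[OF gk[OF i] i] by (simp add: M.cg_def)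
  qed (use nq in blast)
  \<comment> \<open>To find a root z a that reduces to a root of \<open>h2\<close>, take a complex
    root \<alpha> of the monic lift of \<open>h2\<close>. It is an algebraic integer and a root of
    \<open>s_poly\<close> modulo M, hence congruent to some z a.\<close>
  have "\<exists>x :: complex. poly (of_int_poly (Poly (h2 @ [1]))) x = 0"
  proof -
    have "\<not> constant (poly (of_int_poly (Poly (h2 @ [1])) :: complex poly))"
      by (simp add: constant_degree h2_def)
    then show ?thesis by (rule fundamental_theorem_of_algebra)
  qed
  then obtain \<alpha> :: complex where \<alpha>: "poly (of_int_poly (Poly (h2 @ [1]))) \<alpha> = 0" by blast
  have alg\<alpha>: "algebraic_int \<alpha>"
    unfolding algebraic_int_altdef_ipoly by (intro exI[of _ "Poly (h2 @ [1])"] conjI \<alpha>) (simp add: h2_def)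
  have l\<alpha>: "lval (h2 @ [1]) \<alpha> = 0" using \<alpha> unfolding poly_Poly_lval .
  have "poly (of_int_poly s_poly) \<alpha> \<in> M"
    unfolding eval47 l\<alpha> using M47[OF alg_lval[OF alg\<alpha>]] by simp
  then obtain a where a: "a \<in> {1..10}" "\<alpha> - z a \<in> M" using ex_root_mod[OF M alg\<alpha>] by blast
  have za: "algebraic_int (z a)" by (rule algebraic_int_z[OF a(1)])
  have "M.cg (lval (h2 @ [1]) \<alpha>) (lval (h2 @ [1]) (z a))"
    using a alg\<alpha> za by (intro M.cg_lval_cong) (simp_all add: M.cg_def)
  then have "lval (h2 @ [1]) (z a) \<in> M" unfolding l\<alpha> M.cg_def using M.M_uminus by fastforce
  then have qa: "M.root_mod h2 (z a)" using za by (simp add: M.root_mod_def del: horner_sum_append)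
  have fa: "M.cg (z a ^ 47 ^ 1) (lval [11, 46] (z a))"
    using q1 qa by (auto simp: M.frobenius_at_def simp del: horner_sum_simps)
  define b where "b = g a"
  have bS: "b \<in> {1..10}" using gk[OF a(1), of 1] by (simp add: b_def)
  have zb: "M.cg (z b) (lval [11, 46] (z a))"
    using M.cg_trans[OF M.cg_sym[OF iter[OF a(1), of 1]] fa] by (simp add: b_def)
  have "a \<noteq> b"
  proof
    assume "a = b"
    then have "M.cg (lval [11, 46] (z a)) (z a)" using M.cg_sym[OF zb] by simp
    then have "lval [11, 45] (z a) \<in> M" by (simp add: M.cg_def algebra_simps)
    moreover have "lval [11, 45] (z a) \<notin> M"
      by (rule M.not_in_M_if_unit_mod[OF qa, of _ "[36, 2]"]) (use h2_no_period_1 in \<open>simp_all add: h2_def\<close>)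
    ultimately show False by blast
  qed
  have g2a: "(g ^^ 2) a = a"
  proof -
    have "M.cg (z a ^ 47 ^ 2) (z a)" using q2 qa by (auto simp: M.frobenius_at_def)
    then have "M.cg (z ((g ^^ 2) a)) (z a)" using M.cg_trans[OF M.cg_sym[OF iter[OF a(1), of 2]]] by blast
    then show ?thesis using dist[OF gk[OF a(1)] a(1)] by (simp add: M.cg_def)
  qed
  have "(g ^^ 7) a = b"
  proof -
    \<comment> \<open>On the 2-cycle of a and b the odd power 7 acts like g.\<close>
    have "(g ^^ 7) a = (g ^^ (1 + 2 * 3)) a" by simp
    also have "\<dots> = (g ^^ 1) ((g ^^ (2 * 3)) a)" by (simp only: funpow_add comp_apply)
    also have "(g ^^ (2 * 3)) a = a" by (rule funpow_multiple_fixed[OF g2a])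
    finally show ?thesis by (simp add: b_def)
  qed
  moreover have "(g ^^ 7) k = k" if k: "k \<in> {1..10}" "k \<noteq> a" "k \<noteq> b" for k
  proof (rule fixed_if[OF k(1)])
    show "\<not> M.root_mod h2 (z k)"
    proof
      assume qk: "M.root_mod h2 (z k)"
      have zk: "algebraic_int (z k)" by (rule algebraic_int_z[OF k(1)])
      \<comment> \<open>No third root of \<open>h2\<close> exists: incongruent roots z k and z a
        have sum -36 modulo M, and X^47 = 11 - X modulo 47 shows that z b also has the residue -36 -
        z a.\<close>
      have "lval (h2 @ [1]) (z k) - lval (h2 @ [1]) (z a) \<in> M"
        using qa qk by (intro M.M_diff) (simp_all add: M.root_mod_def del: horner_sum_append)
      moreover have "lval (h2 @ [1]) (z k) - lval (h2 @ [1]) (z a) = (z k - z a) * (z k + z a + 36)"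
        by (simp add: h2_def algebra_simps)
      ultimately have "(z k - z a) * (z k + z a + 36) \<in> M" by simp
      moreover have "z k - z a \<notin> M" using dist[OF k(1) a(1)] k by blast
      ultimately have ka: "z k + z a + 36 \<in> M"
        using M.M_prime[of "z k - z a" "z k + z a + 36"] M.A_diff[of "z k" "z a"] M.A_add[of "z k" "z a"]
          M.A_add[of "z k + z a" 36] zk za by auto
      have lb: "lval [11, 46] (z a) - z b \<in> M" using M.cg_sym[OF zb] by (simp add: M.cg_def del: horner_sum_simps)
      have "algebraic_int (1 + z a)" using M.A_add[of 1 "z a"] za by simp
      \<comment> \<open>The multiple 47 (1 + z a) cancels 36 + 11 and z a + 46 z a, leaving z k - z
        b.\<close>
      from M.M_diff[OF M.M_add[OF ka lb] M47[OF this]]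
      have "(z k + z a + 36) + (lval [11, 46] (z a) - z b) - of_nat 47 * (1 + z a) \<in> M" .
      then have "z k - z b \<in> M" by (simp add: algebra_simps)
      then show False using dist[OF k(1) bS] k by blast
    qed
  qed
  ultimately have "g ^^ 7 = Transposition.transpose a b"
    by (intro transposition_criterion[OF perms_permutes[OF perms_funpow[OF g1]] a(1) _ \<open>a \<noteq> b\<close>])
  then show thesis using that[OF a(1) \<open>a \<noteq> b\<close>] perms_funpow[OF g1, of 7] by simp
qed

theorem perms_all:
  assumes "\<tau> permutes {1..10}"
  shows "\<tau> \<in> perms"
proof -
  obtain g i0 where g: "g \<in> perms" "i0 \<in> {1..10}" "g i0 = i0"
    "\<And>i. i \<in> {1..10} - {i0} \<Longrightarrow> (g ^^ 9) i = i \<and> (g ^^ 3) i \<noteq> i" by (rule ex_nine_cycle) blast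
  obtain a b where ab: "a \<in> {1..10}" "a \<noteq> b" "Transposition.transpose a b \<in> perms" by (rule ex_transposition) blast
  have trans: "\<exists>k. (g ^^ k) i = j" if "i \<in> {1..10} - {i0}" "j \<in> {1..10} - {i0}" for i j
    by (rule nine_cycle_transitive[OF perms_permutes[OF g(1)] _ g(2-4) that]) simp
  show ?thesis
    by (rule symmetric_group_generation[OF _ perms_permutes perms_comp perms_inv g(1) trans g(2,3)
          ex_moving_perm[OF s_poly_no_int_root g(2)] ab(3,2,1) assms]) simp
qed

end

lemma rpoly_of_int_poly: "rpoly (of_int_poly g) x = poly (of_int_poly g) x"
  by (simp add: rpoly_def map_poly_map_poly o_def)

lemma degree_s_poly: "degree s_poly = 10" and lead_coeff_s_poly: "lead_coeff s_poly = 1"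
  by (simp_all add: s_poly_def s_poly_coeffs_def)

text \<open>A double root in C would remain a common root of \<open>s_poly\<close> and its
  derivative modulo a prime over 7, contradicting the certificate.\<close>

lemma s_poly_no_double_root:
  fixes x :: complex
  assumes x: "poly (of_int_poly s_poly) x = 0"
  shows "poly (of_int_poly (pderiv s_poly)) x \<noteq> 0"
proof
  assume 0: "poly (of_int_poly (pderiv s_poly)) x = 0"
  have alg: "algebraic_int x"
    unfolding algebraic_int_altdef_ipoly using x lead_coeff_s_poly by blast
  obtain M where M: "prime_over {x :: complex. algebraic_int x} M 7" using ex_prime_over[of 7] by auto
  interpret M: prime_over "{x. algebraic_int x}" M 7 by (fact M)
  have "M.root_mod s_poly_coeffs x"
    unfolding M.root_mod_def using alg x M.M_0 by (simp only: s_poly_def poly_Poly_lval mem_Collect_eq)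
  moreover have "length s_poly_deriv = length s_poly_coeffs" "s_poly_coeffs \<noteq> []"
    by (simp_all add: s_poly_deriv_def s_poly_coeffs_def)
  ultimately have "lval s_poly_deriv x \<notin> M"
    using M.not_in_M_if_unit_mod s_poly_separable_7 by force
  moreover have "lval s_poly_deriv x = 0" using 0 unfolding pderiv_s_poly poly_Poly_lval .
  ultimately show False using M.M_0 by simp
qed

lemma ex_s_roots: "\<exists>z c \<theta> m. s_roots z c \<theta> m"
proof -
  let ?F = "of_int_poly s_poly :: complex poly"
  have "rsquarefree ?F"
    unfolding rsquarefree_roots using s_poly_no_double_root by (simp add: of_int_hom.map_poly_pderiv)
  then have dec: "smult (lead_coeff ?F) (\<Prod>x|poly ?F x = 0. [:-x, 1:]) = ?F"
    by (rule complex_poly_decompose_rsquarefree)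
  have lc: "lead_coeff ?F = 1" using lead_coeff_s_poly by simp
  have F0: "?F \<noteq> 0" using lc by auto
  have prod: "?F = (\<Prod>x|poly ?F x = 0. [:-x, 1:])" using dec unfolding lc by simp
  have "degree ?F = card {x. poly ?F x = 0}"
    by (subst prod, subst degree_prod_sum_eq) simp_all
  then have card: "card {x. poly ?F x = 0} = 10" using degree_s_poly by simp
  have "finite {x. poly ?F x = 0}" by (rule poly_roots_finite[OF F0])
  then obtain z :: "nat \<Rightarrow> complex" where z: "bij_betw z {1..10} {x. poly ?F x = 0}"
    using ex_bij_betw_nat_finite_1[of "{x. poly ?F x = 0}"] card by auto
  have root: "poly ?F (z i) = 0" if "i \<in> {1..10}" for i
    using bij_betwE[OF z] that by blast
  have alg: "algebraic_int (z i)" if "i \<in> {1..10}" for i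
    unfolding algebraic_int_altdef_ipoly using root[OF that] lead_coeff_s_poly by blast
  have "\<exists>c :: nat \<Rightarrow> int. \<forall>i\<in>{1..10}. z i \<in> Qadj (\<Sum>i=1..10. of_int (c i) * z i)"
  proof (rule primitive_element)
    show "of_int_poly s_poly \<noteq> (0 :: rat poly)" using degree_s_poly by auto
    show "rpoly (of_int_poly s_poly) (z i) = 0 \<and> rpoly (pderiv (of_int_poly s_poly)) (z i) \<noteq> 0" if "i \<in> {1..10}" for i
      using root[OF that] s_poly_no_double_root[OF root[OF that]]
      by (simp add: rpoly_of_int_poly flip: of_int_hom.map_poly_pderiv)
    show "algebraic (\<Sum>i=1..k. of_int (c i) * z i)" if "k \<le> 10" for c k
      using that by (intro algebraic_int_imp_algebraic algebraic_int_sum algebraic_int_times alg) auto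
  qed
  then obtain c :: "nat \<Rightarrow> int" where c: "\<And>i. i \<in> {1..10} \<Longrightarrow> z i \<in> Qadj (\<Sum>i=1..10. of_int (c i) * z i)" by blast
  define \<theta> where "\<theta> = (\<Sum>i=1..10. of_int (c i) * z i)"
  have "algebraic \<theta>"
    unfolding \<theta>_def by (intro algebraic_int_imp_algebraic algebraic_int_sum algebraic_int_times alg) auto
  then obtain m where m: "is_min_poly \<theta> m" using ex_min_poly by blast
  have "s_roots z c \<theta> m"
    unfolding s_roots_def
  proof (rule galois_roots.intro)
    show "lead_coeff s_poly = 1" by (rule lead_coeff_s_poly)
    show "of_int_poly s_poly = (\<Prod>i=1..10. [:- z i, 1:])"
      using prod.reindex_bij_betw[OF z, of "\<lambda>x. [:-x, 1:]"] prod by simp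
    show "inj_on z {1..10}" using z by (rule bij_betw_imp_inj_on)
    show "\<theta> = (\<Sum>i=1..10. of_int (c i) * z i)" by (rule \<theta>_def)
    show "z i \<in> Qadj \<theta>" if "i \<in> {1..10}" for i using c[OF that] by (simp add: \<theta>_def)
    show "is_min_poly \<theta> m" by (rule m)
  qed
  then show ?thesis by blast
qed

section \<open>Galois groups\<close>

abbreviation "C_ring \<equiv> (ring_of_type_algebra :: complex ring)"

lemma C_ring_simps [simp]: "carrier C_ring = UNIV" "monoid.mult C_ring = (*)" "monoid.one C_ring = 1" "ring.zero C_ring = 0" "ring.add C_ring = (+)"
  by (simp_all add: ring_of_type_algebra_def)

lemma C_ring_a_inv [simp]: "a_inv C_ring x = - x"
proof -
  interpret field C_ring by (rule field_from_type_algebra)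
  show ?thesis by (rule minus_equality) simp_all
qed

lemma C_ring_m_inv [simp]: "x \<noteq> 0 \<Longrightarrow> m_inv C_ring x = inverse x"
proof -
  assume "x \<noteq> 0"
  interpret field C_ring by (rule field_from_type_algebra)
  show ?thesis by (rule comm_inv_char) (simp_all add: \<open>x \<noteq> 0\<close>)
qed

definition gen_field :: "complex set \<Rightarrow> complex set" where
  "gen_field W = generate_field C_ring W"

lemma gen_field_induct [consumes 1, case_names one incl uminus inverse add mult]:
  assumes "x \<in> gen_field W" and "P 1" and "\<And>w. w \<in> W \<Longrightarrow> P w"
    and "\<And>x. x \<in> gen_field W \<Longrightarrow> P x \<Longrightarrow> P (- x)" and "\<And>x. x \<in> gen_field W \<Longrightarrow> P x \<Longrightarrow> x \<noteq> 0 \<Longrightarrow> P (inverse x)"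
    and "\<And>x y. x \<in> gen_field W \<Longrightarrow> P x \<Longrightarrow> y \<in> gen_field W \<Longrightarrow> P y \<Longrightarrow> P (x + y)"
    and "\<And>x y. x \<in> gen_field W \<Longrightarrow> P x \<Longrightarrow> y \<in> gen_field W \<Longrightarrow> P y \<Longrightarrow> P (x * y)"
  shows "P x"
  using assms(1) unfolding gen_field_def
proof (induction rule: generate_field.induct)
  case (m_inv h)
  then show ?case using assms(5)[of h] by (simp add: gen_field_def)
qed (use assms in \<open>simp_all add: gen_field_def\<close>)

lemma gen_field_closed:
  shows gen_field_1: "1 \<in> gen_field W" and gen_field_incl: "w \<in> W \<Longrightarrow> w \<in> gen_field W"
    and gen_field_uminus: "x \<in> gen_field W \<Longrightarrow> - x \<in> gen_field W"
    and gen_field_add: "x \<in> gen_field W \<Longrightarrow> y \<in> gen_field W \<Longrightarrow> x + y \<in> gen_field W"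
    and gen_field_mult: "x \<in> gen_field W \<Longrightarrow> y \<in> gen_field W \<Longrightarrow> x * y \<in> gen_field W"
  using generate_field.one[of C_ring W] generate_field.incl[of w W C_ring] generate_field.a_inv[of x C_ring W]
    generate_field.eng_add[of x C_ring W y] generate_field.eng_mult[of x C_ring W y]
  by (simp_all add: gen_field_def)

lemma gen_field_inverse: "x \<in> gen_field W \<Longrightarrow> x \<noteq> 0 \<Longrightarrow> inverse x \<in> gen_field W"
  using generate_field.m_inv[of x C_ring W] by (simp add: gen_field_def)

lemma gen_field_0: "0 \<in> gen_field W"
  using gen_field_add[OF gen_field_1 gen_field_uminus[OF gen_field_1]] by simp

lemma gen_field_of_rat: "of_rat r \<in> gen_field W"
proof -
  have nat: "of_nat k \<in> gen_field W" for k
    by (induction k) (simp_all add: gen_field_0 gen_field_1 gen_field_add)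
  have int: "of_int k \<in> gen_field W" for k
    by (cases k) (simp_all add: nat gen_field_uminus del: of_nat_Suc)
  obtain a b where r: "r = of_int a / of_int b" "b \<noteq> 0"
    by (cases r) (auto simp: Fract_of_int_quotient)
  have "(of_int b :: complex) \<noteq> 0" using r(2) by simp
  then have "of_int a * inverse (of_int b) \<in> gen_field W" by (intro gen_field_mult gen_field_inverse int)
  moreover have "of_rat r = (of_int a * inverse (of_int b) :: complex)"
    by (simp add: r of_rat_divide) (simp add: field_simps)
  ultimately show ?thesis by simp
qed

text \<open>Elements of the carrier of \<open>galois_group\<close> in plain terms. Membership in
  \<open>extensional\<close>, inherited from \<open>Bij\<close>, makes automorphisms that agree on L
  equal as functions.\<close>

definition field_aut :: "complex set \<Rightarrow> (complex \<Rightarrow> complex) \<Rightarrow> bool" where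
  "field_aut L \<sigma> \<longleftrightarrow> \<sigma> \<in> extensional L \<and> bij_betw \<sigma> L L \<and> \<sigma> 1 = 1 \<and>
     (\<forall>x\<in>L. \<forall>y\<in>L. \<sigma> (x + y) = \<sigma> x + \<sigma> y \<and> \<sigma> (x * y) = \<sigma> x * \<sigma> y) \<and> (\<forall>q. \<sigma> (of_rat q) = of_rat q)"

lemma carrier_galois_group:
  "carrier (galois_group f) = {\<sigma>. field_aut (gen_field {x. rpoly f x = 0}) \<sigma>}"
  unfolding galois_group_def splitting_field_def Let_def gen_field_def [symmetric] rpoly_def [symmetric]
  by (auto simp: field_aut_def Ring.ring_hom_def Bij_def dest: bij_betwE)

lemma mult_galois_group:
  assumes "\<sigma> \<in> carrier (galois_group f)" "\<tau> \<in> carrier (galois_group f)"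
  shows "\<sigma> \<otimes>\<^bsub>galois_group f\<^esub> \<tau> = compose (gen_field {x. rpoly f x = 0}) \<sigma> \<tau>"
proof -
  let ?L = "gen_field {x. rpoly f x = 0}"
  have "\<sigma> \<in> Bij ?L" "\<tau> \<in> Bij ?L" using assms by (simp_all add: carrier_galois_group field_aut_def Bij_def)
  then show ?thesis
    unfolding galois_group_def splitting_field_def Let_def gen_field_def [symmetric] rpoly_def [symmetric]
    by (simp add: BijGroup_def)
qed

lemma field_aut_uminus:
  assumes "field_aut (gen_field W) \<sigma>" "x \<in> gen_field W"
  shows "\<sigma> (- x) = - \<sigma> x"
proof -
  have "\<sigma> (x + - x) = \<sigma> x + \<sigma> (- x)" using assms gen_field_uminus by (simp only: field_aut_def)
  moreover have "\<sigma> 0 = 0" using assms(1) unfolding field_aut_def by (metis of_rat_0)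
  ultimately show ?thesis by (simp add: eq_neg_iff_add_eq_0 add.commute)
qed

lemma field_aut_inverse:
  assumes "field_aut (gen_field W) \<sigma>" "x \<in> gen_field W" "x \<noteq> 0"
  shows "\<sigma> (inverse x) = inverse (\<sigma> x)"
proof -
  have "\<sigma> (x * inverse x) = \<sigma> x * \<sigma> (inverse x)"
    using assms(1,2) gen_field_inverse[OF assms(2,3)] unfolding field_aut_def by blast
  then have "\<sigma> x * \<sigma> (inverse x) = 1" using assms(1,3) by (simp add: field_aut_def)
  then show ?thesis by (metis inverse_unique)
qed

lemma field_aut_eqI:
  assumes "field_aut (gen_field W) \<sigma>" "field_aut (gen_field W) \<tau>" and W: "\<And>w. w \<in> W \<Longrightarrow> \<sigma> w = \<tau> w"
  shows "\<sigma> = \<tau>"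
proof (rule extensionalityI[of _ "gen_field W"])
  show "\<sigma> \<in> extensional (gen_field W)" "\<tau> \<in> extensional (gen_field W)" using assms by (simp_all add: field_aut_def)
  fix x assume "x \<in> gen_field W"
  then show "\<sigma> x = \<tau> x"
  proof (induction rule: gen_field_induct)
    case (uminus x) then show ?case using assms by (simp add: field_aut_uminus)
  next
    case (inverse x) then show ?case using assms by (simp add: field_aut_inverse)
  qed (use assms in \<open>simp_all add: field_aut_def\<close>)
qed

lemma field_aut_rpoly:
  assumes \<sigma>: "field_aut (gen_field W) \<sigma>" and w: "w \<in> gen_field W"
  shows "rpoly q w \<in> gen_field W \<and> \<sigma> (rpoly q w) = rpoly q (\<sigma> w)"
proof (induction q)
  case 0
  have "\<sigma> 0 = 0" using \<sigma> unfolding field_aut_def by (metis of_rat_0)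
  then show ?case by (simp add: gen_field_0)
next
  case (pCons a q)
  have *: "rpoly (pCons a q) x = of_rat a + x * rpoly q x" for x
    by (simp add: rpoly_def of_rat_hom.map_poly_pCons_hom)
  have mem: "of_rat a \<in> gen_field W" "w * rpoly q w \<in> gen_field W"
    using gen_field_of_rat gen_field_mult w pCons by blast+
  have "\<sigma> (of_rat a + w * rpoly q w) = \<sigma> (of_rat a) + \<sigma> (w * rpoly q w)"
    using \<sigma> mem by (simp only: field_aut_def)
  also have "\<sigma> (w * rpoly q w) = \<sigma> w * \<sigma> (rpoly q w)"
    using \<sigma> w pCons by (simp only: field_aut_def)
  also have "\<sigma> (of_rat a) = of_rat a" using \<sigma> by (simp only: field_aut_def)
  finally show ?case unfolding * using mem pCons gen_field_add by simp
qed

text \<open>An automorphism permutes the roots of f and is determined by that permutation, since the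
  roots generate the field. The assumption \<open>ex\<close> is surjectivity onto the symmetric
  group.\<close>

lemma galois_group_symmetric:
  fixes f :: "rat poly" and r :: "nat \<Rightarrow> complex"
  assumes r: "bij_betw r {1..n} {x. rpoly f x = 0}"
    and ex: "\<And>\<tau>. \<tau> permutes {1..n} \<Longrightarrow>
        \<exists>\<sigma>. field_aut (gen_field {x. rpoly f x = 0}) \<sigma> \<and> (\<forall>i\<in>{1..n}. \<sigma> (r i) = r (\<tau> i))"
  shows "galois_group f \<cong> sym_group n"
proof -
  define W where "W = {x. rpoly f x = 0}"
  define G where "G = carrier (galois_group f)"
  have G: "\<sigma> \<in> G \<longleftrightarrow> field_aut (gen_field W) \<sigma>" for \<sigma> by (simp add: G_def carrier_galois_group W_def)
  have rW: "r i \<in> W" if "i \<in> {1..n}" for i using bij_betwE[OF r] that unfolding W_def by blast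
  have rinj: "i = j" if "i \<in> {1..n}" "j \<in> {1..n}" "r i = r j" for i j
    using bij_betw_imp_inj_on[OF r] that by (meson inj_onD)
  have surj: "\<exists>i\<in>{1..n}. w = r i" if "w \<in> W" for w
    using bij_betw_imp_surj_on[OF r] that unfolding W_def by blast
  have memL: "r i \<in> gen_field W" if "i \<in> {1..n}" for i using gen_field_incl rW[OF that] .
  have root: "\<exists>j\<in>{1..n}. \<sigma> (r i) = r j" if \<sigma>: "\<sigma> \<in> G" and i: "i \<in> {1..n}" for \<sigma> i
  proof -
    have "rpoly f (\<sigma> (r i)) = \<sigma> (rpoly f (r i))"
      using field_aut_rpoly[of W \<sigma> "r i" f] \<sigma> memL[OF i] G by simp
    also have "rpoly f (r i) = 0" using rW[OF i] by (simp add: W_def)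
    also have "\<sigma> 0 = 0" using \<sigma> unfolding G field_aut_def by (metis of_rat_0)
    finally show ?thesis using surj[of "\<sigma> (r i)"] by (simp add: W_def)
  qed
  \<comment> \<open>The induced permutation of the indices, extended by the identity outside 1, ...,
    n as \<open>permutes\<close> demands.\<close>
  define h where "h \<sigma> i = (if i \<in> {1..n} then SOME j. j \<in> {1..n} \<and> \<sigma> (r i) = r j else i)" for \<sigma> i
  have h: "h \<sigma> i \<in> {1..n} \<and> \<sigma> (r i) = r (h \<sigma> i)" if "\<sigma> \<in> G" "i \<in> {1..n}" for \<sigma> i
  proof -
    have "\<exists>j. j \<in> {1..n} \<and> \<sigma> (r i) = r j" using root[OF that] by blast
    from someI_ex[OF this] show ?thesis unfolding h_def if_P[OF that(2)] .
  qed
  have h_out: "h \<sigma> i = i" if "i \<notin> {1..n}" for \<sigma> i unfolding h_def if_not_P[OF that] ..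
  have h_eqI: "h \<sigma> = \<tau>" if "\<sigma> \<in> G" "\<And>i. i \<in> {1..n} \<Longrightarrow> \<tau> i \<in> {1..n} \<and> \<sigma> (r i) = r (\<tau> i)" "\<And>i. i \<notin> {1..n} \<Longrightarrow> \<tau> i = i" for \<sigma> \<tau>
  proof
    fix i show "h \<sigma> i = \<tau> i"
      using h[OF that(1), of i] that(2)[of i] rinj[of "h \<sigma> i" "\<tau> i"] h_out that(3) by (cases "i \<in> {1..n}") metis+
  qed
  have h_perm: "h \<sigma> permutes {1..n}" if \<sigma>: "\<sigma> \<in> G" for \<sigma>
  proof (rule bij_imp_permutes)
    have inj: "inj_on (h \<sigma>) {1..n}"
    proof (rule inj_onI)
      fix i j assume ij: "i \<in> {1..n}" "j \<in> {1..n}" "h \<sigma> i = h \<sigma> j"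
      then have "\<sigma> (r i) = \<sigma> (r j)" using h[OF \<sigma>] by metis
      moreover have "inj_on \<sigma> (gen_field W)" using \<sigma> by (auto simp: G field_aut_def bij_betw_def)
      ultimately have "r i = r j" using memL ij by (meson inj_onD)
      then show "i = j" using rinj ij by blast
    qed
    have "h \<sigma> ` {1..n} = {1..n}" by (rule endo_inj_surj[OF _ _ inj]) (use h[OF \<sigma>] in auto)
    with inj show "bij_betw (h \<sigma>) {1..n} {1..n}" by (simp add: bij_betw_def)
  qed (rule h_out)
  have mult: "\<sigma> \<otimes>\<^bsub>galois_group f\<^esub> \<tau> = compose (gen_field W) \<sigma> \<tau>" if "\<sigma> \<in> G" "\<tau> \<in> G" for \<sigma> \<tau>
    using mult_galois_group[of \<sigma> f \<tau>] that by (simp add: G_def W_def)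
  have closed: "compose (gen_field W) \<sigma> \<tau> \<in> G" if st: "\<sigma> \<in> G" "\<tau> \<in> G" for \<sigma> \<tau>
  proof -
    have s: "field_aut (gen_field W) \<sigma>" and t: "field_aut (gen_field W) \<tau>" using st by (simp_all add: G)
    have "bij_betw (compose (gen_field W) \<sigma> \<tau>) (gen_field W) (gen_field W)"
      using s t by (intro bij_betw_compose) (auto simp: field_aut_def)
    moreover have "\<tau> x \<in> gen_field W" if "x \<in> gen_field W" for x
      using t that by (auto simp: field_aut_def dest: bij_betwE)
    ultimately show ?thesis
      using s t unfolding G field_aut_def
      by (simp add: compose_def gen_field_1 gen_field_add gen_field_mult gen_field_of_rat)
  qed
  have "h \<in> iso (galois_group f) (sym_group n)"
  proof (unfold iso_def, intro CollectI conjI)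
    show "h \<in> hom (galois_group f) (sym_group n)"
    proof (rule homI)
      show "h \<sigma> \<in> carrier (sym_group n)" if "\<sigma> \<in> carrier (galois_group f)" for \<sigma>
        using h_perm that by (simp add: sym_group_carrier G_def)
      fix \<sigma> \<tau> assume "\<sigma> \<in> carrier (galois_group f)" "\<tau> \<in> carrier (galois_group f)"
      then have st: "\<sigma> \<in> G" "\<tau> \<in> G" by (simp_all add: G_def)
      have "h (compose (gen_field W) \<sigma> \<tau>) = h \<sigma> \<circ> h \<tau>"
      proof (rule h_eqI[OF closed[OF st]])
        fix i assume i: "i \<in> {1..n}"
        have "compose (gen_field W) \<sigma> \<tau> (r i) = \<sigma> (\<tau> (r i))" using memL[OF i] by (simp add: compose_eq)
        then show "(h \<sigma> \<circ> h \<tau>) i \<in> {1..n} \<and> compose (gen_field W) \<sigma> \<tau> (r i) = r ((h \<sigma> \<circ> h \<tau>) i)"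
          using h[OF st(2) i] h[OF st(1), of "h \<tau> i"] by simp
      qed (simp add: h_out)
      then show "h (\<sigma> \<otimes>\<^bsub>galois_group f\<^esub> \<tau>) = h \<sigma> \<otimes>\<^bsub>sym_group n\<^esub> h \<tau>"
        by (simp add: mult[OF st] sym_group_mult)
    qed
    show "bij_betw h (carrier (galois_group f)) (carrier (sym_group n))"
      unfolding bij_betw_def
    proof (rule conjI)
      show "inj_on h (carrier (galois_group f))"
      proof (rule inj_onI, fold G_def)
        fix \<sigma> \<tau> assume st: "\<sigma> \<in> G" "\<tau> \<in> G" "h \<sigma> = h \<tau>"
        have "\<sigma> w = \<tau> w" if "w \<in> W" for w
          using surj[OF that] h[OF st(1)] h[OF st(2)] st(3) by metis
        then show "\<sigma> = \<tau>" using field_aut_eqI st by (simp add: G)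
      qed
      show "h ` carrier (galois_group f) = carrier (sym_group n)"
      proof (fold G_def, rule antisym)
        show "h ` G \<subseteq> carrier (sym_group n)" using h_perm by (auto simp: sym_group_carrier)
        show "carrier (sym_group n) \<subseteq> h ` G"
        proof
          fix \<tau> assume "\<tau> \<in> carrier (sym_group n)"
          then have \<tau>: "\<tau> permutes {1..n}" by (simp add: sym_group_carrier)
          obtain \<sigma> where \<sigma>: "\<sigma> \<in> G" "\<And>i. i \<in> {1..n} \<Longrightarrow> \<sigma> (r i) = r (\<tau> i)"
            using ex[OF \<tau>] unfolding W_def [symmetric] G [symmetric] by blast
          have "h \<sigma> = \<tau>"
            by (rule h_eqI[OF \<sigma>(1)]) (use \<sigma>(2) \<tau> in \<open>simp_all only: permutes_in_image permutes_not_in simp_thms\<close>)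
          then show "\<tau> \<in> h ` G" using \<sigma>(1) by blast
        qed
      qed
    qed
  qed
  then show ?thesis by (rule is_isoI)
qed

section \<open>The Galois group and irreducibility\<close>

definition F6_specialized :: "rat poly" where
  "F6_specialized = specialize_H 1 F6_poly"

text \<open>At H = 1 one has h = 25, so h^2 = 625 and 125 F + 32 - 2 h = 125 F - 18.\<close>

lemma F6_specialized_altdef: "F6_specialized = [:1 / 5^30:] * elim_poly [:625:] [:-18, 125:]"
  by (simp add: F6_specialized_def specialize_H_F6_poly power2_eq_square)

lemma degree_F6_specialized: "degree F6_specialized = 10"
proof -
  have "degree (elim_poly [:625:] [:-18, 125 :: rat:]) = 10"
    by (rule elim_poly_leading) simp_all
  then show ?thesis by (simp add: F6_specialized_altdef)
qed

lemma rpoly_F6_specialized: "rpoly F6_specialized x = of_rat (1 / 5^30) * elim_poly 625 (125 * x - 18)"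
proof -
  have "rpoly [:625:] x = 625" "rpoly [:-18, 125:] x = 125 * x - 18"
    by (simp_all add: rpoly_def of_rat_hom.map_poly_pCons_hom)
  then show ?thesis
    unfolding F6_specialized_altdef by (simp only: rpoly.hom_mult rpoly.hom_elim_poly rpoly_simps)
qed

lemma s_poly_equation:
  fixes s :: complex
  assumes "poly (of_int_poly s_poly) s = 0"
  shows "25 * s^5 = (s^5 - 1) * (s + 1)^5" "s \<noteq> 0"
proof -
  have e: "poly (of_int_poly s_poly) x = (x^5 - 1) * (x + 1)^5 - 25 * x^5" for x :: complex
    by (simp add: s_poly_def s_poly_coeffs_def eval_nat_numeral algebra_simps)
  show "25 * s^5 = (s^5 - 1) * (s + 1)^5" using assms unfolding e by simp
  show "s \<noteq> 0" using assms unfolding e by auto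
qed

definition s_num :: "rat poly" where
  "s_num = [:1, 1:]^4 * [:-4, 1, 0, 0, 0, 5:]"

lemma rpoly_s_num: "rpoly s_num s = (s + 1)^4 * (5 * s^5 + s - 4)"
proof -
  have "rpoly [:1, 1:] s = s + 1" "rpoly [:-4, 1, 0, 0, 0, 5:] s = 5 * s^5 + s - 4"
    by (simp_all add: rpoly_def of_rat_hom.map_poly_pCons_hom eval_nat_numeral algebra_simps)
  then show ?thesis unfolding s_num_def by (simp only: rpoly.hom_mult rpoly.hom_power)
qed

definition F_value :: "complex \<Rightarrow> complex" where
  "F_value s = (rpoly s_num s / s^5 - 32) / 125"

lemma F_value_eq: "s \<noteq> 0 \<Longrightarrow> (125 * F_value s + 32) * s^5 = rpoly s_num s"
proof -
  assume "s \<noteq> 0"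
  have "125 * ((c - 32) / 125) + 32 = c" for c :: complex by (simp add: diff_divide_distrib)
  then have "125 * F_value s + 32 = rpoly s_num s / s^5" unfolding F_value_def .
  then show ?thesis using \<open>s \<noteq> 0\<close> by simp
qed

lemma F_value_root:
  assumes "poly (of_int_poly s_poly) s = 0"
  shows "rpoly F6_specialized (F_value s) = 0"
proof -
  note s = s_poly_equation[OF assms]
  have y: "(125 * F_value s + 32) * s^5 = (s + 1)^4 * (5 * s^5 + s - 4)"
    unfolding rpoly_s_num [symmetric] by (rule F_value_eq[OF s(2)])
  have "elim_poly (25^2) ((125 * F_value s + 32) - 2 * 25) = (0 :: complex)"
    by (rule elim_poly_vanishes[of s "inverse s", OF _ s(1) y]) (simp add: s(2))
  moreover have "(25 :: complex)^2 = 625" by simp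
  moreover have "(125 * F_value s + 32) - 2 * 25 = 125 * F_value s - 18" by simp
  ultimately show ?thesis unfolding rpoly_F6_specialized by (simp only: mult_zero_right)
qed

text \<open>A fibre of \<open>F_value\<close> is contained in the zero set of a polynomial of degree 9.\<close>

lemma card_F_value_fibre:
  "finite {s. s \<noteq> 0 \<and> F_value s = y}" "card {s. s \<noteq> 0 \<and> F_value s = y} \<le> 9"
proof -
  define N :: "complex poly" where "N = [:1, 1:]^4 * [:-4, 1, 0, 0, 0, 5:] - monom (125 * y + 32) 5"
  have l: "[:1, 1:]^4 * [:-4, 1, 0, 0, 0, 5:] = [:-4, -15, -20, -10, 0, 6, 20, 30, 20, 5 :: complex:]"
    by (simp add: eval_nat_numeral)
  have deg: "degree N \<le> 9"
    unfolding N_def l by (intro degree_diff_le order_trans[OF degree_monom_le]) simp_all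
  have "coeff N 9 = 5" unfolding N_def l by (simp add: eval_nat_numeral)
  then have N0: "N \<noteq> 0" by auto
  have "poly N s = 0" if "s \<noteq> 0" "F_value s = y" for s
  proof -
    have "(125 * y + 32) * s^5 = (s + 1)^4 * (5 * s^5 + s - 4)"
      unfolding rpoly_s_num [symmetric] using F_value_eq[OF that(1)] that(2) by simp
    moreover have "poly N s = (s + 1)^4 * (5 * s^5 + s - 4) - (125 * y + 32) * s^5"
      by (simp add: N_def poly_monom add.commute) (simp add: eval_nat_numeral algebra_simps)
    ultimately show ?thesis by simp
  qed
  then have sub: "{s. s \<noteq> 0 \<and> F_value s = y} \<subseteq> {s. poly N s = 0}" by blast
  show "finite {s. s \<noteq> 0 \<and> F_value s = y}" by (rule finite_subset[OF sub poly_roots_finite[OF N0]])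
  have "card {s. s \<noteq> 0 \<and> F_value s = y} \<le> card {s. poly N s = 0}"
    by (rule card_mono[OF poly_roots_finite[OF N0] sub])
  also have "\<dots> \<le> 9" using card_poly_roots_bound[OF N0] deg by linarith
  finally show "card {s. s \<noteq> 0 \<and> F_value s = y} \<le> 9" .
qed

section \<open>The ten values F(s) and their conjugates\<close>

context s_roots
begin

definition F_root :: "nat \<Rightarrow> complex" where "F_root i = F_value (z i)"

lemma z_nonzero: "i \<in> {1..10} \<Longrightarrow> z i \<noteq> 0"
  using s_poly_equation(2) root_s_poly by blast

lemma F_root_Qadj: "i \<in> {1..10} \<Longrightarrow> F_root i \<in> Qadj \<theta>"
proof -
  assume i: "i \<in> {1..10}"
  have "rpoly s_num (z i) \<in> Qadj \<theta>" using Qadj_subset[OF z_Qadj[OF i]] by blast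
  then show ?thesis
    unfolding F_root_def F_value_def
    by (intro Qadj_divide Qadj_diff Qadj_power algebraic_theta z_Qadj[OF i] Qadj_simps)
qed

text \<open>F(s) is a rational expression in s with rational coefficients. Clearing the denominator
  s^5 leaves polynomial values only, through which \<open>conj t\<close> passes.\<close>

lemma conj_F_root:
  assumes t: "t \<in> conjugates" and i: "i \<in> {1..10}"
  shows "conj t (F_root i) = F_root (perm t i)"
proof -
  let ?a = "[:32, 125:] :: rat poly" and ?m = "monom 1 5 :: rat poly"
  have a: "rpoly ?a x = 125 * x + 32" and m: "rpoly ?m x = x^5" for x
    by (simp_all add: rpoly_def of_rat_hom.map_poly_pCons_hom map_poly_monom poly_monom add.commute)
  have z': "z (perm t i) \<noteq> 0" by (rule z_nonzero[OF perm_mem[OF t i]])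
  have "rpoly ?a (F_root i) * rpoly ?m (z i) = rpoly s_num (z i)"
    unfolding a m F_root_def by (rule F_value_eq[OF z_nonzero[OF i]])
  then have "conj t (rpoly ?a (F_root i) * rpoly ?m (z i)) = conj t (rpoly s_num (z i))" by simp
  moreover have "rpoly ?a (F_root i) \<in> Qadj \<theta>" "rpoly ?m (z i) \<in> Qadj \<theta>"
    using Qadj_subset[OF F_root_Qadj[OF i]] Qadj_subset[OF z_Qadj[OF i]] by blast+
  ultimately have "rpoly ?a (conj t (F_root i)) * rpoly ?m (z (perm t i)) = rpoly s_num (z (perm t i))"
    unfolding z_perm[OF t i]
    by (simp only: conj_mult[OF t] conj_compose_rpoly[OF t F_root_Qadj[OF i]] conj_compose_rpoly[OF t z_Qadj[OF i]])
  then have "125 * conj t (F_root i) + 32 = rpoly s_num (z (perm t i)) / z (perm t i) ^ 5"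
    unfolding a m using z' by (simp add: field_simps)
  moreover have "x = (125 * x + 32 - 32) / 125" for x :: complex by simp
  ultimately show ?thesis unfolding F_root_def F_value_def by metis
qed

lemma ex_conj_perm:
  assumes "\<tau> permutes {1..10}"
  obtains t where "t \<in> conjugates" "\<And>i. i \<in> {1..10} \<Longrightarrow> conj t (F_root i) = F_root (\<tau> i)"
  using perms_all[OF assms] conj_F_root unfolding perms_def by blast

text \<open>If the values at i and j agree, conjugation by the transposition (i k) fixes the value
  at j and moves that at i to the one at k, so all ten values agree.\<close>

lemma inj_F_root: "inj_on F_root {1..10}"
proof (rule ccontr)
  assume "\<not> ?thesis"
  then obtain i j where ij: "i \<in> {1..10}" "j \<in> {1..10}" "i \<noteq> j" "F_root i = F_root j"
    by (auto simp: inj_on_def)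
  have all_eq: "F_root k = F_root j" if k: "k \<in> {1..10}" for k
  proof (cases "k = j")
    case False
    have "Transposition.transpose i k permutes {1..10}" by (rule permutes_swap_id[OF ij(1) k])
    then obtain t where t: "t \<in> conjugates" "\<And>l. l \<in> {1..10} \<Longrightarrow> conj t (F_root l) = F_root (Transposition.transpose i k l)"
      using ex_conj_perm by blast
    have "F_root k = conj t (F_root i)" using t(2)[OF ij(1)] by simp
    also have "\<dots> = conj t (F_root j)" using ij(4) by simp
    also have "\<dots> = F_root j" using t(2)[OF ij(2)] ij(3) False by simp
    finally show ?thesis .
  qed simp
  have "z ` {1..10} \<subseteq> {s. s \<noteq> 0 \<and> F_value s = F_root j}"
    using all_eq z_nonzero by (auto simp: F_root_def)
  then have "card (z ` {1..10}) \<le> card {s. s \<noteq> 0 \<and> F_value s = F_root j}"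
    by (intro card_mono card_F_value_fibre)
  also have "\<dots> \<le> 9" by (rule card_F_value_fibre)
  finally show False using card_image[OF inj_z] by simp
qed

lemma F_root_bij: "bij_betw F_root {1..10} {x. rpoly F6_specialized x = 0}"
proof -
  let ?P = "map_poly of_rat F6_specialized :: complex poly"
  have P0: "?P \<noteq> 0" using degree_F6_specialized by auto
  have sub: "F_root ` {1..10} \<subseteq> {x. poly ?P x = 0}"
    using F_value_root[OF root_s_poly] unfolding F_root_def rpoly_def by blast
  have "card {x. poly ?P x = 0} \<le> 10" using card_poly_roots_bound[OF P0] degree_F6_specialized by simp
  moreover have "card (F_root ` {1..10}) = 10" using card_image[OF inj_F_root] by simp
  moreover have "card (F_root ` {1..10}) \<le> card {x. poly ?P x = 0}"
    by (rule card_mono[OF poly_roots_finite[OF P0] sub])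
  ultimately have "F_root ` {1..10} = {x. poly ?P x = 0}"
    by (intro card_subset_eq[OF poly_roots_finite[OF P0] sub]) linarith
  then show ?thesis using inj_F_root by (simp add: bij_betw_def rpoly_def)
qed

abbreviation "L \<equiv> gen_field {x. rpoly F6_specialized x = 0}"

lemma L_Qadj: "x \<in> L \<Longrightarrow> x \<in> Qadj \<theta>"
proof (induction rule: gen_field_induct)
  case (incl w)
  then obtain i where "i \<in> {1..10}" "w = F_root i" using bij_betw_imp_surj_on[OF F_root_bij] by blast
  then show ?case using F_root_Qadj by blast
qed (simp_all add: Qadj_uminus Qadj_add Qadj_mult Qadj_inverse algebraic_theta)

lemma conj_L:
  assumes t: "t \<in> conjugates"
  shows "x \<in> L \<Longrightarrow> conj t x \<in> L"
proof (induction rule: gen_field_induct)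
  case one
  then show ?case by (simp add: conj_1[OF t] gen_field_1)
next
  case (incl w)
  then obtain i where i: "i \<in> {1..10}" "w = F_root i" using bij_betw_imp_surj_on[OF F_root_bij] by blast
  then have "conj t w = F_root (perm t i)" using conj_F_root[OF t] by blast
  then show ?case using bij_betwE[OF F_root_bij] perm_mem[OF t i(1)] gen_field_incl by metis
next
  case (uminus x)
  then show ?case by (simp add: conj_uminus[OF t] L_Qadj gen_field_uminus)
next
  case (inverse x)
  have "conj t x * conj t (inverse x) = conj t (x * inverse x)"
    using inverse L_Qadj Qadj_inverse algebraic_theta by (simp only: conj_mult[OF t])
  then have 1: "conj t x * conj t (inverse x) = 1" using inverse by (simp add: conj_1[OF t])
  then have "conj t (inverse x) = inverse (conj t x)" by (metis inverse_unique)
  moreover have "conj t x \<noteq> 0" using 1 by auto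
  ultimately show ?case using inverse gen_field_inverse by simp
next
  case (add x y)
  then show ?case by (simp add: conj_add[OF t] L_Qadj gen_field_add)
next
  case (mult x y)
  then show ?case by (simp add: conj_mult[OF t] L_Qadj gen_field_mult)
qed

text \<open>Surjectivity on L comes from a conjugate t' with \<open>conj t t' = \<theta>\<close>:
  then \<open>conj t'\<close> is a right inverse of \<open>conj t\<close>, and it also maps L into
  itself.\<close>

lemma field_aut_conj:
  assumes t: "t \<in> conjugates"
  shows "field_aut L (restrict (conj t) L)"
proof -
  have "\<theta> \<in> conj t ` conjugates"
    using bij_betw_imp_surj_on[OF bij_conj[OF t]] theta_conjugate by (simp only:)
  then obtain t' where t': "\<theta> = conj t t'" "t' \<in> conjugates" by (rule imageE)
  have "x \<in> conj t ` L" if "x \<in> L" for x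
  proof
    show "x = conj t (conj t' x)"
      unfolding conj_conj[OF t t'(2) L_Qadj[OF that]] t'(1) [symmetric] by (rule conj_theta_id[OF L_Qadj[OF that], symmetric])
    show "conj t' x \<in> L" by (rule conj_L[OF t'(2) that])
  qed
  then have "conj t ` L = L" using conj_L[OF t] by blast
  moreover have "inj_on (conj t) L" using conj_inj[OF t] L_Qadj by (meson inj_on_subset subsetI)
  ultimately have "bij_betw (conj t) L L" by (simp add: bij_betw_def)
  then have "bij_betw (restrict (conj t) L) L L" by (simp add: bij_betw_restrict_eq)
  then show ?thesis
    unfolding field_aut_def
    by (simp add: conj_add[OF t] conj_mult[OF t] L_Qadj conj_1[OF t] conj_of_rat[OF t]
        gen_field_1 gen_field_add gen_field_mult gen_field_of_rat)
qed

lemma galois_group_F6_specialized: "galois_group F6_specialized \<cong> sym_group 10"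
proof (rule galois_group_symmetric[OF F_root_bij])
  fix \<tau> :: "nat \<Rightarrow> nat" assume "\<tau> permutes {1..10}"
  then obtain t where t: "t \<in> conjugates" "\<And>i. i \<in> {1..10} \<Longrightarrow> conj t (F_root i) = F_root (\<tau> i)"
    by (rule ex_conj_perm) blast
  have "F_root i \<in> L" if "i \<in> {1..10}" for i
    using bij_betwE[OF F_root_bij] that gen_field_incl by blast
  then have "\<forall>i\<in>{1..10}. restrict (conj t) L (F_root i) = F_root (\<tau> i)" using t(2) by simp
  then show "\<exists>\<sigma>. field_aut L \<sigma> \<and> (\<forall>i\<in>{1..10}. \<sigma> (F_root i) = F_root (\<tau> i))"
    using field_aut_conj[OF t(1)] by blast
qed

text \<open>A nonconstant factor a has some F_root i as a root; the embeddings realizing the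
  transpositions (i j) carry it to all ten values, so a has degree at least 10.\<close>

lemma F6_specialized_factor:
  assumes "F6_specialized = a * b"
  shows "degree a = 0 \<or> degree b = 0"
proof (rule ccontr)
  assume *: "\<not> ?thesis"
  have nz: "F6_specialized \<noteq> 0" using degree_F6_specialized by auto
  then have ab: "a \<noteq> 0" "b \<noteq> 0" using assms by auto
  let ?a = "map_poly of_rat a :: complex poly"
  have "\<not> constant (poly ?a)" using * by (simp add: constant_degree)
  then obtain x where x: "rpoly a x = 0" using fundamental_theorem_of_algebra unfolding rpoly_def by blast
  then have "rpoly F6_specialized x = 0" by (simp add: assms rpoly.hom_mult)
  then obtain i where i: "i \<in> {1..10}" "x = F_root i" using bij_betw_imp_surj_on[OF F_root_bij] by blast
  have "rpoly a (F_root j) = 0" if j: "j \<in> {1..10}" for j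
  proof -
    have "Transposition.transpose i j permutes {1..10}" by (rule permutes_swap_id[OF i(1) j])
    then obtain t where t: "t \<in> conjugates" "\<And>l. l \<in> {1..10} \<Longrightarrow> conj t (F_root l) = F_root (Transposition.transpose i j l)"
      using ex_conj_perm by blast
    have "rpoly a (F_root j) = rpoly a (conj t (F_root i))" using t(2)[OF i(1)] by simp
    also have "\<dots> = conj t (rpoly a (F_root i))" by (rule conj_compose_rpoly[OF t(1) F_root_Qadj[OF i(1)], symmetric])
    finally show ?thesis using x i by (simp add: conj_0[OF t(1)])
  qed
  then have sub: "F_root ` {1..10} \<subseteq> {x. poly ?a x = 0}" by (auto simp: rpoly_def)
  have a0: "?a \<noteq> 0" using ab by simp
  have "10 = card (F_root ` {1..10})" using card_image[OF inj_F_root] by simp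
  also have "\<dots> \<le> card {x. poly ?a x = 0}" by (rule card_mono[OF poly_roots_finite[OF a0] sub])
  also have "\<dots> \<le> degree a" using card_poly_roots_bound[OF a0] by simp
  finally have "10 \<le> degree a" .
  moreover have "degree a + degree b = 10"
    using degree_mult_eq[OF ab] degree_F6_specialized assms by simp
  ultimately show False using * by simp
qed

end

section \<open>From P(1,F) to irreducibility in two variables\<close>

lemma specialize_H_mult: "specialize_H a (p * q) = specialize_H a p * specialize_H a q"
proof -
  interpret e: map_poly_comm_ring_hom "\<lambda>c. poly c a" by unfold_locales simp_all
  show ?thesis unfolding specialize_H_def by (rule e.hom_mult)
qed

text \<open>In a factorization of a monic polynomial the leading coefficients are units of Q[H], so
  no degree drops at H = 1. A factor that becomes constant was already constant, equal to its unit
  leading coefficient.\<close>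

lemma irreducible_F6_poly: "irreducible F6_poly"
proof (rule irreducibleI)
  obtain z c \<theta> m where "s_roots z c \<theta> m" using ex_s_roots by blast
  then interpret s_roots z c \<theta> m .
  have lc: "lead_coeff F6_poly = 1" using F6_poly_monic by simp
  show "F6_poly \<noteq> 0" using lc by auto
  show "\<not> F6_poly dvd 1" using F6_poly_monic(1) by (metis poly_dvd_1 zero_neq_numeral)
  fix a b assume ab: "F6_poly = a * b"
  have "lead_coeff a * lead_coeff b = 1" using lc unfolding ab by (simp add: lead_coeff_mult)
  then have u: "is_unit (lead_coeff a)" "is_unit (lead_coeff b)" by (metis dvdI, metis dvdI mult.commute)
  have spec_deg: "degree (specialize_H 1 p) = degree p" if up: "is_unit (lead_coeff p)" for p
  proof -
    obtain k where "lead_coeff p = [:k:]" "k dvd 1" using up unfolding is_unit_poly_iff by blast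
    then have "poly (lead_coeff p) 1 \<noteq> 0" by auto
    then show ?thesis
      unfolding specialize_H_def by (intro map_poly_degree_eq) simp
  qed
  have "F6_specialized = specialize_H 1 a * specialize_H 1 b"
    by (simp add: F6_specialized_def ab specialize_H_mult)
  then have "degree a = 0 \<or> degree b = 0"
    using F6_specialized_factor spec_deg u by metis
  moreover have "is_unit p" if "degree p = 0" "is_unit (lead_coeff p)" for p :: "rat poly poly"
    using that by (metis degree_eq_zeroE is_unit_const_poly_iff lead_coeff_pCons(2))
  ultimately show "a dvd 1 \<or> b dvd 1" using u by blast
qed

theorem mainTheorem11:
  shows "\<exists>P :: rat poly poly.
    Polynomial.degree P = 10 \<and>
    Factorial_Ring.irreducible (map_poly to_fract P :: rat poly fract poly) \<and>
    eval_at_series P (F6_at 1) = 0 \<and>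
    specialize_H 0 P =
      Polynomial.smult (1 / 5 ^ 21) ([:0, 1:] * [:32, 125:] ^ 5 * [:11, 75, 125:] ^ 2) \<and>
    galois_group (specialize_H 1 P) \<cong> sym_group 10"
proof (intro exI[of _ F6_poly] conjI)
  show "Polynomial.degree F6_poly = 10" by (rule F6_poly_monic)
  \<comment> \<open>Gauss's lemma passes from Q[H][F] to Q(H)[F].\<close>
  show "Factorial_Ring.irreducible (map_poly to_fract F6_poly)"
    using irreducible_F6_poly nonconst_poly_irreducible_iff[of F6_poly] F6_poly_monic(1) by simp
  show "specialize_H 0 F6_poly =
      Polynomial.smult (1 / 5 ^ 21) ([:0, 1:] * [:32, 125:] ^ 5 * [:11, 75, 125:] ^ 2)"
    by (rule specialize_H_0_F6_poly)
  obtain z c \<theta> m where "s_roots z c \<theta> m" using ex_s_roots by blast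
  then interpret s_roots z c \<theta> m .
  show "galois_group (specialize_H 1 F6_poly) \<cong> sym_group 10"
    using galois_group_F6_specialized unfolding F6_specialized_def .
  obtain S :: "rat fps" where S: "fps_nth S 0 = 1"
    "(S ^ 5 - 1) * (S + 1) ^ 5 = 25 * fps_X * S ^ 5"
    "(125 * F6_at 1 + 32) * S ^ 5 = (S + 1) ^ 4 * (5 * S ^ 5 + S - 4)"
    by (rule F6_at_one_closed_form)
  have "S * inverse S = 1" by (rule inverse_mult_eq_1') (simp add: S)
  from elim_poly_vanishes[OF this S(2)[symmetric] S(3)]
  have "elim_poly ((25 * fps_X)^2) (125 * F6_at 1 + 32 - 2 * (25 * fps_X)) = 0" .
  then show "eval_at_series F6_poly (F6_at 1) = 0"
    unfolding eval_at_series_F6_poly by (simp only: mult_zero_right)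
qed


end
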